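(* Let $f\not\equiv 0$ be a holomorphic (resp. real analytic) function defined in a neighbourhood of the origin in $\mathbb{C}^2$ (resp. $\mathbb{R}^2$), with coordinates $(x,y)$, and with $f(0,0)=0$. Then there exists a holomorphic (resp. real analytic) function germ $Q$ of one variable with $Q(0)=0$ and a change of coordinates of the form \[ (\tilde x,\tilde y)=(x-Q(y),\,y)\quad\text{or}\quad(\tilde x,\tilde y)=(x,\,y-Q(x)) \] such that \[ c_0(f)=2\,\delta_{NP}\qquad(\text{resp. } c_0(f)=\delta_{NP}), \] where $\delta_{NP}$ is the Newton distance of $f$ expressed in the coordinates $(\tilde x,\tilde y)$.
   Context: The critical integrability index of $f$ at the origin is $c_0(f):=\sup\{c>0:\exists\,\epsilon>0 \text{ such that } \int_{B_\epsilon(0)}|f|^{-c}<+\infty\}$, the integral being with respect to Lebesgue measure on $\mathbb{C}^2\cong\mathbb{R}^4$ (resp. $\mathbb{R}^2$). Given coordinates $(u,v)$ centered at the origin and the power series expansion $f=\sum_{(p,q)\in\mathbb{N}^2}a_{p,q}u^pv^q$ (with $0\in\mathbb{N}$), the Newton polyhedron $NP(f)\subset\mathbb{R}^2_{\geq0}$ is the convex hull of $\bigcup_{a_{p,q}\neq0}\big((p,q)+\mathbb{R}^2_{\geq0}\big)$. The Newton distance $\delta_{NP}$ of $f$ in these coordinates is defined by \[ \delta_{NP}^{-1}=\inf\{t\geq0:(t,t)\in NP(f)\}, \] i.e. $(\delta_{NP}^{-1},\delta_{NP}^{-1})$ is the point where the diagonal meets $\partial NP(f)$. The Newton polyhedron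 depends on the choice of coordinates. *)

theory Defs
  imports "HOL-Complex_Analysis.Complex_Analysis"
begin

(* Complex Frechet differentiability: the total derivative at every point is complex linear. *)
definition holomorphic2_on :: "(complex \<times> complex \<Rightarrow> complex) \<Rightarrow> (complex \<times> complex) set \<Rightarrow> bool"
  where "holomorphic2_on f U \<longleftrightarrow>
    (\<forall>z\<in>U. \<exists>A B. (f has_derivative (\<lambda>(h, k). A * h + B * k)) (at z))"

definition has_power_series2 ::
  "('a::real_normed_field \<times> 'a \<Rightarrow> 'a) \<Rightarrow> (nat \<times> nat \<Rightarrow> 'a) \<Rightarrow> 'a \<times> 'a \<Rightarrow> bool"
  where "has_power_series2 f a z \<longleftrightarrow>
    (\<exists>r>0. \<forall>u v. norm u < r \<longrightarrow> norm v < r \<longrightarrow>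
      ((\<lambda>(p, q). a (p, q) * u ^ p * v ^ q) has_sum f (z + (u, v))) UNIV)"

definition real_analytic2_on :: "(real \<times> real \<Rightarrow> real) \<Rightarrow> (real \<times> real) set \<Rightarrow> bool"
  where "real_analytic2_on f U \<longleftrightarrow> (\<forall>z\<in>U. \<exists>a. has_power_series2 f a z)"

(* Over the reals and the complex numbers the expansion of a function at the origin is
   unique when it exists. *)
definition power_series_coeff :: "('a::real_normed_field \<times> 'a \<Rightarrow> 'a) \<Rightarrow> nat \<times> nat \<Rightarrow> 'a"
  where "power_series_coeff f = (THE a. has_power_series2 f a 0)"

definition newton_polyhedron :: "('a::real_normed_field \<times> 'a \<Rightarrow> 'a) \<Rightarrow> (real \<times> real) set"
  where "newton_polyhedron f = convex hull
    (\<Union>(p, q)\<in>{pq. power_series_coeff f pq \<noteq> 0}. {(s, t). real p \<le> s \<and> real q \<le> t})"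

definition newton_distance :: "('a::real_normed_field \<times> 'a \<Rightarrow> 'a) \<Rightarrow> real"
  where "newton_distance f = inverse (Inf {t. 0 \<le> t \<and> (t, t) \<in> newton_polyhedron f})"

(* The inverse is taken in ennreal, so that the integrand is infinite on the zero set of f
   (whereas 0 powr (- c) = 0).  The supremum is taken in the extended reals. *)
definition critical_integrability_index ::
  "('a::euclidean_space \<Rightarrow> 'b::real_normed_vector) \<Rightarrow> ereal"
  where "critical_integrability_index f =
    (SUP c\<in>{c. 0 < c \<and> (\<exists>\<epsilon>>0.
        (\<integral>\<^sup>+z\<in>ball 0 \<epsilon>. inverse (ennreal (norm (f z) powr c)) \<partial>lborel) < \<infinity>)}. ereal c)"

end

theory Submission
  imports Defs
begin

text \<open>
  Let e be the real dimension of the field, which is \<real> or \<complex>; almost everything is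
  stated for the class {real_normed_field, euclidean_space} and covers both. For f with expansion a
  at the origin let d be the parameter at which the diagonal enters the Newton polyhedron, so that
  the Newton distance is 1 / d. The assertion is that |f|^(-c) is locally integrable for c < e / d
  and not for c > e / d, after a suitable shear of the coordinates.

  One half holds in all coordinates: a supporting line of the polyhedron at (d, d) gives weights
  \<kappa>1, \<kappa>2 such that f = O(\<lambda>^((\<kappa>1 + \<kappa>2) d)) on the polydisc of
  radii \<lambda>^\<kappa>1, \<lambda>^\<kappa>2, and the volume \<lambda>^(e (\<kappa>1 +
  \<kappa>2)) of these polydiscs is too large for |f|^(-c) to be integrable
  (not_neg_integrable_above_exit). Shears and the exchange of coordinates preserve Lebesgue measure,
  hence do not change the critical index.

  For integrability, take an edge of the polyhedron on a line i + k j = N meeting the diagonal, and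
  rescale x = t \<sigma> with |\<sigma>| = 1, y = t^k z. Then f = t^N (p(\<sigma>, z) + o(1)) with
  the edge polynomial p. If p(\<sigma>, _) has order s at a point z0, divided differences of f over
  s + 1 points near z0 are bounded below by a multiple of t^N. As in van der Corput's lemma, this
  bounds the measure of the sublevel sets |f| \<le> \<epsilon> t^N in the slice by a multiple of
  \<epsilon>^(e / s), and this argument does not distinguish between \<real> and \<complex>.
  Compactness of the sphere and of discs in z, and integration over t, show that |f|^(-c) is
  integrable if c N < e (1 + k) and c s < e for all occurring orders s (neg_integrable_if_weights).
  Since N / (1 + k) \<le> d, this suffices whenever no edge polynomial p(\<sigma>, _) has a root of
  order greater than N / (1 + k): the coordinates are then adapted. If the diagonal meets an
  unbounded face instead, weights with k tending to infinity show the same (adapted_horizontal).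

  Suppose that there is a root z0 \<noteq> 0 of larger order, where k \<ge> 1 after exchanging the
  coordinates. A polynomial with T terms has order less than T at z0, and an edge with k not an
  integer has too few terms for such a root, so k is an integer K (adapted_or_root). If the root has
  order m, the equation \<partial>_z^(m-1) (f(x, x^K z) / x^N) = 0 has a solution z = Z(x) with Z(0)
  = z0 by the implicit function theorem, and the shear by Q(x) = x^K Z(x) makes (N - K m, m) a
  vertex of the polyhedron and cancels all terms x^i y^(m-1) (straighten_complex). Among all sheared
  coordinates choose those in which the vertex above the diagonal has minimal height m. A further
  root of too large an order would again have order m by minimality, so its edge polynomial would
  contain the power z^(m-1), which is no longer present. So one straightening at this height is
  enough (adapted_shear_from_vertex), and neither Puiseux series nor a limit of infinitely many
  coordinate changes is involved. The real case is obtained by complexification, because the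
  implicit function Z is real on the real line when f and z0 are real (straightenable_real).
\<close>

section \<open>Convergent double power series\<close>

definition double_series :: "(nat \<times> nat \<Rightarrow> 'a::{real_normed_field,banach}) \<Rightarrow> 'a \<Rightarrow> 'a \<Rightarrow> 'a"
  where "double_series a x y = (\<Sum>\<^sub>\<infinity>(i, j). a (i, j) * x ^ i * y ^ j)"

text \<open>
  Absolute convergence on the closed polydisc of radii r and R, stated through the coefficients so
  that no point of the polydisc has to be chosen.
\<close>
definition abs_conv :: "(nat \<times> nat \<Rightarrow> 'a::{real_normed_field,banach}) \<Rightarrow> real \<Rightarrow> real \<Rightarrow> bool"
  where "abs_conv a r R \<longleftrightarrow> (\<lambda>(i, j). norm (a (i, j)) * r ^ i * R ^ j) summable_on UNIV"

lemma abs_conv_mono: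
  assumes "abs_conv a r R" "0 \<le> r'" "r' \<le> r" "0 \<le> R'" "R' \<le> R"
  shows "abs_conv a r' R'"
  using assms(1) unfolding abs_conv_def
proof (rule summable_on_comparison_test, goal_cases)
  case (1 ij)
  then show ?case using assms
    by (auto simp: case_prod_beta intro!: mult_mono power_mono)
next
  case (2 ij)
  then show ?case using assms by (auto simp: case_prod_beta)
qed

lemma abs_conv_has_sum:
  assumes "abs_conv a r R" "norm x \<le> r" "norm y \<le> R"
  shows "((\<lambda>(i, j). a (i, j) * x ^ i * y ^ j) has_sum double_series a x y) UNIV"
proof -
  have "(\<lambda>ij. norm ((\<lambda>(i, j). a (i, j) * x ^ i * y ^ j) ij)) summable_on UNIV"
    using abs_conv_mono[OF assms(1) norm_ge_zero assms(2) norm_ge_zero assms(3)]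
    by (simp add: abs_conv_def case_prod_unfold norm_mult norm_power)
  then show ?thesis
    unfolding double_series_def by (rule has_sum_infsum[OF abs_summable_summable])
qed

lemma geometric_double_summable:
  fixes s t :: real
  assumes "0 \<le> s" "s < 1" "0 \<le> t" "t < 1"
  shows "(\<lambda>(i, j). s ^ i * t ^ j) summable_on (UNIV :: (nat \<times> nat) set)"
proof -
  have g: "((\<lambda>i. u ^ i) has_sum (1 / (1 - u))) UNIV" if "0 \<le> u" "u < 1" for u :: real
    using that by (intro sums_nonneg_imp_has_sum) (auto intro: geometric_sums)
  have "(\<lambda>(i, j). s ^ i * t ^ j) summable_on (Sigma (UNIV :: nat set) (\<lambda>_. UNIV :: nat set))"
  proof (rule summable_on_SigmaI)
    show "((\<lambda>y. (case (x, y) of (i, j) \<Rightarrow> s ^ i * t ^ j)) has_sum s ^ x * (1 / (1 - t))) UNIV" for x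
      using has_sum_cmult_right[OF g[OF assms(3,4)], of "s ^ x"] by simp
    show "(\<lambda>x. s ^ x * (1 / (1 - t))) summable_on UNIV"
      using has_sum_cmult_left[OF g[OF assms(1,2)], of "1 / (1 - t)"] by (auto simp: summable_on_def)
  qed (use assms in auto)
  then show ?thesis by simp
qed

lemma abs_conv_if_bounded:
  assumes "\<And>i j. norm (a (i, j)) * r ^ i * R ^ j \<le> M" "0 \<le> r'" "r' < r" "0 \<le> R'" "R' < R"
  shows "abs_conv a r' R'"
  unfolding abs_conv_def
proof (rule summable_on_comparison_test)
  show "(\<lambda>ij. M * (\<lambda>(i, j). (r' / r) ^ i * (R' / R) ^ j) ij) summable_on UNIV"
    using assms by (intro summable_on_cmult_right geometric_double_summable) auto
next
  fix ij :: "nat \<times> nat"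
  obtain i j where ij: "ij = (i, j)" by force
  have "norm (a (i, j)) * r' ^ i * R' ^ j
      = (norm (a (i, j)) * r ^ i * R ^ j) * ((r' / r) ^ i * (R' / R) ^ j)"
    using assms by (simp add: power_divide)
  also have "\<dots> \<le> M * ((r' / r) ^ i * (R' / R) ^ j)"
    using assms by (intro mult_right_mono) auto
  finally show "(case ij of (i, j) \<Rightarrow> norm (a (i, j)) * r' ^ i * R' ^ j)
      \<le> M * (case ij of (i, j) \<Rightarrow> (r' / r) ^ i * (R' / R) ^ j)"
    by (simp add: ij)
qed (use assms in auto)

lemma has_sum_imp_bounded_terms:
  fixes f :: "'b \<Rightarrow> 'a::real_normed_vector"
  assumes "(f has_sum S) A"
  shows "\<exists>M. \<forall>x\<in>A. norm (f x) \<le> M"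
proof -
  have "eventually (\<lambda>X. dist (sum f X) S < 1) (finite_subsets_at_top A)"
    using assms unfolding has_sum_def by (auto dest: tendstoD[where e=1])
  then obtain F where F: "finite F" "F \<subseteq> A"
    and *: "\<And>Y. finite Y \<Longrightarrow> F \<subseteq> Y \<Longrightarrow> Y \<subseteq> A \<Longrightarrow> dist (sum f Y) S < 1"
    by (auto simp: eventually_finite_subsets_at_top)
  have "norm (f x) \<le> 2 + (\<Sum>y\<in>F. norm (f y))" if "x \<in> A" for x
  proof (cases "x \<in> F")
    case True
    then have "norm (f x) \<le> (\<Sum>y\<in>F. norm (f y))"
      using F by (intro member_le_sum) auto
    then show ?thesis by simp
  next
    case False
    have "dist (sum f (insert x F)) S < 1" "dist (sum f F) S < 1"
      using F that by (auto intro!: *)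
    then have "norm (sum f (insert x F) - sum f F) < 2"
      by (smt (verit) dist_norm dist_triangle2)
    then have "norm (f x) < 2" using False F by simp
    moreover have "(\<Sum>y\<in>F. norm (f y)) \<ge> 0" by (intro sum_nonneg) auto
    ultimately show ?thesis by linarith
  qed
  then show ?thesis by blast
qed

text \<open>
  An unconditionally convergent series has bounded terms, and bounded terms at one radius give a
  geometric majorant at every smaller one. So unconditional convergence on a polydisc can be traded
  for absolute convergence on a smaller polydisc, where sums can be rearranged.
\<close>
lemma has_power_series2_iff:
  fixes f :: "'a::{real_normed_field,banach} \<times> 'a \<Rightarrow> 'a"
  shows "has_power_series2 f a 0 \<longleftrightarrow>
    (\<exists>r>0. abs_conv a r r \<and> (\<forall>x y. norm x < r \<longrightarrow> norm y < r \<longrightarrow> f (x, y) = double_series a x y))"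
proof
  assume "has_power_series2 f a 0"
  then obtain r where r: "r > 0"
    and S: "\<And>u v. norm u < r \<Longrightarrow> norm v < r \<Longrightarrow> ((\<lambda>(p, q). a (p, q) * u ^ p * v ^ q) has_sum f (u, v)) UNIV"
    by (auto simp: has_power_series2_def)
  have nn: "norm (of_real (r/2) :: 'a) = r/2" using r by simp
  have lt: "norm (of_real (r/2) :: 'a) < r" using nn r by simp
  obtain M where M: "\<forall>ij\<in>UNIV.
      norm ((\<lambda>(p, q). a (p, q) * of_real (r/2) ^ p * of_real (r/2) ^ q) ij) \<le> M"
    using has_sum_imp_bounded_terms[OF S[OF lt lt]] by (elim exE)
  have c: "abs_conv a (r/4) (r/4)"
  proof (rule abs_conv_if_bounded[where r="r/2" and R="r/2" and M=M])
    fix i j show "norm (a (i, j)) * (r/2) ^ i * (r/2) ^ j \<le> M"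
      using bspec[OF M UNIV_I, of "(i, j)"] nn by (simp only: case_prod_conv norm_mult norm_power)
  qed (use r in auto)
  show "\<exists>r>0. abs_conv a r r \<and> (\<forall>x y. norm x < r \<longrightarrow> norm y < r \<longrightarrow> f (x, y) = double_series a x y)"
  proof (intro exI[of _ "r/4"] conjI allI impI c)
    fix x y :: 'a assume xy: "norm x < r/4" "norm y < r/4"
    show "f (x, y) = double_series a x y"
      using S[of x y] abs_conv_has_sum[OF c, of x y] xy r by (auto dest: has_sum_unique)
  qed (use r in auto)
next
  assume "\<exists>r>0. abs_conv a r r \<and> (\<forall>x y. norm x < r \<longrightarrow> norm y < r \<longrightarrow> f (x, y) = double_series a x y)"
  then obtain r where "r > 0" and c: "abs_conv a r r"
    and "\<And>x y. norm x < r \<Longrightarrow> norm y < r \<Longrightarrow> f (x, y) = double_series a x y" by auto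
  then show "has_power_series2 f a 0"
    unfolding has_power_series2_def
    by (intro exI[of _ r]) (auto intro!: abs_conv_has_sum[OF c])
qed

lemma power_series_zero_coeffs:
  fixes c :: "nat \<Rightarrow> 'a::{real_normed_field,banach}"
  assumes "0 < r" and "\<And>x. norm x < r \<Longrightarrow> ((\<lambda>n. c n * x ^ n) has_sum 0) UNIV"
  shows "c n = 0"
proof (rule ccontr)
  assume nz: "c n \<noteq> 0"
  have sums: "(\<lambda>n. c n * x ^ n) sums 0" if "norm x < r" for x
    using assms(2)[OF that] by (rule has_sum_imp_sums)
  have "c 0 = 0"
    using sums[of 0] assms(1) sums_unique2 powser_sums_zero by fastforce
  then have "n > 0" using nz by (cases n) auto
  obtain s where s: "0 < s" "\<And>z::'a. z \<in> cball 0 s - {0} \<Longrightarrow> (0::'a) \<noteq> 0"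
    using powser_0_nonzero[of r 0 c "\<lambda>_. 0" n] assms(1) sums nz \<open>n > 0\<close> by auto
  then show False using s(2)[of "of_real s"] by auto
qed

lemma double_series_iterated:
  assumes "abs_conv a r R" "norm x \<le> r" "norm y \<le> R" "0 < r"
  shows "((\<lambda>i. (\<Sum>\<^sub>\<infinity>j. a (i, j) * y ^ j) * x ^ i) has_sum double_series a x y) UNIV"
    "((\<lambda>j. a (i, j) * y ^ j) has_sum (\<Sum>\<^sub>\<infinity>j. a (i, j) * y ^ j)) UNIV"
proof -
  have inner: "((\<lambda>j. a (i, j) * y ^ j) has_sum (\<Sum>\<^sub>\<infinity>j. a (i, j) * y ^ j)) UNIV" for i
  proof -
    have "(\<lambda>(i, j). norm (a (i, j)) * r ^ i * norm y ^ j) summable_on UNIV \<times> UNIV"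
      using abs_conv_mono[OF assms(1), of r "norm y"] assms by (simp add: abs_conv_def)
    from summable_on_SigmaD1[of "\<lambda>i j. norm (a (i, j)) * r ^ i * norm y ^ j", OF this, of i]
    have "(\<lambda>j. (norm (a (i, j)) * r ^ i * norm y ^ j) * inverse (r ^ i)) summable_on UNIV"
      by (intro summable_on_cmult_left) auto
    then have "(\<lambda>j. norm (a (i, j) * y ^ j)) summable_on UNIV"
      using assms(4) by (simp add: field_simps norm_mult norm_power)
    then have "(\<lambda>j. a (i, j) * y ^ j) summable_on UNIV"
      by (rule abs_summable_summable)
    then show ?thesis by (rule has_sum_infsum)
  qed
  show "((\<lambda>j. a (i, j) * y ^ j) has_sum (\<Sum>\<^sub>\<infinity>j. a (i, j) * y ^ j)) UNIV" by (rule inner)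
  have "((\<lambda>ij. (\<lambda>(i, j). a (i, j) * x ^ i * y ^ j) ij) has_sum double_series a x y) (UNIV \<times> UNIV)"
    using abs_conv_has_sum[OF assms(1-3)] by simp
  then show "((\<lambda>i. (\<Sum>\<^sub>\<infinity>j. a (i, j) * y ^ j) * x ^ i) has_sum double_series a x y) UNIV"
  proof (rule has_sum_SigmaD)
    fix i
    show "((\<lambda>j. (case (i, j) of (i, j) \<Rightarrow> a (i, j) * x ^ i * y ^ j)) has_sum
        (\<Sum>\<^sub>\<infinity>j. a (i, j) * y ^ j) * x ^ i) UNIV"
      using has_sum_cmult_left[OF inner[of i], of "x ^ i"] by (simp add: mult_ac)
  qed
qed

lemma double_series_eq_0D:
  fixes a :: "nat \<times> nat \<Rightarrow> 'a::{real_normed_field,banach}"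
  assumes "abs_conv a r R" "0 < r" "0 < R"
    and "\<And>x y. norm x < r \<Longrightarrow> norm y < R \<Longrightarrow> double_series a x y = 0"
  shows "a ij = 0"
proof -
  obtain i j where ij: "ij = (i, j)" by force
  have "(\<Sum>\<^sub>\<infinity>j. a (i, j) * y ^ j) = 0" if y: "norm y < R" for y i
  proof (rule power_series_zero_coeffs[OF assms(2)])
    fix x :: 'a assume x: "norm x < r"
    show "((\<lambda>n. (\<Sum>\<^sub>\<infinity>j. a (n, j) * y ^ j) * x ^ n) has_sum 0) UNIV"
      using double_series_iterated(1)[OF assms(1), of x y] x y assms(2,4) by simp
  qed
  then have "((\<lambda>j. a (i, j) * y ^ j) has_sum 0) UNIV" if y: "norm y < R" for y i
    using double_series_iterated(2)[OF assms(1), of 0 y i] assms(2) y by simp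
  from power_series_zero_coeffs[OF assms(3) this] show ?thesis by (simp add: ij)
qed

lemma continuous_on_double_series:
  assumes "abs_conv a r R"
  shows "continuous_on (cball 0 r \<times> cball 0 R) (\<lambda>(x, y). double_series a x y)"
proof -
  have "uniform_limit (cball 0 r \<times> cball 0 R)
      (\<lambda>X xy. \<Sum>ij\<in>X. (case ij of (i, j) \<Rightarrow> a (i, j) * fst xy ^ i * snd xy ^ j))
      (\<lambda>(x, y). double_series a x y) (finite_subsets_at_top UNIV)"
  proof (rule Weierstrass_m_test_general')
    show "(\<lambda>(i, j). norm (a (i, j)) * r ^ i * R ^ j) summable_on UNIV"
      using assms by (simp add: abs_conv_def)
    show "norm (case ij of (i, j) \<Rightarrow> a (i, j) * fst xy ^ i * snd xy ^ j)
        \<le> (case ij of (i, j) \<Rightarrow> norm (a (i, j)) * r ^ i * R ^ j)"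
      if "xy \<in> cball 0 r \<times> cball 0 R" for ij xy
    proof -
      have "norm (fst xy) \<le> r" "norm (snd xy) \<le> R" "0 \<le> r" "0 \<le> R"
        using that order_trans[OF norm_ge_zero] by (auto simp: mem_Times_iff)
      then show ?thesis
        by (auto simp: case_prod_unfold norm_mult norm_power intro!: mult_mono power_mono)
    qed
    show "((\<lambda>ij. case ij of (i, j) \<Rightarrow> a (i, j) * fst xy ^ i * snd xy ^ j) has_sum
        (case xy of (x, y) \<Rightarrow> double_series a x y)) UNIV"
      if "xy \<in> cball 0 r \<times> cball 0 R" for xy
      using that abs_conv_has_sum[OF assms, of "fst xy" "snd xy"] by (auto simp: case_prod_unfold)
  qed
  then show ?thesis
    by (rule uniform_limit_theorem[rotated])
      (auto intro!: always_eventually continuous_intros simp: case_prod_unfold)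
qed

text \<open>
  The identity theorem: this makes the expansion of a germ, and hence its Newton polyhedron,
  independent of the chosen representation.
\<close>
lemma double_series_cong_coeffs:
  assumes "abs_conv a r r" "abs_conv b s s" "0 < r" "0 < s"
    and "\<forall>\<^sub>F (x, y) in nhds (0, 0). double_series a x y = double_series b x y"
  shows "a = b"
proof -
  obtain e where e: "e > 0" "\<And>x y. dist (x, y) (0, 0) < e \<Longrightarrow> double_series a x y = double_series b x y"
    using assms(5) unfolding eventually_nhds_metric by auto
  define t where "t = Min {r, s, e / 2}"
  have t: "t > 0" "t \<le> r" "t \<le> s" "t \<le> e / 2" using assms e by (auto simp: t_def)
  have ca: "abs_conv a t t" and cb: "abs_conv b t t"
    using abs_conv_mono[OF assms(1), of t t] abs_conv_mono[OF assms(2), of t t] t by auto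
  let ?d = "\<lambda>ij. a ij - b ij"
  have "abs_conv ?d t t"
    unfolding abs_conv_def
  proof (rule summable_on_comparison_test)
    show "(\<lambda>ij. (case ij of (i, j) \<Rightarrow> norm (a (i, j)) * t ^ i * t ^ j)
        + (case ij of (i, j) \<Rightarrow> norm (b (i, j)) * t ^ i * t ^ j)) summable_on UNIV"
      using ca cb unfolding abs_conv_def by (rule summable_on_add)
    fix ij :: "nat \<times> nat"
    have "norm (?d ij) * (t ^ fst ij * t ^ snd ij)
        \<le> (norm (a ij) + norm (b ij)) * (t ^ fst ij * t ^ snd ij)"
      using t by (intro mult_right_mono norm_triangle_ineq4) auto
    then show "(case ij of (i, j) \<Rightarrow> norm (a (i, j) - b (i, j)) * t ^ i * t ^ j)
       \<le> (case ij of (i, j) \<Rightarrow> norm (a (i, j)) * t ^ i * t ^ j)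
        + (case ij of (i, j) \<Rightarrow> norm (b (i, j)) * t ^ i * t ^ j)"
      by (simp add: case_prod_unfold algebra_simps)
  qed (use t in auto)
  moreover have "double_series ?d x y = 0" if "norm x < t" "norm y < t" for x y
  proof -
    have "((\<lambda>ij. (case ij of (i, j) \<Rightarrow> a (i, j) * x ^ i * y ^ j)
        - (case ij of (i, j) \<Rightarrow> b (i, j) * x ^ i * y ^ j)) has_sum
        (double_series a x y - double_series b x y)) UNIV"
      using has_sum_add[OF abs_conv_has_sum[OF ca, of x y] has_sum_uminusI[OF abs_conv_has_sum[OF cb, of x y]]] that
      by simp
    moreover have "dist (x, y) (0, 0) < e"
      using that t norm_Pair_le[of x y] by (simp add: dist_norm)
    ultimately have "((\<lambda>(i, j). (a (i, j) - b (i, j)) * x ^ i * y ^ j) has_sum 0) UNIV"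
      using e(2)[of x y] by (simp add: case_prod_unfold algebra_simps)
    then show ?thesis unfolding double_series_def by (rule infsumI)
  qed
  ultimately have "?d ij = 0" for ij using double_series_eq_0D[of ?d t t] t by blast
  then show ?thesis by (simp add: fun_eq_iff)
qed

lemma power_series_coeff_eq:
  fixes f :: "'a::{real_normed_field,banach} \<times> 'a \<Rightarrow> 'a"
  assumes "has_power_series2 f a 0"
  shows "power_series_coeff f = a"
  unfolding power_series_coeff_def
proof (rule the_equality)
  fix b assume "has_power_series2 f b 0"
  then obtain s where s: "s > 0" "abs_conv b s s"
    "\<And>x y. norm x < s \<Longrightarrow> norm y < s \<Longrightarrow> f (x, y) = double_series b x y"
    by (auto simp: has_power_series2_iff)
  obtain r where r: "r > 0" "abs_conv a r r"
    "\<And>x y. norm x < r \<Longrightarrow> norm y < r \<Longrightarrow> f (x, y) = double_series a x y"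
    using assms by (auto simp: has_power_series2_iff)
  have "\<forall>\<^sub>F (x, y) in nhds (0, 0). double_series b x y = double_series a x y"
    unfolding eventually_nhds_metric
  proof (intro exI[of _ "min r s"] conjI allI impI)
    fix z :: "'a \<times> 'a" assume "dist z (0, 0) < min r s"
    moreover obtain x y where "z = (x, y)" by force
    ultimately show "case z of (x, y) \<Rightarrow> double_series b x y = double_series a x y"
      using norm_fst_le[of x y] norm_snd_le[of y x] r(3)[of x y] s(3)[of x y]
      by (auto simp: dist_norm)
  qed (use r s in auto)
  then show "b = a" using double_series_cong_coeffs[OF s(2) r(2) s(1) r(1)] by blast
qed (rule assms)

section \<open>Divided differences\<close>

text \<open>
  Lagrange's formula for the leading coefficient of the interpolation polynomial of h at the points
  of S. In contrast to a mean value theorem it is available over \<real> and over \<complex> alike.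
\<close>
definition divided_difference :: "'a::field set \<Rightarrow> ('a \<Rightarrow> 'a) \<Rightarrow> 'a"
  where "divided_difference S h = (\<Sum>s\<in>S. h s / (\<Prod>t\<in>S-{s}. s - t))"

text \<open>
  The factor s - u cancels against the denominator and kills the summand at u. The Leibniz rule and
  the values on powers rest on this cancellation.
\<close>
lemma divided_difference_shift_factor:
  assumes "finite S" "u \<in> S"
  shows "divided_difference S (\<lambda>z. (z - u) * p z) = divided_difference (S - {u}) p"
proof -
  have "divided_difference S (\<lambda>z. (z - u) * p z) =
      (\<Sum>s\<in>S-{u}. (s - u) * p s / (\<Prod>t\<in>S-{s}. s - t))"
    unfolding divided_difference_def using assms by (simp add: sum.remove)
  also have "\<dots> = (\<Sum>s\<in>S-{u}. p s / (\<Prod>t\<in>S-{u}-{s}. s - t))"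
  proof (rule sum.cong[OF refl])
    fix s assume s: "s \<in> S - {u}"
    have "(\<Prod>t\<in>S-{s}. s - t) = (s - u) * (\<Prod>t\<in>S-{s}-{u}. s - t)"
      using assms s by (intro prod.remove) auto
    moreover have "S - {s} - {u} = S - {u} - {s}" by auto
    ultimately show "(s - u) * p s / (\<Prod>t\<in>S-{s}. s - t) = p s / (\<Prod>t\<in>S-{u}-{s}. s - t)"
      using s by simp
  qed
  finally show ?thesis unfolding divided_difference_def .
qed

lemma divided_difference_add:
  "divided_difference S (\<lambda>z. p z + q z) = divided_difference S p + divided_difference S q"
  by (simp add: divided_difference_def add_divide_distrib sum.distrib)

lemma divided_difference_diff:
  "divided_difference S (\<lambda>z. p z - q z) = divided_difference S p - divided_difference S q"
  by (simp add: divided_difference_def diff_divide_distrib sum_subtractf)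

lemma divided_difference_cmult:
  "divided_difference S (\<lambda>z. c * p z) = c * divided_difference S p"
  by (simp add: divided_difference_def sum_distrib_left)

lemma divided_difference_cmult_right:
  "divided_difference S (\<lambda>z. p z * c) = divided_difference S p * c"
  by (simp add: divided_difference_def sum_distrib_right)

lemma divided_difference_sum:
  "divided_difference S (\<lambda>z. \<Sum>i\<in>I. p i z) = (\<Sum>i\<in>I. divided_difference S (p i))"
  unfolding divided_difference_def by (subst sum.swap) (simp add: sum_divide_distrib)

lemma divided_difference_Leibniz:
  assumes "finite S" "u \<in> S"
  shows "divided_difference S (\<lambda>z. z * p z) = u * divided_difference S p + divided_difference (S - {u}) p"
proof -
  have "divided_difference S (\<lambda>z. z * p z) = divided_difference S (\<lambda>z. u * p z + (z - u) * p z)"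
    by (simp add: algebra_simps)
  then show ?thesis
    by (simp add: divided_difference_add divided_difference_cmult divided_difference_shift_factor[OF assms])
qed

lemma divided_difference_const:
  assumes "finite S" "card S = Suc n"
  shows "divided_difference S (\<lambda>z. 1) = (if n = 0 then 1 else 0)"
  using assms
proof (induction n arbitrary: S)
  case 0
  then obtain u where "S = {u}" by (metis One_nat_def card_1_singletonE)
  then show ?case by (simp add: divided_difference_def)
next
  case (Suc n)
  obtain u where u: "u \<in> S" using Suc.prems by (metis card.empty ex_in_conv nat.distinct(1))
  have "card (S - {u}) = Suc n" using Suc.prems u by simp
  then have "S - {u} \<noteq> {}" by (metis card.empty nat.distinct(1))
  then obtain v where v: "v \<in> S" "v \<noteq> u" by blast
  have "divided_difference S (\<lambda>z. (z - u) * 1) = divided_difference (S - {u}) (\<lambda>z. 1)"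
    "divided_difference S (\<lambda>z. (z - v) * 1) = divided_difference (S - {v}) (\<lambda>z. 1)"
    using divided_difference_shift_factor[of S u "\<lambda>_. 1"] divided_difference_shift_factor[of S v "\<lambda>_. 1"]
      Suc.prems u v by simp_all
  moreover have "card (S - {u}) = Suc n" "card (S - {v}) = Suc n"
    using Suc.prems u v by auto
  ultimately have "divided_difference S (\<lambda>z. (z - u) * 1) = divided_difference S (\<lambda>z. (z - v) * 1)"
    using Suc.IH[of "S - {u}"] Suc.IH[of "S - {v}"] Suc.prems by simp
  then have "divided_difference S (\<lambda>z. (z - u) * 1 - (z - v) * 1) = 0"
    unfolding divided_difference_diff by simp
  then have "(v - u) * divided_difference S (\<lambda>z. 1) = 0"
    using divided_difference_cmult[of S "v - u" "\<lambda>z. 1"] by simp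
  then show ?case using v by simp
qed

lemma divided_difference_power:
  assumes "finite S" "card S = Suc n" "j \<le> n"
  shows "divided_difference S (\<lambda>z. z ^ j) = (if j = n then 1 else 0)"
  using assms
proof (induction j arbitrary: n S)
  case 0
  then show ?case using divided_difference_const[of S n] by simp
next
  case (Suc j)
  obtain u where u: "u \<in> S" using Suc.prems by (metis card.empty ex_in_conv nat.distinct(1))
  obtain n' where n': "n = Suc n'" using Suc.prems by (cases n) auto
  have "divided_difference S (\<lambda>z. z ^ Suc j)
      = u * divided_difference S (\<lambda>z. z ^ j) + divided_difference (S - {u}) (\<lambda>z. z ^ j)"
    using divided_difference_Leibniz[OF Suc.prems(1) u, of "\<lambda>z. z ^ j"] by simp
  also have "\<dots> = (if Suc j = n then 1 else 0)"
    using Suc.IH[of S n] Suc.IH[of "S - {u}" n'] Suc.prems u n' by simp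
  finally show ?case .
qed

text \<open>
  The divided difference of z^(n+j) is the complete homogeneous polynomial of degree j in the n + 1
  points, which has (n + j choose n) monomials; the Leibniz rule reproduces Pascal's recursion.
\<close>
lemma norm_divided_difference_power_le:
  fixes S :: "'a::real_normed_field set"
  assumes "finite S" "card S = Suc n" "\<And>s. s \<in> S \<Longrightarrow> norm s \<le> r"
  shows "norm (divided_difference S (\<lambda>z. z ^ (n + j))) \<le> real ((n + j) choose n) * r ^ j"
  using assms
proof (induction "n + j" arbitrary: n j S rule: less_induct)
  case less
  show ?case
  proof (cases j)
    case 0
    then show ?thesis using divided_difference_power[OF less.prems(1,2), of n] by simp
  next
    case (Suc j')
    obtain u where u: "u \<in> S" using less.prems by (metis card.empty ex_in_conv nat.distinct(1))
    then have r: "r \<ge> 0" using less.prems(3)[of u] norm_ge_zero[of u] by linarith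
    have eq: "divided_difference S (\<lambda>z. z ^ (n + j))
      = u * divided_difference S (\<lambda>z. z ^ (n + j')) + divided_difference (S - {u}) (\<lambda>z. z ^ (n + j'))"
      using divided_difference_Leibniz[OF less.prems(1) u, of "\<lambda>z. z ^ (n + j')"] Suc by simp
    have 1: "norm (u * divided_difference S (\<lambda>z. z ^ (n + j')))
        \<le> r * (real ((n + j') choose n) * r ^ j')"
      unfolding norm_mult using less.hyps[of n j'] less.prems Suc u r
      by (intro mult_mono) auto
    show ?thesis
    proof (cases n)
      case 0
      then obtain v where "S = {v}" using less.prems by (metis One_nat_def card_1_singletonE)
      then have "S - {u} = {}" using u by auto
      then have "divided_difference (S - {u}) (\<lambda>z. z ^ (n + j')) = 0"
        by (simp only: divided_difference_def sum.empty)
      with 1 eq show ?thesis using 0 Suc by simp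
    next
      case (Suc n')
      have "norm (divided_difference (S - {u}) (\<lambda>z. z ^ (n' + j))) \<le> real ((n' + j) choose n') * r ^ j"
        using Suc less.prems u by (intro less.hyps) auto
      moreover have "n' + j = n + j'" using Suc \<open>j = Suc j'\<close> by simp
      ultimately have "norm (divided_difference (S - {u}) (\<lambda>z. z ^ (n + j')))
          \<le> real ((n + j') choose n') * r ^ j" by simp
      then have "norm (divided_difference S (\<lambda>z. z ^ (n + j)))
          \<le> r * (real ((n + j') choose n) * r ^ j') + real ((n + j') choose n') * r ^ j"
        unfolding eq using 1 by (intro norm_triangle_le add_mono)
      also have "\<dots> = real ((n + j) choose n) * r ^ j"
        using Suc \<open>j = Suc j'\<close> by (simp add: algebra_simps)
      finally show ?thesis .
    qed
  qed
qed

corollary norm_divided_difference_power_le':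
  fixes S :: "'a::real_normed_field set"
  assumes "finite S" "card S = Suc n" "\<And>s. s \<in> S \<Longrightarrow> norm s \<le> r"
  shows "norm (divided_difference S (\<lambda>z. z ^ j)) \<le> real (j choose n) * r ^ (j - n)"
proof (cases "j < n")
  case True
  then show ?thesis using divided_difference_power[OF assms(1,2), of j] by simp
next
  case False
  then show ?thesis using norm_divided_difference_power_le[OF assms, of "j - n"] by simp
qed

lemma divided_difference_translate:
  "divided_difference ((+) c ` S) h = divided_difference S (\<lambda>z. h (c + z))"
proof -
  have "(\<Prod>t\<in>(+) c ` S - {c + s}. c + s - t) = (\<Prod>t\<in>S-{s}. s - t)" for s
  proof -
    have "(+) c ` S - {c + s} = (+) c ` (S - {s})" by auto
    then show ?thesis by (simp add: prod.reindex)
  qed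
  then show ?thesis
    by (simp add: divided_difference_def sum.reindex)
qed

text \<open>
  As the n + 1 points of S tend to z, the divided difference tends to the n-th Taylor coefficient of
  w^j at z. The error is linear in r with an explicit constant, as needed for summing over j.
\<close>
lemma divided_difference_near_point:
  fixes S :: "'a::real_normed_field set"
  assumes "finite S" "card S = Suc n" "\<And>s. s \<in> S \<Longrightarrow> norm (s - z) \<le> r" "r \<le> 1"
  shows "norm (divided_difference S (\<lambda>w. w ^ j) - of_nat (j choose n) * z ^ (j - n))
    \<le> r * (\<Sum>l\<le>j. real (j choose l) * real (l choose n) * norm z ^ (j - l))"
proof -
  define T where "T = (+) (- z) ` S"
  have ST: "S = (+) z ` T" unfolding T_def by (force simp: image_image)
  have T: "finite T" "card T = Suc n" "\<And>t. t \<in> T \<Longrightarrow> norm t \<le> r"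
    using assms by (auto simp: T_def card_image)
  obtain t where "t \<in> T" using T(2) by (metis card.empty ex_in_conv nat.distinct(1))
  then have r0: "r \<ge> 0" using T(3)[of t] norm_ge_zero[of t] by linarith
  have "divided_difference S (\<lambda>w. w ^ j) = divided_difference T (\<lambda>w. (w + z) ^ j)"
    unfolding ST divided_difference_translate by (simp add: add.commute)
  also have "\<dots> = (\<Sum>l\<le>j. divided_difference T (\<lambda>w. w ^ l) * (of_nat (j choose l) * z ^ (j - l)))"
    unfolding binomial_ring divided_difference_sum
    by (simp add: divided_difference_cmult_right[symmetric]) (simp add: mult_ac)
  finally have eq: "divided_difference S (\<lambda>w. w ^ j) =
     (\<Sum>l\<le>j. divided_difference T (\<lambda>w. w ^ l) * (of_nat (j choose l) * z ^ (j - l)))" .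
  have main: "of_nat (j choose n) * z ^ (j - n) =
      (\<Sum>l\<le>j. (if l = n then 1 else 0) * (of_nat (j choose l) * z ^ (j - l)))"
    by (cases "n \<le> j") (auto simp: sum.delta if_distrib[of "\<lambda>x. x * _"] cong: if_cong)
  have "norm (divided_difference S (\<lambda>w. w ^ j) - of_nat (j choose n) * z ^ (j - n))
    = norm (\<Sum>l\<le>j. (divided_difference T (\<lambda>w. w ^ l) - (if l = n then 1 else 0)) * (of_nat (j choose l) * z ^ (j - l)))"
    unfolding eq main by (simp add: sum_subtractf[symmetric] left_diff_distrib)
  also have "\<dots> \<le> (\<Sum>l\<le>j. (r * real (l choose n)) * (real (j choose l) * norm z ^ (j - l)))"
  proof (rule order_trans[OF norm_sum sum_mono])
    fix l assume "l \<in> {..j}"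
    have "norm (divided_difference T (\<lambda>w. w ^ l) - (if l = n then 1 else 0)) \<le> r * real (l choose n)"
    proof (cases "l \<le> n")
      case True
      then show ?thesis using divided_difference_power[OF T(1,2) True] r0 by simp
    next
      case False
      then have "norm (divided_difference T (\<lambda>w. w ^ l)) \<le> real (l choose n) * r ^ (l - n)"
        using norm_divided_difference_power_le'[OF T] by blast
      also have "r ^ (l - n) \<le> r ^ 1" using r0 assms(4) False by (intro power_decreasing) auto
      finally show ?thesis using False r0 by (simp add: mult_ac mult_left_mono)
    qed
    then show "norm ((divided_difference T (\<lambda>w. w ^ l) - (if l = n then 1 else 0)) * (of_nat (j choose l) * z ^ (j - l)))
      \<le> (r * real (l choose n)) * (real (j choose l) * norm z ^ (j - l))"
      unfolding norm_mult norm_power norm_of_nat by (intro mult_right_mono) auto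
  qed
  also have "\<dots> = r * (\<Sum>l\<le>j. real (j choose l) * real (l choose n) * norm z ^ (j - l))"
    by (simp add: sum_distrib_left mult_ac)
  finally show ?thesis .
qed

text \<open>
  If h is small at well separated points then so is its divided difference. Read backwards, a lower
  bound for divided differences prevents a sublevel set of h from containing n + 1 well separated
  points.
\<close>
lemma norm_divided_difference_separated:
  fixes S :: "'a::real_normed_field set"
  assumes "finite S" "card S = Suc n" "0 < d" "\<And>s t. s \<in> S \<Longrightarrow> t \<in> S \<Longrightarrow> s \<noteq> t \<Longrightarrow> d \<le> dist s t"
    and "\<And>s. s \<in> S \<Longrightarrow> norm (h s) \<le> e"
  shows "norm (divided_difference S h) \<le> real (Suc n) * e / d ^ n"
proof -
  have "norm (h s / (\<Prod>t\<in>S-{s}. s - t)) \<le> e / d ^ n" if s: "s \<in> S" for s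
  proof -
    have "d ^ n = (\<Prod>t\<in>S-{s}. d)" using s assms by simp
    also have "\<dots> \<le> (\<Prod>t\<in>S-{s}. norm (s - t))"
      using assms s by (intro prod_mono) (auto simp: dist_norm)
    finally have "d ^ n \<le> norm (\<Prod>t\<in>S-{s}. s - t)" by (simp add: prod_norm)
    then show ?thesis
      unfolding norm_divide using assms(3,5) s order_trans[OF norm_ge_zero assms(5)[OF s]]
      by (intro frac_le) auto
  qed
  then have "norm (divided_difference S h) \<le> real (card S) * (e / d ^ n)"
    unfolding divided_difference_def by (intro sum_norm_bound)
  then show ?thesis using assms by simp
qed

section \<open>Sublevel sets and integrals of negative powers\<close>

text \<open>
  A maximal d-separated subset has at most n points, and by maximality the d-balls around it cover.
\<close>
lemma separated_subset_cover:
  fixes E :: "'a::metric_space set"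
  assumes "0 < d"
    and "\<And>S. finite S \<Longrightarrow> S \<subseteq> E \<Longrightarrow> card S = Suc n \<Longrightarrow> \<exists>s\<in>S. \<exists>t\<in>S. s \<noteq> t \<and> dist s t < d"
  shows "\<exists>F. finite F \<and> card F \<le> n \<and> E \<subseteq> (\<Union>p\<in>F. ball p d)"
proof -
  define P where "P F \<longleftrightarrow> finite F \<and> F \<subseteq> E \<and> (\<forall>s\<in>F. \<forall>t\<in>F. s \<noteq> t \<longrightarrow> d \<le> dist s t)" for F
  have card: "card F \<le> n" if "P F" for F
  proof (rule ccontr)
    assume "\<not> card F \<le> n"
    then obtain S where S: "S \<subseteq> F" "card S = Suc n" "finite S"
      by (metis not_less_eq_eq obtain_subset_with_card_n)
    then show False using assms(2)[of S] that unfolding P_def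
      by (meson leD order.trans subset_iff)
  qed
  have "P {}" by (simp add: P_def)
  moreover have "\<forall>F. P F \<longrightarrow> card F < Suc n" using card by (simp add: less_Suc_eq_le)
  ultimately obtain F where F: "P F" "\<And>G. P G \<Longrightarrow> card G \<le> card F"
    using ex_has_greatest_nat[of P "{}" card "Suc n"] by blast
  have "E \<subseteq> (\<Union>p\<in>F. ball p d)"
  proof
    fix x assume x: "x \<in> E"
    show "x \<in> (\<Union>p\<in>F. ball p d)"
    proof (rule ccontr)
      assume "x \<notin> (\<Union>p\<in>F. ball p d)"
      then have *: "\<forall>p\<in>F. d \<le> dist p x" by force
      then have "x \<notin> F" using assms(1) by force
      moreover have "P (insert x F)"
        using F(1) * x unfolding P_def by (auto simp: dist_commute)
      ultimately show False using F(2)[of "insert x F"] F(1) by (simp add: P_def)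
    qed
  qed
  then show ?thesis using F(1) card by (auto simp: P_def)
qed

text \<open>
  A counterpart of van der Corput's sublevel estimate, with a lower bound on the n-th derivative
  replaced by one on n-th divided differences: the sublevel set is covered by n balls of radius
  proportional to e^(1/n).
\<close>
lemma sublevel_measure_le:
  fixes A :: "'a::{real_normed_field,euclidean_space} set"
  assumes "0 < n" "0 < \<eta>" "0 < e"
    and "{z \<in> A. norm (h z) \<le> e} \<in> sets lborel"
    and dd: "\<And>S. finite S \<Longrightarrow> S \<subseteq> A \<Longrightarrow> card S = Suc n \<Longrightarrow> \<eta> \<le> norm (divided_difference S h)"
  shows "emeasure lborel {z \<in> A. norm (h z) \<le> e} \<le>
     ennreal (real n * unit_ball_vol (real DIM('a)) * (2 * real (Suc n) / \<eta>) powr (real DIM('a) / n)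
        * e powr (real DIM('a) / n))"
proof -
  define d where "d = (2 * real (Suc n) * e / \<eta>) powr (1 / n)"
  have d0: "d > 0" using assms by (simp add: d_def)
  have dn: "d ^ n = 2 * real (Suc n) * e / \<eta>"
    using assms by (simp add: d_def powr_realpow[symmetric] powr_powr)
  let ?E = "{z \<in> A. norm (h z) \<le> e}"
  have "\<exists>F. finite F \<and> card F \<le> n \<and> ?E \<subseteq> (\<Union>p\<in>F. ball p d)"
  proof (rule separated_subset_cover[OF d0])
    fix S assume S: "finite S" "S \<subseteq> ?E" "card S = Suc n"
    show "\<exists>s\<in>S. \<exists>t\<in>S. s \<noteq> t \<and> dist s t < d"
    proof (rule ccontr)
      assume "\<not> ?thesis"
      then have "norm (divided_difference S h) \<le> real (Suc n) * e / d ^ n"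
        using S d0 by (intro norm_divided_difference_separated) force+
      also have "\<dots> = \<eta> / 2"
      proof -
        have "K / (2 * K / \<eta>) = \<eta> / 2" if "K \<noteq> 0" for K :: real
          using that assms by simp
        from this[of "real (Suc n) * e"] show ?thesis
          unfolding dn using assms by (simp only: mult.assoc) simp
      qed
      also have "\<dots> < \<eta>" using assms by simp
      finally show False using dd[of S] S by fastforce
    qed
  qed
  then obtain F where F: "finite F" "card F \<le> n" "?E \<subseteq> (\<Union>p\<in>F. ball p d)" by blast
  have "emeasure lborel ?E \<le> emeasure lborel (\<Union>p\<in>F. ball p d)"
    using F by (intro emeasure_mono) auto
  also have "\<dots> \<le> (\<Sum>p\<in>F. emeasure lborel (ball p d))"
    using F by (intro emeasure_subadditive_finite) auto
  also have "\<dots> = ennreal (real (card F) * (unit_ball_vol (real DIM('a)) * d ^ DIM('a)))"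
    using d0 by (simp add: emeasure_ball ennreal_mult ennreal_of_nat_eq_real_of_nat)
  also have "\<dots> \<le> ennreal (real n * (unit_ball_vol (real DIM('a)) * d ^ DIM('a)))"
    using F d0 by (intro ennreal_leI mult_right_mono) auto
  also have "d ^ DIM('a) = (2 * real (Suc n) / \<eta>) powr (real DIM('a) / n) * e powr (real DIM('a) / n)"
    using assms by (simp add: d_def powr_realpow[symmetric] powr_powr powr_mult[symmetric])
  finally show ?thesis by (simp add: mult_ac)
qed

text \<open>
  Dyadic decomposition according to the size of h. Points with norm (h z) > 1 contribute at most the
  measure of A, and the sublevel sets at the heights 2^(-k) contribute a geometric series because c
  < \<beta>.
\<close>
lemma nn_integral_neg_power_le:
  fixes h :: "'a::euclidean_space \<Rightarrow> 'b::real_normed_vector"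
  assumes "0 < c" "c < \<beta>" "0 \<le> B" "0 \<le> a"
    and A: "A \<in> sets lborel" "emeasure lborel A \<le> ennreal a"
    and m: "\<And>e. 0 < e \<Longrightarrow> {z \<in> A. norm (h z) \<le> e} \<in> sets lborel"
    and B: "\<And>e. 0 < e \<Longrightarrow> emeasure lborel {z \<in> A. norm (h z) \<le> e} \<le> ennreal (B * e powr \<beta>)"
  shows "(\<integral>\<^sup>+z\<in>A. inverse (ennreal (norm (h z) powr c)) \<partial>lborel)
     \<le> ennreal (a + 2 powr c * B / (1 - 2 powr (c - \<beta>)))"
proof -
  define E where "E k = {z \<in> A. norm (h z) \<le> (1/2)^k}" for k :: nat
  have E: "E k \<in> sets lborel" for k unfolding E_def by (rule m) simp
  define w where "w k = (2::real) powr (real (Suc k) * c)" for k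
  have pw: "inverse (ennreal (norm (h z) powr c)) * indicator A z
      \<le> indicator A z + (\<Sum>k. ennreal (w k) * indicator (E k) z)" for z
  proof (cases "z \<in> A")
    case False then show ?thesis by simp
  next
    case zA: True
    show ?thesis
    proof (cases "norm (h z) = 0")
      case True
      then have "z \<in> E k" for k using zA by (simp add: E_def)
      moreover have "1 \<le> w k" for k using assms by (simp add: w_def ge_one_powr_ge_zero)
      ultimately have "(\<Sum>k. (1::ennreal)) \<le> (\<Sum>k. ennreal (w k) * indicator (E k) z)"
        by (intro suminf_le) (auto simp: ennreal_leI[of 1, simplified])
      moreover have "(\<Sum>k::nat. (1::ennreal)) = \<infinity>"
        using nn_integral_count_space_nat[of "\<lambda>_. 1"] by (simp add: emeasure_count_space)
      ultimately show ?thesis by (simp add: top.extremum_unique)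
    next
      case False
      then have hz: "norm (h z) > 0" by simp
      show ?thesis
      proof (cases "norm (h z) \<le> 1")
        case le: True
        obtain k where k: "(1/2)^Suc k < norm (h z)" "norm (h z) \<le> (1/2)^k"
        proof -
          obtain n where n: "(1/2)^n < norm (h z)"
            using real_arch_pow_inv[OF hz, of "1/2"] by auto
          define n0 where "n0 = (LEAST n. (1/2)^n < norm (h z))"
          have n0: "(1/2)^n0 < norm (h z)" unfolding n0_def using n by (rule LeastI)
          then obtain k where "n0 = Suc k" using le by (cases n0) auto
          moreover have "\<not> (1/2)^k < norm (h z)"
            using not_less_Least[of k "\<lambda>n. (1/2)^n < norm (h z)"] \<open>n0 = Suc k\<close> n0_def by auto
          ultimately show ?thesis using n0 that by auto
        qed
        have "inverse (norm (h z) powr c) \<le> inverse (((1/2)^Suc k) powr c)"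
          using k hz assms by (intro le_imp_inverse_le powr_mono2) (auto simp del: power_Suc)
        also have "\<dots> = w k"
          by (simp add: w_def powr_realpow[symmetric] powr_powr powr_minus[symmetric] powr_divide
             powr_minus_divide del: power_Suc)
        finally have "inverse (ennreal (norm (h z) powr c)) \<le> ennreal (w k)"
          using hz by (simp add: inverse_ennreal ennreal_leI)
        also have "\<dots> = ennreal (w k) * indicator (E k) z" using k zA by (simp add: E_def)
        also have "\<dots> \<le> (\<Sum>k. ennreal (w k) * indicator (E k) z)"
        proof -
          have "g k \<le> (\<Sum>k. g k)" for g :: "nat \<Rightarrow> ennreal"
            using sum_le_suminf[of g "{k}"] by simp
          then show ?thesis .
        qed
        finally show ?thesis using zA by (simp add: add_increasing)
      next
        case False
        then have "inverse (norm (h z) powr c) \<le> 1"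
          using assms by (simp add: inverse_le_1_iff ge_one_powr_ge_zero)
        then have "inverse (ennreal (norm (h z) powr c)) \<le> 1"
          using hz by (simp add: inverse_ennreal)
        then show ?thesis using zA by (simp add: add_increasing2)
      qed
    qed
  qed
  have "(\<integral>\<^sup>+z\<in>A. inverse (ennreal (norm (h z) powr c)) \<partial>lborel)
      \<le> (\<integral>\<^sup>+z. indicator A z + (\<Sum>k. ennreal (w k) * indicator (E k) z) \<partial>lborel)"
    by (intro nn_integral_mono pw)
  also have "\<dots> = emeasure lborel A + (\<Sum>k. ennreal (w k) * emeasure lborel (E k))"
    using A E by (subst nn_integral_add)
      (auto simp: nn_integral_suminf nn_integral_cmult_indicator simp del: sets_lborel)
  also have "(\<Sum>k. ennreal (w k) * emeasure lborel (E k)) \<le>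
      (\<Sum>k. ennreal ((2 powr c * B) * (2 powr (c - \<beta>)) ^ k))"
  proof (rule suminf_le)
    fix k
    have "ennreal (w k) * emeasure lborel (E k) \<le> ennreal (w k) * ennreal (B * ((1/2)^k) powr \<beta>)"
      unfolding E_def by (intro mult_left_mono B) auto
    also have "\<dots> = ennreal ((2 powr c * B) * (2 powr (c - \<beta>)) ^ k)"
      by (simp add: ennreal_mult'[symmetric] w_def powr_realpow[symmetric] powr_powr powr_add[symmetric]
           powr_divide powr_minus_divide[symmetric] algebra_simps)
    finally show "ennreal (w k) * emeasure lborel (E k) \<le> ennreal ((2 powr c * B) * (2 powr (c - \<beta>)) ^ k)" .
  qed auto
  also have "\<dots> = ennreal (2 powr c * B / (1 - 2 powr (c - \<beta>)))"
  proof -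
    have "2 powr (c - \<beta>) < (1::real)" using assms by (simp add: powr_less_one)
    then have "(\<lambda>k. (2 powr c * B) * (2 powr (c - \<beta>)) ^ k) sums ((2 powr c * B) * (1 / (1 - 2 powr (c - \<beta>))))"
      by (intro sums_mult geometric_sums) auto
    then show ?thesis using assms
      by (subst suminf_ennreal2) (auto simp: sums_iff)
  qed
  also have "emeasure lborel A + ennreal (2 powr c * B / (1 - 2 powr (c - \<beta>)))
      \<le> ennreal a + ennreal (2 powr c * B / (1 - 2 powr (c - \<beta>)))"
    by (intro add_right_mono A)
  also have "\<dots> = ennreal (a + 2 powr c * B / (1 - 2 powr (c - \<beta>)))"
  proof -
    have "2 powr (c - \<beta>) < (1::real)" using assms by (simp add: powr_less_one)
    then show ?thesis using assms by (subst ennreal_plus) auto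
  qed
  finally show ?thesis by (auto intro: add_left_mono)
qed

text \<open>
  The bound M depends only on c, \<eta>, n and on the measure of the domain, not on h. This
  uniformity is what later allows integration over the scaling parameter.
\<close>
lemma neg_power_integral_bound:
  fixes c \<eta> a :: real
  assumes "0 < c" "0 < \<eta>" "0 \<le> a" "c * real n < real DIM('a)"
  shows "\<exists>M. \<forall>(A :: 'a::{real_normed_field,euclidean_space} set) h :: 'a \<Rightarrow> 'a.
      A \<in> sets lborel \<longrightarrow> emeasure lborel A \<le> ennreal a \<longrightarrow>
      (\<forall>e>0. {z \<in> A. norm (h z) \<le> e} \<in> sets lborel) \<longrightarrow>
      (\<forall>S. finite S \<longrightarrow> S \<subseteq> A \<longrightarrow> card S = Suc n \<longrightarrow> \<eta> \<le> norm (divided_difference S h)) \<longrightarrow>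
      (\<integral>\<^sup>+z\<in>A. inverse (ennreal (norm (h z) powr c)) \<partial>lborel) \<le> ennreal M"
proof (cases "n = 0")
  case True
  show ?thesis
  proof (intro exI[of _ "a * (1/\<eta>) powr c"] allI impI)
    fix A :: "'a set" and h :: "'a \<Rightarrow> 'a"
    assume A: "A \<in> sets lborel" "emeasure lborel A \<le> ennreal a"
      and dd: "\<forall>S. finite S \<longrightarrow> S \<subseteq> A \<longrightarrow> card S = Suc n \<longrightarrow> \<eta> \<le> norm (divided_difference S h)"
    have h: "\<eta> \<le> norm (h z)" if "z \<in> A" for z
      using dd[rule_format, of "{z}"] that True by (simp add: divided_difference_def)
    have "inverse (ennreal (norm (h z) powr c)) * indicator A z \<le> ennreal ((1/\<eta>) powr c) * indicator A z" for z
    proof (cases "z \<in> A")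
      case True
      then have "norm (h z) > 0" "inverse (norm (h z)) \<le> 1 / \<eta>"
        using h[OF True] assms le_imp_inverse_le[OF h[OF True]] by (auto simp: inverse_eq_divide)
      then have "inverse (norm (h z) powr c) \<le> (1/\<eta>) powr c"
        using powr_mono2[of c "inverse (norm (h z))" "1/\<eta>"] assms by (simp add: inverse_powr)
      then show ?thesis using True \<open>norm (h z) > 0\<close> by (simp add: inverse_ennreal ennreal_leI)
    qed simp
    then have "(\<integral>\<^sup>+z\<in>A. inverse (ennreal (norm (h z) powr c)) \<partial>lborel)
       \<le> (\<integral>\<^sup>+z. ennreal ((1/\<eta>) powr c) * indicator A z \<partial>lborel)" by (rule nn_integral_mono)
    also have "\<dots> = ennreal ((1/\<eta>) powr c) * emeasure lborel A"
      using A by (simp add: nn_integral_cmult_indicator)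
    also have "\<dots> \<le> ennreal ((1/\<eta>) powr c) * ennreal a" using A by (intro mult_left_mono) auto
    finally show "(\<integral>\<^sup>+z\<in>A. inverse (ennreal (norm (h z) powr c)) \<partial>lborel) \<le> ennreal (a * (1/\<eta>) powr c)"
      using assms by (simp add: ennreal_mult' mult.commute)
  qed
next
  case False
  let ?\<beta> = "real DIM('a) / n"
  let ?B = "real n * unit_ball_vol (real DIM('a)) * (2 * real (Suc n) / \<eta>) powr (real DIM('a) / n)"
  have "0 < ?B" using False assms by simp
  show ?thesis
  proof (intro exI[of _ "a + 2 powr c * ?B / (1 - 2 powr (c - ?\<beta>))"] allI impI)
    fix A :: "'a set" and h :: "'a \<Rightarrow> 'a"
    assume *: "A \<in> sets lborel" "emeasure lborel A \<le> ennreal a"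
      "\<forall>e>0. {z \<in> A. norm (h z) \<le> e} \<in> sets lborel"
      "\<forall>S. finite S \<longrightarrow> S \<subseteq> A \<longrightarrow> card S = Suc n \<longrightarrow> \<eta> \<le> norm (divided_difference S h)"
    show "(\<integral>\<^sup>+z\<in>A. inverse (ennreal (norm (h z) powr c)) \<partial>lborel)
      \<le> ennreal (a + 2 powr c * ?B / (1 - 2 powr (c - ?\<beta>)))"
    proof (rule nn_integral_neg_power_le[OF assms(1) _ _ assms(3) *(1,2)])
      show "c < ?\<beta>" using False assms by (simp add: field_simps)
      show "0 \<le> ?B" using \<open>0 < ?B\<close> by simp
      show "{z \<in> A. norm (h z) \<le> e} \<in> sets lborel" if "0 < e" for e
        using *(3) that by blast
      show "emeasure lborel {z \<in> A. norm (h z) \<le> e} \<le> ennreal (?B * e powr ?\<beta>)" if "0 < e" for e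
        using *(3,4) that False assms(2) by (intro sublevel_measure_le) blast+
    qed
  qed
qed

section \<open>Edges of the Newton polyhedron and rescaled slices\<close>

text \<open>
  The exponents on the line of weight N for the weights (1, k). For a supporting line these lie on a
  face of the Newton polyhedron.
\<close>
definition edge :: "(nat \<times> nat \<Rightarrow> 'a::zero) \<Rightarrow> real \<Rightarrow> real \<Rightarrow> (nat \<times> nat) set"
  where "edge a k N = {(i, j). a (i, j) \<noteq> 0 \<and> real i + k * real j = N}"

text \<open>
  The s-th Taylor coefficient at z of the polynomial in Z that sums a (i, j) \<sigma>^i Z^j over the
  edge, written out so that binomial coefficients replace derivatives.
\<close>
definition edge_taylor :: "(nat \<times> nat \<Rightarrow> 'a::field) \<Rightarrow> real \<Rightarrow> real \<Rightarrow> 'a \<Rightarrow> 'a \<Rightarrow> nat \<Rightarrow> 'a"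
  where "edge_taylor a k N \<sigma> z s =
    (\<Sum>(i, j)\<in>edge a k N. a (i, j) * \<sigma> ^ i * of_nat (j choose s) * z ^ (j - s))"

definition weight_ge :: "(nat \<times> nat \<Rightarrow> 'a::zero) \<Rightarrow> real \<Rightarrow> real \<Rightarrow> bool"
  where "weight_ge a k N \<longleftrightarrow> (\<forall>i j. a (i, j) \<noteq> 0 \<longrightarrow> N \<le> real i + k * real j)"

lemma finite_weight_le:
  assumes "0 < k"
  shows "finite {(i :: nat, j :: nat). real i + k * real j \<le> N}"
proof (rule finite_subset)
  show "{(i :: nat, j :: nat). real i + k * real j \<le> N} \<subseteq> {..nat \<lceil>N\<rceil>} \<times> {..nat \<lceil>N / k\<rceil>}"
  proof clarify
    fix i j :: nat assume *: "real i + k * real j \<le> N"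
    have "real i \<le> N" using * assms by (smt (verit) mult_nonneg_nonneg of_nat_0_le_iff)
    moreover have "real j \<le> N / k" using * assms by (simp add: field_simps)
    ultimately show "i \<in> {..nat \<lceil>N\<rceil>} \<and> j \<in> {..nat \<lceil>N / k\<rceil>}" by simp linarith
  qed
qed auto

lemma finite_edge: "0 < k \<Longrightarrow> finite (edge a k N)"
  by (rule finite_subset[OF _ finite_weight_le[of k N]]) (auto simp: edge_def)

text \<open>
  Only finitely many exponents lie below any given weight, so the weights beyond the edge stay away
  from N. The gap \<theta> makes the remaining terms of order t^(N + \<theta>).
\<close>
lemma weight_gap:
  assumes "0 < k" "weight_ge a k N"
  obtains \<theta> where "0 < \<theta>" "\<And>i j. a (i, j) \<noteq> 0 \<Longrightarrow> (i, j) \<notin> edge a k N \<Longrightarrow> N + \<theta> \<le> real i + k * real j"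
proof -
  define D where "D = (\<lambda>(i, j). real i + k * real j - N) ` {(i, j). a (i, j) \<noteq> 0 \<and> (i, j) \<notin> edge a k N \<and> real i + k * real j \<le> N + 1}"
  have fin: "finite D"
    unfolding D_def by (rule finite_imageI, rule finite_subset[OF _ finite_weight_le[OF assms(1), of "N + 1"]]) auto
  have pos: "d > 0" if "d \<in> D" for d
    using that assms(2) unfolding D_def edge_def weight_ge_def by fastforce
  show ?thesis
  proof (rule that)
    show "0 < Min (insert 1 D)" using fin pos by simp
    fix i j assume a: "a (i, j) \<noteq> 0" "(i, j) \<notin> edge a k N"
    show "N + Min (insert 1 D) \<le> real i + k * real j"
    proof (cases "real i + k * real j \<le> N + 1")
      case True
      then have "real i + k * real j - N \<in> insert 1 D" using a unfolding D_def by force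
      then have "Min (insert 1 D) \<le> real i + k * real j - N" using fin by (intro Min_le) auto
      then show ?thesis by simp
    next
      case False
      have "Min (insert 1 D) \<le> 1" using fin by (intro Min_le) auto
      then show ?thesis using False by simp
    qed
  qed
qed

lemma has_sum_finite_linear_combination:
  fixes f :: "'s \<Rightarrow> 'i \<Rightarrow> 'a::real_normed_field"
  assumes "finite S" "\<And>s. s \<in> S \<Longrightarrow> (f s has_sum g s) A"
  shows "((\<lambda>x. \<Sum>s\<in>S. f s x) has_sum (\<Sum>s\<in>S. g s)) A"
  using assms by (induction S rule: finite_induct) (auto intro: has_sum_add)

lemma divided_difference_has_sum:
  fixes p :: "'i \<Rightarrow> 'a::real_normed_field"
  assumes "finite S" "\<And>s. s \<in> S \<Longrightarrow> ((\<lambda>x. p x * q x s) has_sum h s) A"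
  shows "((\<lambda>x. p x * divided_difference S (q x)) has_sum divided_difference S h) A"
proof -
  have "((\<lambda>x. \<Sum>s\<in>S. (p x * q x s) * inverse (\<Prod>t\<in>S-{s}. s - t)) has_sum
     (\<Sum>s\<in>S. h s * inverse (\<Prod>t\<in>S-{s}. s - t))) A"
    by (intro has_sum_finite_linear_combination has_sum_cmult_left assms)
  then show ?thesis
    by (simp add: divided_difference_def sum_distrib_left field_simps)
qed

text \<open>
  On the slice x = t \<sigma>, y = t^k z the edge contributes t^N times its polynomial in z, whose
  divided differences over s + 1 points near z0 are close to the s-th Taylor coefficient there, and
  everything else is of order t^(N + \<theta>). The bound holds for all directions \<sigma> near
  \<sigma>0 simultaneously.
\<close>
lemma divided_difference_slice_lower_bound:
  fixes a :: "nat \<times> nat \<Rightarrow> 'a::{real_normed_field,banach}"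
  assumes conv: "abs_conv a \<rho> \<rho>" "0 < \<rho>" and k: "0 < k" and N: "weight_ge a k N"
    and \<sigma>0: "norm \<sigma>0 = 1" and nz: "edge_taylor a k N \<sigma>0 z0 s \<noteq> 0"
  shows "\<exists>r>0. \<exists>\<tau>>0. \<exists>\<eta>>0. \<exists>\<delta>>0. \<tau> \<le> \<rho> \<and> \<tau> powr k * (norm z0 + r) \<le> \<rho> \<and>
    (\<forall>\<sigma> t S. norm \<sigma> = 1 \<longrightarrow> dist \<sigma> \<sigma>0 < \<delta> \<longrightarrow> 0 < t \<longrightarrow> t < \<tau> \<longrightarrow> finite S \<longrightarrow> S \<subseteq> ball z0 r \<longrightarrow>
       card S = Suc s \<longrightarrow>
       \<eta> * t powr N \<le> norm (divided_difference S (\<lambda>z. double_series a (of_real t * \<sigma>) (of_real (t powr k) * z))))"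
proof -
  define \<beta> where "\<beta> = norm (edge_taylor a k N \<sigma>0 z0 s)"
  have \<beta>: "\<beta> > 0" using nz by (simp add: \<beta>_def)
  (* R bounds the points near z0; the radius 2 R in the majorant w below absorbs the binomial
  factors 2^j. *)
  define R where "R = norm z0 + 1"
  have R: "R \<ge> 1" by (simp add: R_def)
  define t0 where "t0 = min \<rho> ((\<rho> / (2 * R)) powr (1 / k))"
  have t0: "t0 > 0" "t0 \<le> \<rho>" using conv R by (auto simp: t0_def)
  have t0k: "t0 powr k * (2 * R) \<le> \<rho>"
  proof -
    have "t0 powr k \<le> ((\<rho> / (2 * R)) powr (1 / k)) powr k"
      using t0 k by (intro powr_mono2) (auto simp: t0_def)
    then show ?thesis using k conv R by (simp add: powr_powr field_simps)
  qed
  obtain \<theta> where \<theta>: "0 < \<theta>" "\<And>i j. a (i, j) \<noteq> 0 \<Longrightarrow> (i, j) \<notin> edge a k N \<Longrightarrow> N + \<theta> \<le> real i + k * real j"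
    using weight_gap[OF k N] by blast
  have fin: "finite (edge a k N)" by (rule finite_edge[OF k])
  define E where "E = edge a k N"
  define w where "w = (\<lambda>(i, j). norm (a (i, j)) * t0 ^ i * (t0 powr k * (2 * R)) ^ j)"
  have wsum: "w summable_on X" for X
  proof -
    have "abs_conv a t0 (t0 powr k * (2 * R))"
      using conv t0 t0k R by (intro abs_conv_mono[OF conv(1)]) auto
    then have "w summable_on UNIV" by (simp add: abs_conv_def w_def)
    then show ?thesis by (rule summable_on_subset_banach) auto
  qed
  define A where "A = infsum w (- E)"
  have w0: "w ij \<ge> 0" for ij using t0 R by (auto simp: w_def case_prod_unfold)
  have A0: "A \<ge> 0" unfolding A_def by (intro infsum_nonneg w0)
  have cancel: "x / (4 * L) * L = x / 4" if "L \<noteq> 0" for x L :: real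
    using that by simp
  define K where "K = (\<Sum>(i, j)\<in>E. norm (a (i, j)) *
      (\<Sum>l\<le>j. real (j choose l) * real (l choose s) * norm z0 ^ (j - l)))"
  have K0: "K \<ge> 0" unfolding K_def by (intro sum_nonneg) (auto intro!: mult_nonneg_nonneg sum_nonneg)
  (* Three errors of size \<beta> / 4 are allowed: from moving the points within r of z0, from
  moving \<sigma> within \<delta> of \<sigma>0, and from the terms beyond the edge for t < \<tau>.
  This leaves \<beta> / 4. *)
  define r where "r = min 1 (\<beta> / (4 * (K + 1)))"
  have r: "0 < r" "r \<le> 1" using \<beta> K0 by (auto simp: r_def)
  have rK: "r * K \<le> \<beta> / 4"
  proof -
    have "r * K \<le> (\<beta> / (4 * (K + 1))) * (K + 1)"
      using K0 \<beta> by (intro mult_mono) (auto simp: r_def)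
    then show ?thesis using K0 cancel[of "K + 1" \<beta>] by linarith
  qed
  have "isCont (\<lambda>\<sigma>. edge_taylor a k N \<sigma> z0 s) \<sigma>0"
    unfolding edge_taylor_def case_prod_unfold by (intro continuous_intros)
  then obtain \<delta> where \<delta>: "0 < \<delta>"
    "\<And>\<sigma>. dist \<sigma> \<sigma>0 < \<delta> \<Longrightarrow> dist (edge_taylor a k N \<sigma> z0 s) (edge_taylor a k N \<sigma>0 z0 s) < \<beta> / 4"
    using \<beta> unfolding continuous_at_eps_delta by (metis zero_less_divide_iff zero_less_numeral)
  define B where "B = t0 powr (- N - \<theta>) * A"
  have B0: "B \<ge> 0" using A0 by (simp add: B_def)
  define \<tau> where "\<tau> = min t0 ((\<beta> / (4 * (B + 1))) powr (1 / \<theta>))"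
  have \<tau>: "0 < \<tau>" "\<tau> \<le> t0" using t0 \<beta> B0 by (auto simp: \<tau>_def)
  have \<tau>B: "t powr \<theta> * B \<le> \<beta> / 4" if "0 < t" "t < \<tau>" for t
  proof -
    have "t powr \<theta> \<le> ((\<beta> / (4 * (B + 1))) powr (1 / \<theta>)) powr \<theta>"
      using that \<theta> by (intro powr_mono2) (auto simp: \<tau>_def)
    also have "\<dots> = \<beta> / (4 * (B + 1))" using \<theta> \<beta> B0 by (simp add: powr_powr)
    finally have "t powr \<theta> * B \<le> (\<beta> / (4 * (B + 1))) * (B + 1)"
      using B0 \<beta> by (intro mult_mono) auto
    then show ?thesis using B0 cancel[of "B + 1" \<beta>] by linarith
  qed
  have \<tau>k: "\<tau> powr k * (norm z0 + r) \<le> \<rho>"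
  proof -
    have zR: "norm z0 + r \<le> 2 * R" using r norm_ge_zero[of z0] unfolding R_def distrib_left by linarith
    have "\<tau> powr k * (norm z0 + r) \<le> t0 powr k * (2 * R)"
      by (rule mult_mono[OF powr_mono2 zR]) (use \<tau> k r in auto)
    then show ?thesis using t0k by simp
  qed
  have main: "\<beta> / 4 * t powr N \<le> norm (divided_difference S (\<lambda>z. double_series a (of_real t * \<sigma>) (of_real (t powr k) * z)))"
    if \<sigma>: "norm \<sigma> = 1" "dist \<sigma> \<sigma>0 < \<delta>" and t: "0 < t" "t < \<tau>"
      and S: "finite S" "S \<subseteq> ball z0 r" "card S = Suc s" for \<sigma> t S
  proof -
    let ?h = "\<lambda>z. double_series a (of_real t * \<sigma>) (of_real (t powr k) * z)"
    define q where "q ij = a ij * (of_real t * \<sigma>) ^ fst ij * of_real (t powr k) ^ snd ij" for ij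
    define T where "T ij = q ij * divided_difference S (\<lambda>z. z ^ snd ij)" for ij
    have Sz: "norm (u - z0) \<le> r" "norm u \<le> R" if "u \<in> S" for u
    proof -
      show *: "norm (u - z0) \<le> r" using that S by (auto simp: dist_norm norm_minus_commute)
      show "norm u \<le> R" using * r norm_triangle_sub[of u z0] by (simp add: R_def)
    qed
    have "((\<lambda>ij. q ij * u ^ snd ij) has_sum ?h u) UNIV" if u: "u \<in> S" for u
    proof -
      have "norm (of_real (t powr k) * u) \<le> \<rho>"
      proof -
        have "norm (of_real (t powr k) * u) \<le> t0 powr k * (2 * R)"
          unfolding norm_mult using t \<tau> k Sz[OF u] R by (intro mult_mono) (auto intro!: powr_mono2)
        then show ?thesis using t0k by simp
      qed
      moreover have "norm (of_real t * \<sigma>) \<le> \<rho>" using \<sigma> t \<tau> t0 by (simp add: norm_mult)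
      ultimately show ?thesis
        using abs_conv_has_sum[OF conv(1), of "of_real t * \<sigma>" "of_real (t powr k) * u"]
        by (simp add: q_def case_prod_unfold power_mult_distrib mult_ac)
    qed
    then have hs: "(T has_sum divided_difference S ?h) UNIV"
      unfolding T_def using divided_difference_has_sum[where S=S and p=q and q="\<lambda>ij z. z ^ snd ij" and h="?h" and A=UNIV] S(1)
      by simp
    have "(T has_sum (divided_difference S ?h - sum T E)) (UNIV - E)"
      using has_sum_Diff[OF hs has_sum_finite[of E T]] fin by (simp add: E_def)
    then have rest_hs: "(T has_sum (divided_difference S ?h - sum T E)) (- E)"
      by (simp add: Compl_eq_Diff_UNIV)
    have rest: "norm (divided_difference S ?h - sum T E) \<le> t powr (N + \<theta>) * B"
    proof -
      have bound: "norm (T ij) \<le> (t / t0) powr (N + \<theta>) * w ij" if ij: "ij \<in> - E" for ij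
      proof (cases "a ij = 0")
        case True
        then show ?thesis using w0[of ij] by (simp add: T_def q_def)
      next
        case False
        obtain i j where ij_eq: "ij = (i, j)" by force
        have wt: "N + \<theta> \<le> real i + k * real j" using \<theta>(2)[of i j] False ij by (simp add: ij_eq E_def)
        have "norm (divided_difference S (\<lambda>z. z ^ j)) \<le> real (j choose s) * R ^ (j - s)"
          using norm_divided_difference_power_le'[OF S(1,3)] Sz(2) by blast
        also have "\<dots> \<le> 2 ^ j * R ^ j"
          using R by (intro mult_mono power_increasing) (auto intro: binomial_le_pow2 simp flip: of_nat_power)
        finally have d: "norm (divided_difference S (\<lambda>z. z ^ j)) \<le> (2 * R) ^ j" by (simp add: power_mult_distrib)
        have "norm (T ij) = norm (a ij) * (t ^ i * (t powr k) ^ j) * norm (divided_difference S (\<lambda>z. z ^ j))"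
          using t \<sigma> by (simp add: T_def q_def ij_eq norm_mult norm_power)
        also have "\<dots> \<le> norm (a ij) * (t ^ i * (t powr k) ^ j) * (2 * R) ^ j"
          using d t by (intro mult_left_mono) auto
        also have "t ^ i * (t powr k) ^ j = t powr (real i + k * real j)"
          using t by (simp add: powr_add powr_realpow[symmetric] powr_powr mult_ac)
        also have "\<dots> = (t / t0) powr (real i + k * real j) * t0 powr (real i + k * real j)"
          using t t0 by (simp add: powr_divide)
        also have "t0 powr (real i + k * real j) = t0 ^ i * (t0 powr k) ^ j"
          using t0 by (simp add: powr_add powr_realpow[symmetric] powr_powr mult_ac)
        also have "(t / t0) powr (real i + k * real j) \<le> (t / t0) powr (N + \<theta>)"
          using t t0 \<tau> wt by (intro powr_mono') auto
        finally have "norm (T ij) \<le> norm (a ij) * ((t / t0) powr (N + \<theta>) * (t0 ^ i * (t0 powr k) ^ j)) * (2 * R) ^ j"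
          using t0 R by (simp add: mult_left_mono mult_right_mono)
        then show ?thesis by (simp add: w_def ij_eq power_mult_distrib mult_ac)
      qed
      have "norm (divided_difference S ?h - sum T E) \<le> (t / t0) powr (N + \<theta>) * A"
        unfolding A_def
      proof (rule norm_infsum_le[OF rest_hs _ bound])
        show "((\<lambda>ij. (t / t0) powr (N + \<theta>) * w ij) has_sum (t / t0) powr (N + \<theta>) * infsum w (- E)) (- E)"
          by (intro has_sum_cmult_right has_sum_infsum wsum)
      qed
      also have "\<dots> = t powr (N + \<theta>) * B"
        using t t0 by (simp add: B_def powr_divide powr_minus powr_diff powr_add field_simps)
      finally show ?thesis .
    qed
    have edge: "norm (sum T E - of_real (t powr N) * edge_taylor a k N \<sigma> z0 s) \<le> t powr N * (r * K)"
    proof -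
      have "sum T E - of_real (t powr N) * edge_taylor a k N \<sigma> z0 s =
        (\<Sum>(i, j)\<in>E. of_real (t powr N) * (a (i, j) * \<sigma> ^ i *
            (divided_difference S (\<lambda>w. w ^ j) - of_nat (j choose s) * z0 ^ (j - s))))"
        unfolding edge_taylor_def sum_distrib_left E_def[symmetric] sum_subtractf[symmetric]
      proof (rule sum.cong[OF refl])
        fix ij assume "ij \<in> E"
        then obtain i j where ij: "ij = (i, j)" "real i + k * real j = N" by (auto simp: E_def edge_def)
        have "of_real t ^ i * of_real (t powr k) ^ j = (of_real (t powr N) :: 'a)"
          using t unfolding ij(2)[symmetric]
          by (simp add: powr_add powr_realpow[symmetric] powr_powr mult_ac flip: of_real_power of_real_mult)
        then have "q ij = of_real (t powr N) * (a ij * \<sigma> ^ i)"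
          by (simp add: q_def ij power_mult_distrib mult_ac)
        then show "T ij - of_real (t powr N) * (case ij of (i, j) \<Rightarrow> a (i, j) * \<sigma> ^ i * of_nat (j choose s) * z0 ^ (j - s))
          = (case ij of (i, j) \<Rightarrow> of_real (t powr N) * (a (i, j) * \<sigma> ^ i *
            (divided_difference S (\<lambda>w. w ^ j) - of_nat (j choose s) * z0 ^ (j - s))))"
          by (simp add: T_def ij algebra_simps)
      qed
      also have "norm \<dots> \<le> (\<Sum>(i, j)\<in>E. t powr N * (norm (a (i, j)) * (r *
          (\<Sum>l\<le>j. real (j choose l) * real (l choose s) * norm z0 ^ (j - l)))))"
      proof (rule order_trans[OF norm_sum sum_mono])
        fix ij assume "ij \<in> E"
        obtain i j where ij: "ij = (i, j)" by force
        have "norm (divided_difference S (\<lambda>w. w ^ j) - of_nat (j choose s) * z0 ^ (j - s)) \<le>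
            r * (\<Sum>l\<le>j. real (j choose l) * real (l choose s) * norm z0 ^ (j - l))"
          using divided_difference_near_point[OF S(1,3) Sz(1) r(2)] by blast
        then show "norm (case ij of (i, j) \<Rightarrow> of_real (t powr N) * (a (i, j) * \<sigma> ^ i *
            (divided_difference S (\<lambda>w. w ^ j) - of_nat (j choose s) * z0 ^ (j - s))))
          \<le> (case ij of (i, j) \<Rightarrow> t powr N * (norm (a (i, j)) * (r *
          (\<Sum>l\<le>j. real (j choose l) * real (l choose s) * norm z0 ^ (j - l)))))"
          using t \<sigma> by (simp add: ij norm_mult norm_power mult_left_mono)
      qed
      also have "\<dots> = t powr N * (r * K)"
        by (simp add: K_def sum_distrib_left case_prod_unfold mult_ac)
      finally show ?thesis .
    qed
    have "\<beta> - \<beta> / 4 \<le> norm (edge_taylor a k N \<sigma> z0 s)"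
      using \<delta>(2)[OF \<sigma>(2)] norm_triangle_sub[of "edge_taylor a k N \<sigma>0 z0 s" "edge_taylor a k N \<sigma> z0 s"]
      by (simp add: \<beta>_def dist_norm norm_minus_commute)
    then have "t powr N * (3 / 4 * \<beta>) \<le> norm (of_real (t powr N) * edge_taylor a k N \<sigma> z0 s)"
      unfolding norm_mult using t by (simp add: mult_left_mono)
    also have "\<dots> \<le> norm (divided_difference S ?h) + norm (divided_difference S ?h - sum T E)
       + norm (sum T E - of_real (t powr N) * edge_taylor a k N \<sigma> z0 s)"
      by (smt (verit, ccfv_threshold) norm_minus_commute norm_triangle_sub)
    also have "\<dots> \<le> norm (divided_difference S ?h) + t powr N * (\<beta> / 4) + t powr N * (\<beta> / 4)"
    proof -
      have "t powr (N + \<theta>) * B \<le> t powr N * (\<beta> / 4)"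
        using \<tau>B[OF t] t by (simp add: powr_add mult.assoc mult_left_mono)
      moreover have "t powr N * (r * K) \<le> t powr N * (\<beta> / 4)"
        using rK t by (intro mult_left_mono) auto
      ultimately show ?thesis using rest edge by linarith
    qed
    finally show ?thesis by (simp add: field_simps)
  qed
  show ?thesis
    by (rule exI[of _ r], rule conjI[OF r(1)], rule exI[of _ \<tau>], rule conjI[OF \<tau>(1)],
        rule exI[of _ "\<beta> / 4"], rule conjI, use \<beta> in simp, rule exI[of _ \<delta>], rule conjI[OF \<delta>(1)])
      (use \<tau> t0 \<tau>k main in \<open>auto simp del: times_divide_eq_left\<close>)
qed

section \<open>Integrals of negative powers over rescaled slices\<close>

lemma sublevel_set_measurable:
  fixes g :: "'a::topological_space \<Rightarrow> 'b::real_normed_vector"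
  assumes "continuous_on A g" "A \<in> sets borel"
  shows "{z \<in> A. norm (g z) \<le> e} \<in> sets borel"
proof -
  obtain T where T: "closed T" "A \<inter> {z. norm (g z) \<le> e} = A \<inter> T"
  proof -
    have "continuous_on A (\<lambda>z. norm (g z))" using assms by (intro continuous_intros)
    then have "closedin (top_of_set A) (A \<inter> (\<lambda>z. norm (g z)) -` {..e})"
      by (intro continuous_closedin_preimage) auto
    then show ?thesis using that by (auto simp: closedin_closed vimage_def)
  qed
  have "{z \<in> A. norm (g z) \<le> e} = A \<inter> T" using T by auto
  then show ?thesis using assms T by auto
qed

lemma neg_power_measurable:
  fixes g :: "'a::topological_space \<Rightarrow> 'b::real_normed_vector"
  assumes "continuous_on A g" "A \<in> sets borel"
  shows "(\<lambda>z. inverse (ennreal (norm (g z) powr c)) * indicator A z) \<in> borel_measurable borel"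
proof -
  have "continuous_on A (\<lambda>z. norm (g z))" using assms by (intro continuous_intros)
  then have "(\<lambda>z. norm (g z)) \<in> borel_measurable (restrict_space borel A)"
    by (rule borel_measurable_continuous_on_restrict)
  then have "(\<lambda>z. inverse (ennreal (norm (g z) powr c))) \<in> borel_measurable (restrict_space borel A)"
    by measurable
  then show ?thesis
    using assms by (subst (asm) borel_measurable_restrict_space_iff_ennreal) auto
qed

lemma inverse_ennreal_powr_mult:
  assumes "0 < u" "0 \<le> v"
  shows "inverse (ennreal ((u * v) powr c)) = ennreal (u powr (- c)) * inverse (ennreal (v powr c))"
proof (cases "v = 0")
  case True
  then show ?thesis using assms by (simp add: ennreal_mult_top)
next
  case False
  then have "inverse (ennreal ((u * v) powr c)) = ennreal (inverse ((u * v) powr c))"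
    using assms by (intro inverse_ennreal) auto
  also have "inverse ((u * v) powr c) = u powr (- c) * inverse (v powr c)"
    using assms False by (simp add: powr_mult powr_minus)
  also have "ennreal \<dots> = ennreal (u powr (- c)) * inverse (ennreal (v powr c))"
    using assms False by (simp add: ennreal_mult inverse_ennreal)
  finally show ?thesis .
qed

lemma nn_integral_scaleR:
  fixes G :: "'a::euclidean_space \<Rightarrow> ennreal"
  assumes [measurable]: "G \<in> borel_measurable borel" and "0 < u"
  shows "(\<integral>\<^sup>+y. G y \<partial>lborel) = ennreal (u ^ DIM('a)) * (\<integral>\<^sup>+z. G (u *\<^sub>R z) \<partial>lborel)"
proof -
  have "(\<integral>\<^sup>+y. G y \<partial>lborel) = (\<integral>\<^sup>+y. G y \<partial>(density (distr lborel borel (\<lambda>x. 0 + u *\<^sub>R x)) (\<lambda>_. ennreal (\<bar>u\<bar> ^ DIM('a)))))"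
    using lborel_affine[of u "0 :: 'a"] assms by simp
  also have "\<dots> = ennreal (u ^ DIM('a)) * (\<integral>\<^sup>+z. G (u *\<^sub>R z) \<partial>lborel)"
    using assms by (simp add: nn_integral_density nn_integral_distr nn_integral_cmult)
  finally show ?thesis .
qed

lemma continuous_on_double_series_slice:
  fixes a :: "nat \<times> nat \<Rightarrow> 'a::{real_normed_field,banach}"
  assumes "abs_conv a \<rho> \<rho>" "norm x \<le> \<rho>" "\<And>z. z \<in> A \<Longrightarrow> norm (u * z) \<le> \<rho>"
  shows "continuous_on A (\<lambda>z. double_series a x (u * z))"
proof -
  have "continuous_on A ((\<lambda>(x, y). double_series a x y) \<circ> (\<lambda>z. (x, u * z)))"
    using assms by (intro continuous_on_compose continuous_on_subset[OF continuous_on_double_series[OF assms(1)]]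
       continuous_intros) auto
  then show ?thesis by (simp add: o_def)
qed

text \<open>
  Integration is over z only: the slice x = t \<sigma> in the weighted coordinates in which y = t^k
  z.
\<close>
definition slice_integral :: "(nat \<times> nat \<Rightarrow> 'a::{real_normed_field,euclidean_space}) \<Rightarrow> real \<Rightarrow> real
    \<Rightarrow> 'a \<Rightarrow> real \<Rightarrow> 'a set \<Rightarrow> ennreal"
  where "slice_integral a k c \<sigma> t A =
    (\<integral>\<^sup>+z\<in>A. inverse (ennreal (norm (double_series a (of_real t * \<sigma>) (of_real (t powr k) * z)) powr c)) \<partial>lborel)"

text \<open>
  The slice integrals over A have the size t^(-c N) of a function that is homogeneous of weight N,
  uniformly in the direction \<sigma>.
\<close>
definition slice_bound :: "(nat \<times> nat \<Rightarrow> 'a::{real_normed_field,euclidean_space}) \<Rightarrow> real \<Rightarrow> real \<Rightarrow> real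
    \<Rightarrow> 'a set \<Rightarrow> real \<Rightarrow> real \<Rightarrow> bool"
  where "slice_bound a k N c A \<tau> M \<longleftrightarrow> (\<forall>\<sigma> t. norm \<sigma> = 1 \<longrightarrow> 0 < t \<longrightarrow> t < \<tau> \<longrightarrow>
       slice_integral a k c \<sigma> t A \<le> ennreal (t powr (- c * N)) * ennreal M)"

lemma slice_integral_mono: "A \<subseteq> B \<Longrightarrow> slice_integral a k c \<sigma> t A \<le> slice_integral a k c \<sigma> t B"
  unfolding slice_integral_def by (intro nn_integral_mono mult_left_mono) (auto simp: indicator_def)

text \<open>
  After division by t^N the divided differences on the slice are bounded below by a constant, so the
  uniform bound for integrals of negative powers applies; it needs c s < DIM('a).
\<close>
lemma slice_integral_bound_near:
  fixes a :: "nat \<times> nat \<Rightarrow> 'a::{real_normed_field,euclidean_space}"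
  assumes conv: "abs_conv a \<rho> \<rho>" "0 < \<rho>" and k: "0 < k" and N: "weight_ge a k N" and c: "0 < c"
    and \<sigma>0: "norm \<sigma>0 = 1" and nz: "edge_taylor a k N \<sigma>0 z0 s \<noteq> 0" "c * real s < real DIM('a)"
  shows "\<exists>r>0. \<exists>\<tau>>0. \<exists>\<delta>>0. \<exists>M. \<forall>\<sigma> t. norm \<sigma> = 1 \<longrightarrow> dist \<sigma> \<sigma>0 < \<delta> \<longrightarrow> 0 < t \<longrightarrow> t < \<tau> \<longrightarrow>
       slice_integral a k c \<sigma> t (ball z0 r) \<le> ennreal (t powr (- c * N)) * ennreal M"
proof -
  define Q where "Q r \<tau> \<eta> \<delta> \<longleftrightarrow>
    (\<forall>\<sigma> t S. norm \<sigma> = 1 \<longrightarrow> dist \<sigma> \<sigma>0 < \<delta> \<longrightarrow> 0 < t \<longrightarrow> t < \<tau> \<longrightarrow> finite S \<longrightarrow> S \<subseteq> ball z0 r \<longrightarrow>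
       card S = Suc s \<longrightarrow>
       \<eta> * t powr N \<le> norm (divided_difference S (\<lambda>z. double_series a (of_real t * \<sigma>) (of_real (t powr k) * z))))"
    for r \<tau> \<eta> \<delta>
  obtain r \<tau> \<eta> \<delta> where r: "r > 0" "\<tau> > 0" "\<eta> > 0" "\<delta> > 0" "\<tau> \<le> \<rho>" "\<tau> powr k * (norm z0 + r) \<le> \<rho>"
    and "Q r \<tau> \<eta> \<delta>"
    using divided_difference_slice_lower_bound[OF conv k N \<sigma>0 nz(1)] unfolding Q_def[symmetric] by blast
  note dd = \<open>Q r \<tau> \<eta> \<delta>\<close>[unfolded Q_def]
  obtain M where M: "\<forall>(A :: 'a set) h :: 'a \<Rightarrow> 'a.
      A \<in> sets lborel \<longrightarrow> emeasure lborel A \<le> ennreal (measure lborel (ball z0 r)) \<longrightarrow>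
      (\<forall>e>0. {z \<in> A. norm (h z) \<le> e} \<in> sets lborel) \<longrightarrow>
      (\<forall>S. finite S \<longrightarrow> S \<subseteq> A \<longrightarrow> card S = Suc s \<longrightarrow> \<eta> \<le> norm (divided_difference S h)) \<longrightarrow>
      (\<integral>\<^sup>+z\<in>A. inverse (ennreal (norm (h z) powr c)) \<partial>lborel) \<le> ennreal M"
    using neg_power_integral_bound[OF c r(3) measure_nonneg[of lborel "ball z0 r"] nz(2)] by (elim exE)
  have "slice_integral a k c \<sigma> t (ball z0 r) \<le> ennreal (t powr (- c * N)) * ennreal M"
    if \<sigma>: "norm \<sigma> = 1" "dist \<sigma> \<sigma>0 < \<delta>" and t: "0 < t" "t < \<tau>" for \<sigma> t
  proof -
    define g where "g z = double_series a (of_real t * \<sigma>) (of_real (t powr k) * z)" for z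
    define h where "h z = inverse (of_real (t powr N)) * g z" for z
    have cont: "continuous_on (ball z0 r) g"
      unfolding g_def
    proof (rule continuous_on_double_series_slice[OF conv(1)])
      show "norm (of_real t * \<sigma>) \<le> \<rho>" using \<sigma> t r by (simp add: norm_mult)
      fix z assume "z \<in> ball z0 r"
      then have "norm z \<le> norm z0 + r"
        using norm_triangle_sub[of z z0] by (simp add: dist_norm norm_minus_commute)
      then have "norm (of_real (t powr k) * z) \<le> \<tau> powr k * (norm z0 + r)"
        unfolding norm_mult using t k by (intro mult_mono) (auto intro!: powr_mono2)
      then show "norm (of_real (t powr k) * z) \<le> \<rho>" using r by simp
    qed
    then have conth: "continuous_on (ball z0 r) h" unfolding h_def by (intro continuous_intros)
    have gh: "norm (g z) = t powr N * norm (h z)" for z using t by (simp add: h_def norm_mult norm_inverse)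
    have fin: "emeasure lborel (ball z0 r) \<le> ennreal (measure lborel (ball z0 r))"
      using emeasure_bounded_finite[of "ball z0 r"] by (subst emeasure_eq_ennreal_measure) auto
    have ddh: "\<eta> \<le> norm (divided_difference S h)" if "finite S" "S \<subseteq> ball z0 r" "card S = Suc s" for S
    proof -
      have "\<eta> * t powr N \<le> norm (divided_difference S g)"
        using dd[rule_format, OF \<sigma> t that] by (simp add: g_def[abs_def])
      moreover have "divided_difference S h = inverse (of_real (t powr N)) * divided_difference S g"
        unfolding h_def by (rule divided_difference_cmult)
      then have "norm (divided_difference S h) = norm (divided_difference S g) / t powr N"
        using t by (simp add: norm_mult norm_inverse divide_inverse)
      ultimately show ?thesis using t by (simp add: pos_le_divide_eq)
    qed
    have "slice_integral a k c \<sigma> t (ball z0 r) =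
      (\<integral>\<^sup>+z. ennreal (t powr (- c * N)) * (inverse (ennreal (norm (h z) powr c)) * indicator (ball z0 r) z) \<partial>lborel)"
      unfolding slice_integral_def g_def[symmetric] gh using t
      by (subst inverse_ennreal_powr_mult) (auto simp: powr_powr mult_ac)
    also have "\<dots> = ennreal (t powr (- c * N)) * (\<integral>\<^sup>+z\<in>ball z0 r. inverse (ennreal (norm (h z) powr c)) \<partial>lborel)"
      using neg_power_measurable[OF conth] by (intro nn_integral_cmult) auto
    also have "\<dots> \<le> ennreal (t powr (- c * N)) * ennreal M"
      using fin sublevel_set_measurable[OF conth] ddh
      by (intro mult_left_mono M[rule_format]) auto
    finally show ?thesis .
  qed
  then have "\<forall>\<sigma> t. norm \<sigma> = 1 \<longrightarrow> dist \<sigma> \<sigma>0 < \<delta> \<longrightarrow> 0 < t \<longrightarrow> t < \<tau> \<longrightarrow>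
       slice_integral a k c \<sigma> t (ball z0 r) \<le> ennreal (t powr (- c * N)) * ennreal M"
    by (intro allI impI)
  with r(1,2,4) show ?thesis by (intro exI conjI)
qed

text \<open>
  The order s may depend on the direction \<sigma>; compactness of the unit sphere makes the
  estimate uniform.
\<close>
lemma slice_integral_bound_point:
  fixes a :: "nat \<times> nat \<Rightarrow> 'a::{real_normed_field,euclidean_space}"
  assumes conv: "abs_conv a \<rho> \<rho>" "0 < \<rho>" and k: "0 < k" and N: "weight_ge a k N" and c: "0 < c"
    and nz: "\<And>\<sigma>. norm \<sigma> = 1 \<Longrightarrow> \<exists>s. edge_taylor a k N \<sigma> z0 s \<noteq> 0 \<and> c * real s < real DIM('a)"
  shows "\<exists>r>0. \<exists>\<tau>>0. \<exists>M. slice_bound a k N c (ball z0 r) \<tau> M"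
proof -
  define Q where "Q \<sigma>0 r \<tau> \<delta> M \<longleftrightarrow> (\<forall>\<sigma> t. norm \<sigma> = 1 \<longrightarrow> dist \<sigma> \<sigma>0 < \<delta> \<longrightarrow> 0 < t \<longrightarrow> t < \<tau> \<longrightarrow>
       slice_integral a k c \<sigma> t (ball z0 r) \<le> ennreal (t powr (- c * N)) * ennreal M)" for \<sigma>0 r \<tau> \<delta> M
  have "\<forall>\<sigma>0. norm \<sigma>0 = 1 \<longrightarrow> (\<exists>r>0. \<exists>\<tau>>0. \<exists>\<delta>>0. \<exists>M. Q \<sigma>0 r \<tau> \<delta> M)"
  proof (intro allI impI)
    fix \<sigma>0 :: 'a assume 1: "norm \<sigma>0 = 1"
    obtain s where "edge_taylor a k N \<sigma>0 z0 s \<noteq> 0" "c * real s < real DIM('a)" using nz[OF 1] by blast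
    from slice_integral_bound_near[OF conv k N c 1 this]
    show "\<exists>r>0. \<exists>\<tau>>0. \<exists>\<delta>>0. \<exists>M. Q \<sigma>0 r \<tau> \<delta> M" unfolding Q_def .
  qed
  then obtain r \<tau> \<delta> M where P: "\<And>\<sigma>0. norm \<sigma>0 = 1 \<Longrightarrow> r \<sigma>0 > 0 \<and> \<tau> \<sigma>0 > 0 \<and> \<delta> \<sigma>0 > 0"
    and Q: "\<And>\<sigma>0. norm \<sigma>0 = 1 \<Longrightarrow> Q \<sigma>0 (r \<sigma>0) (\<tau> \<sigma>0) (\<delta> \<sigma>0) (M \<sigma>0)"
    by metis
  have "compact (sphere (0::'a) 1)" by simp
  then obtain C where C: "C \<subseteq> sphere 0 1" "finite C" "sphere (0::'a) 1 \<subseteq> (\<Union>\<sigma>0\<in>C. ball \<sigma>0 (\<delta> \<sigma>0))"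
  proof (rule compactE_image)
    show "sphere (0::'a) 1 \<subseteq> (\<Union>\<sigma>0\<in>sphere 0 1. ball \<sigma>0 (\<delta> \<sigma>0))" using P by force
  qed auto
  define r' where "r' = Min (insert 1 (r ` C))"
  define \<tau>' where "\<tau>' = Min (insert 1 (\<tau> ` C))"
  define M' where "M' = (\<Sum>\<sigma>0\<in>C. \<bar>M \<sigma>0\<bar>)"
  have pos: "r' > 0" "\<tau>' > 0" using C P by (auto simp: r'_def \<tau>'_def)
  have "slice_integral a k c \<sigma> t (ball z0 r') \<le> ennreal (t powr (- c * N)) * ennreal M'"
    if "norm \<sigma> = 1" "0 < t" "t < \<tau>'" for \<sigma> t
  proof -
    have "\<sigma> \<in> sphere 0 1" using that by simp
    then obtain \<sigma>0 where \<sigma>0: "\<sigma>0 \<in> C" "dist \<sigma>0 \<sigma> < \<delta> \<sigma>0" using C(3) by auto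
    have le: "r' \<le> r \<sigma>0" "\<tau>' \<le> \<tau> \<sigma>0" using \<sigma>0 C by (auto simp: r'_def \<tau>'_def)
    have "M \<sigma>0 \<le> M'" unfolding M'_def
      using member_le_sum[of \<sigma>0 C "\<lambda>x. \<bar>M x\<bar>"] \<sigma>0 C by fastforce
    have "slice_integral a k c \<sigma> t (ball z0 r') \<le> slice_integral a k c \<sigma> t (ball z0 (r \<sigma>0))"
      using le by (intro slice_integral_mono) auto
    also have "\<dots> \<le> ennreal (t powr (- c * N)) * ennreal (M \<sigma>0)"
    proof -
      have "norm \<sigma>0 = 1" using \<sigma>0 C by auto
      from Q[OF this, unfolded Q_def, rule_format, of \<sigma> t] show ?thesis
        using \<sigma>0 that le by (auto simp: dist_commute)
    qed
    also have "\<dots> \<le> ennreal (t powr (- c * N)) * ennreal M'"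
      using \<open>M \<sigma>0 \<le> M'\<close> by (intro mult_left_mono ennreal_leI) auto
    finally show ?thesis .
  qed
  with pos show ?thesis unfolding slice_bound_def by (intro exI[of _ r'] exI[of _ \<tau>'] exI[of _ M'] conjI allI impI) auto
qed

lemma slice_integral_bound_cball:
  fixes a :: "nat \<times> nat \<Rightarrow> 'a::{real_normed_field,euclidean_space}"
  assumes conv: "abs_conv a \<rho> \<rho>" "0 < \<rho>" and k: "0 < k" and N: "weight_ge a k N" and c: "0 < c" and C0: "0 < C"
    and nz: "\<And>\<sigma> z. norm \<sigma> = 1 \<Longrightarrow> \<exists>s. edge_taylor a k N \<sigma> z s \<noteq> 0 \<and> c * real s < real DIM('a)"
  shows "\<exists>\<tau>>0. \<exists>M. slice_bound a k N c (cball 0 C) \<tau> M"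
proof -
  have "\<forall>z0. \<exists>r>0. \<exists>\<tau>>0. \<exists>M. slice_bound a k N c (ball z0 r) \<tau> M"
    by (intro allI slice_integral_bound_point[OF conv k N c] nz)
  then obtain r \<tau> M where P: "\<And>z0. r z0 > 0 \<and> \<tau> z0 > 0"
    and Q: "\<And>z0. slice_bound a k N c (ball z0 (r z0)) (\<tau> z0) (M z0)"
    by metis
  have "compact (cball (0::'a) C)" by simp
  then obtain Z where Z: "Z \<subseteq> cball 0 C" "finite Z" "cball (0::'a) C \<subseteq> (\<Union>z0\<in>Z. ball z0 (r z0))"
  proof (rule compactE_image)
    show "cball (0::'a) C \<subseteq> (\<Union>z0\<in>cball 0 C. ball z0 (r z0))" using P by force
  qed auto
  define \<tau>' where "\<tau>' = Min ({\<rho>, (\<rho> / C) powr (1 / k)} \<union> \<tau> ` Z)"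
  define M' where "M' = (\<Sum>z0\<in>Z. \<bar>M z0\<bar>)"
  have pos: "\<tau>' > 0" using Z P conv C0 by (auto simp: \<tau>'_def)
  have "slice_integral a k c \<sigma> t (cball 0 C) \<le> ennreal (t powr (- c * N)) * ennreal M'"
    if \<sigma>: "norm \<sigma> = 1" and t: "0 < t" "t < \<tau>'" for \<sigma> t
  proof -
    have le: "\<tau>' \<le> \<rho>" "\<tau>' \<le> (\<rho> / C) powr (1 / k)" "\<And>z0. z0 \<in> Z \<Longrightarrow> \<tau>' \<le> \<tau> z0"
      using Z unfolding \<tau>'_def by (intro Min_le; simp)+
    define g where "g z = double_series a (of_real t * \<sigma>) (of_real (t powr k) * z)" for z
    have cont: "continuous_on (cball 0 C) g"
      unfolding g_def
    proof (rule continuous_on_double_series_slice[OF conv(1)])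
      show "norm (of_real t * \<sigma>) \<le> \<rho>" using \<sigma> t le by (simp add: norm_mult)
      fix z :: 'a assume z: "z \<in> cball 0 C"
      have "t powr k \<le> ((\<rho> / C) powr (1 / k)) powr k" using t le k by (intro powr_mono2) auto
      also have "\<dots> = \<rho> / C" using k conv C0 by (simp add: powr_powr)
      finally have "norm (of_real (t powr k) * z) \<le> \<rho> / C * C"
        unfolding norm_mult using z conv C0 by (intro mult_mono) auto
      then show "norm (of_real (t powr k) * z) \<le> \<rho>" using C0 by simp
    qed
    define G where "G z = inverse (ennreal (norm (g z) powr c))" for z
    have meas: "(\<lambda>z. G z * indicator (cball 0 C \<inter> ball z0 (r z0)) z) \<in> borel_measurable borel" for z0
      unfolding G_def by (intro neg_power_measurable continuous_on_subset[OF cont]) auto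
    have "slice_integral a k c \<sigma> t (cball 0 C) = (\<integral>\<^sup>+z\<in>cball 0 C. G z \<partial>lborel)"
      by (simp add: slice_integral_def G_def g_def)
    also have "\<dots> \<le> (\<integral>\<^sup>+z. (\<Sum>z0\<in>Z. G z * indicator (cball 0 C \<inter> ball z0 (r z0)) z) \<partial>lborel)"
    proof (intro nn_integral_mono)
      fix z
      show "G z * indicator (cball 0 C) z \<le> (\<Sum>z0\<in>Z. G z * indicator (cball 0 C \<inter> ball z0 (r z0)) z)"
      proof (cases "z \<in> cball 0 C")
        case True
        then obtain z0 where "z0 \<in> Z" "z \<in> ball z0 (r z0)" using Z by blast
        then show ?thesis
          using True Z member_le_sum[of z0 Z "\<lambda>z0. G z * indicator (cball 0 C \<inter> ball z0 (r z0)) z"] by simp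
      qed simp
    qed
    also have "\<dots> = (\<Sum>z0\<in>Z. (\<integral>\<^sup>+z. G z * indicator (cball 0 C \<inter> ball z0 (r z0)) z \<partial>lborel))"
      using meas by (intro nn_integral_sum) auto
    also have "\<dots> \<le> (\<Sum>z0\<in>Z. ennreal (t powr (- c * N)) * ennreal \<bar>M z0\<bar>)"
    proof (intro sum_mono)
      fix z0 assume z0: "z0 \<in> Z"
      have "(\<integral>\<^sup>+z. G z * indicator (cball 0 C \<inter> ball z0 (r z0)) z \<partial>lborel) \<le> slice_integral a k c \<sigma> t (ball z0 (r z0))"
        unfolding slice_integral_def G_def g_def by (intro nn_integral_mono mult_left_mono) (auto simp: indicator_def)
      also have "\<dots> \<le> ennreal (t powr (- c * N)) * ennreal (M z0)"
        using Q[of z0, unfolded slice_bound_def, rule_format, of \<sigma> t] \<sigma> t le(3)[OF z0] by simp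
      also have "\<dots> \<le> ennreal (t powr (- c * N)) * ennreal \<bar>M z0\<bar>"
        by (intro mult_left_mono ennreal_leI) auto
      finally show "(\<integral>\<^sup>+z. G z * indicator (cball 0 C \<inter> ball z0 (r z0)) z \<partial>lborel)
         \<le> ennreal (t powr (- c * N)) * ennreal \<bar>M z0\<bar>" .
    qed
    also have "\<dots> = ennreal (t powr (- c * N)) * ennreal M'"
      unfolding M'_def by (simp add: sum_distrib_left[symmetric] sum_ennreal)
    finally show ?thesis .
  qed
  with pos show ?thesis unfolding slice_bound_def by (intro exI[of _ \<tau>'] exI[of _ M'] conjI allI impI) auto
qed

section \<open>Integrability from the orders of the edge polynomials\<close>

lemma nn_integral_lborel_pair:
  fixes G :: "'a::euclidean_space \<times> 'b::euclidean_space \<Rightarrow> ennreal"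
  assumes "G \<in> borel_measurable borel"
  shows "(\<integral>\<^sup>+p. G p \<partial>lborel) = (\<integral>\<^sup>+x. \<integral>\<^sup>+y. G (x, y) \<partial>lborel \<partial>lborel)"
proof -
  have "G \<in> borel_measurable (lborel \<Otimes>\<^sub>M lborel)" using assms by (simp add: lborel_prod)
  then show ?thesis by (simp add: lborel.nn_integral_fst lborel_prod[symmetric])
qed

lemma distr_lborel_swap:
  "distr lborel lborel (\<lambda>(x, y). (y, x)) = (lborel :: ('a::euclidean_space \<times> 'b::euclidean_space) measure)"
  using lborel_pair.distr_pair_swap[symmetric] by (simp add: lborel_prod)

text \<open>
  The sublevel sets of the norm are balls, so the dyadic estimate replaces integration in polar
  coordinates.
\<close>
lemma nn_integral_norm_powr_finite:
  assumes "- real DIM('a) < \<alpha>"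
  shows "(\<integral>\<^sup>+x\<in>{x :: 'a::euclidean_space. 0 < norm x \<and> norm x < 1}. ennreal (norm x powr \<alpha>) \<partial>lborel) < \<infinity>"
proof (cases "0 \<le> \<alpha>")
  case True
  have "(\<integral>\<^sup>+x\<in>{x :: 'a. 0 < norm x \<and> norm x < 1}. ennreal (norm x powr \<alpha>) \<partial>lborel)
      \<le> (\<integral>\<^sup>+x. indicator (ball (0::'a) 1) x \<partial>lborel)"
    using True by (intro nn_integral_mono) (auto simp: indicator_def powr_le1 intro!: ennreal_le_1[THEN iffD2])
  also have "\<dots> = emeasure lborel (ball (0::'a) 1)" by simp
  also have "\<dots> < \<infinity>" by (rule emeasure_bounded_finite) auto
  finally show ?thesis .
next
  case False
  have meas: "{z \<in> ball (0::'a) 1. norm z \<le> e} \<in> sets lborel" for e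
    using sublevel_set_measurable[of "ball (0::'a) 1" "\<lambda>z. z" e] by simp
  have "(\<integral>\<^sup>+x\<in>{x :: 'a. 0 < norm x \<and> norm x < 1}. ennreal (norm x powr \<alpha>) \<partial>lborel)
     \<le> (\<integral>\<^sup>+x\<in>ball (0::'a) 1. inverse (ennreal (norm x powr (- \<alpha>))) \<partial>lborel)"
    by (intro nn_integral_mono) (auto simp: indicator_def inverse_ennreal powr_minus)
  also have "\<dots> \<le> ennreal (measure lborel (ball (0::'a) 1) +
      2 powr (- \<alpha>) * unit_ball_vol (real DIM('a)) / (1 - 2 powr (- \<alpha> - real DIM('a))))"
  proof (rule nn_integral_neg_power_le)
    show "emeasure lborel (ball (0::'a) 1) \<le> ennreal (measure lborel (ball (0::'a) 1))"
      using emeasure_bounded_finite[of "ball (0::'a) 1"] by (subst emeasure_eq_ennreal_measure) auto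
    fix e :: real assume e: "0 < e"
    have "emeasure lborel {z \<in> ball (0::'a) 1. norm z \<le> e} \<le> emeasure lborel (cball (0::'a) e)"
      by (intro emeasure_mono) auto
    also have "\<dots> = ennreal (unit_ball_vol (real DIM('a)) * e powr real DIM('a))"
      using e by (simp add: emeasure_cball powr_realpow)
    finally show "emeasure lborel {z \<in> ball (0::'a) 1. norm z \<le> e} \<le>
       ennreal (unit_ball_vol (real DIM('a)) * e powr real DIM('a))" .
  qed (use False assms meas in auto)
  also have "\<dots> < \<infinity>" by simp
  finally show ?thesis .
qed

text \<open>
  The region in which the rescaled variable z = y / |x|^k stays in the disc of radius C.
\<close>
definition sector :: "real \<Rightarrow> real \<Rightarrow> real \<Rightarrow> ('a::real_normed_vector \<times> 'a) set"
  where "sector k C \<tau> = {(x, y). 0 < norm x \<and> norm x < \<tau> \<and> norm y \<le> C * norm x powr k}"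

lemma sets_sector [measurable]: "sector k C \<tau> \<in> sets (borel :: ('a::euclidean_space \<times> 'a) measure)"
proof -
  have "sector k C \<tau> = {p \<in> space (borel \<Otimes>\<^sub>M borel :: ('a \<times> 'a) measure).
     0 < norm (fst p) \<and> norm (fst p) < \<tau> \<and> norm (snd p) \<le> C * norm (fst p) powr k}"
    by (auto simp: sector_def space_pair_measure)
  also have "\<dots> \<in> sets (borel \<Otimes>\<^sub>M borel)" by measurable
  finally show ?thesis by (simp only: borel_prod)
qed

text \<open>
  By Fubini the integral is at most a multiple of that of |x|^(e k - c N), where e = DIM('a): the
  factor |x|^(e k) is the Jacobian of y = |x|^k z. The exponent exceeds -e precisely when c N < e (1
  + k).
\<close>
lemma sector_integral_finite:
  fixes a :: "nat \<times> nat \<Rightarrow> 'a::{real_normed_field,euclidean_space}"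
  assumes conv: "abs_conv a \<rho> \<rho>" "0 < \<rho>" and k: "0 < k" and C: "0 < C"
    and cN: "c * N < real DIM('a) * (1 + k)"
    and bound: "0 < \<tau>0" "slice_bound a k N c (cball 0 C) \<tau>0 M"
  shows "\<exists>\<tau>>0. (\<integral>\<^sup>+p\<in>sector k C \<tau>. inverse (ennreal (norm (double_series a (fst p) (snd p)) powr c)) \<partial>lborel) < \<infinity>
     \<and> (\<lambda>p. inverse (ennreal (norm (double_series a (fst p) (snd p)) powr c)) * indicator (sector k C \<tau>) p) \<in> borel_measurable borel"
proof -
  define \<tau> where "\<tau> = Min {1, \<tau>0, \<rho>, (\<rho> / C) powr (1 / k)}"
  have \<tau>: "0 < \<tau>" "\<tau> \<le> 1" "\<tau> \<le> \<tau>0" "\<tau> \<le> \<rho>" "\<tau> \<le> (\<rho> / C) powr (1 / k)"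
    using bound(1) conv C by (auto simp: \<tau>_def)
  let ?S = "sector k C \<tau> :: ('a \<times> 'a) set"
  define G where "G p = inverse (ennreal (norm (double_series a (fst p) (snd p)) powr c))" for p :: "'a \<times> 'a"
  have sub: "?S \<subseteq> cball 0 \<rho> \<times> cball 0 \<rho>"
  proof clarify
    fix x y :: 'a assume "(x, y) \<in> ?S"
    then have *: "0 < norm x" "norm x < \<tau>" "norm y \<le> C * norm x powr k" by (auto simp: sector_def)
    have "norm x powr k \<le> ((\<rho> / C) powr (1 / k)) powr k" using * \<tau> k by (intro powr_mono2) auto
    also have "\<dots> = \<rho> / C" using k conv C by (simp add: powr_powr)
    finally have "C * norm x powr k \<le> \<rho>" using C by (simp add: field_simps)
    then show "x \<in> cball 0 \<rho> \<and> y \<in> cball 0 \<rho>" using * \<tau> by auto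
  qed
  have meas: "(\<lambda>p. G p * indicator ?S p) \<in> borel_measurable borel"
    unfolding G_def
    using continuous_on_subset[OF continuous_on_double_series[OF conv(1)] sub]
    by (intro neg_power_measurable) (auto simp: case_prod_unfold)
  have inner: "(\<integral>\<^sup>+y. G (x, y) * indicator ?S (x, y) \<partial>lborel)
     \<le> ennreal M * (ennreal (norm x powr (real DIM('a) * k - c * N)) * indicator {x. 0 < norm x \<and> norm x < 1} x)" for x
  proof (cases "0 < norm x \<and> norm x < \<tau>")
    case False
    then have "indicator ?S (x, y) = (0::ennreal)" for y by (auto simp: sector_def indicator_def)
    then show ?thesis by simp
  next
    case True
    define t where "t = norm x"
    define \<sigma> where "\<sigma> = x / of_real t"
    have t: "0 < t" "t < \<tau>" and x: "x = of_real t * \<sigma>" and \<sigma>: "norm \<sigma> = 1"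
      using True by (auto simp: t_def \<sigma>_def norm_divide)
    have "\<sigma> \<noteq> 0" using \<sigma> by auto
    have msl: "(\<lambda>y. G (x, y) * indicator ?S (x, y)) \<in> borel_measurable borel"
      using measurable_compose[OF measurable_Pair1' meas[folded borel_prod]] by simp
    have "(\<integral>\<^sup>+y. G (x, y) * indicator ?S (x, y) \<partial>lborel) =
       ennreal ((t powr k) ^ DIM('a)) * (\<integral>\<^sup>+z. G (x, (t powr k) *\<^sub>R z) * indicator ?S (x, (t powr k) *\<^sub>R z) \<partial>lborel)"
      using t by (intro nn_integral_scaleR msl) auto
    also have "(\<integral>\<^sup>+z. G (x, (t powr k) *\<^sub>R z) * indicator ?S (x, (t powr k) *\<^sub>R z) \<partial>lborel)
       = slice_integral a k c \<sigma> t (cball 0 C)"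
      unfolding slice_integral_def G_def
      by (intro nn_integral_cong) (use t True \<open>\<sigma> \<noteq> 0\<close> in \<open>auto simp: indicator_def sector_def x scaleR_conv_of_real
           norm_mult \<sigma>\<close>)
    also have "\<dots> \<le> ennreal (t powr (- c * N)) * ennreal M"
      using \<tau> t \<sigma> bound(2) by (auto simp: slice_bound_def)
    finally have "(\<integral>\<^sup>+y. G (x, y) * indicator ?S (x, y) \<partial>lborel) \<le>
      ennreal ((t powr k) ^ DIM('a)) * (ennreal (t powr (- c * N)) * ennreal M)"
      by (simp add: mult_left_mono)
    also have "\<dots> = ennreal M * (ennreal ((t powr k) ^ DIM('a)) * ennreal (t powr (- c * N)))"
      by (simp add: mult_ac)
    also have "ennreal ((t powr k) ^ DIM('a)) * ennreal (t powr (- c * N)) = ennreal (t powr (real DIM('a) * k - c * N))"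
      using t by (simp add: powr_realpow[symmetric] powr_powr powr_add[symmetric] ennreal_mult'[symmetric] mult_ac)
    finally show ?thesis using True \<tau> by (simp add: t_def)
  qed
  have "(\<integral>\<^sup>+p\<in>?S. G p \<partial>lborel) = (\<integral>\<^sup>+x. \<integral>\<^sup>+y. G (x, y) * indicator ?S (x, y) \<partial>lborel \<partial>lborel)"
    by (rule nn_integral_lborel_pair[OF meas])
  also have "\<dots> \<le> (\<integral>\<^sup>+x. ennreal M * (ennreal (norm x powr (real DIM('a) * k - c * N)) * indicator {x::'a. 0 < norm x \<and> norm x < 1} x) \<partial>lborel)"
    by (intro nn_integral_mono inner)
  also have "\<dots> = ennreal M * (\<integral>\<^sup>+x\<in>{x::'a. 0 < norm x \<and> norm x < 1}. ennreal (norm x powr (real DIM('a) * k - c * N)) \<partial>lborel)"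
    by (intro nn_integral_cmult) measurable
  also have "\<dots> < \<infinity>"
    using nn_integral_norm_powr_finite[where 'a='a, of "real DIM('a) * k - c * N"] cN
    by (simp add: ennreal_mult_less_top algebra_simps)
  finally have "(\<integral>\<^sup>+p\<in>?S. G p \<partial>lborel) < \<infinity>" .
  with meas \<tau>(1) show ?thesis unfolding G_def by blast
qed

text \<open>
  For c > 0 this is membership in the set whose supremum is the critical integrability index.
\<close>
definition neg_integrable :: "('a::euclidean_space \<Rightarrow> 'b::real_normed_vector) \<Rightarrow> real \<Rightarrow> bool"
  where "neg_integrable f c \<longleftrightarrow>
    (\<exists>\<epsilon>>0. (\<integral>\<^sup>+z\<in>ball 0 \<epsilon>. inverse (ennreal (norm (f z) powr c)) \<partial>lborel) < \<infinity>)"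

definition swap_coeffs :: "(nat \<times> nat \<Rightarrow> 'a) \<Rightarrow> nat \<times> nat \<Rightarrow> 'a"
  where "swap_coeffs a = (\<lambda>(i, j). a (j, i))"

lemma swap_coeffs_apply [simp]: "swap_coeffs a (i, j) = a (j, i)"
  by (simp add: swap_coeffs_def)

lemma swap_coeffs_swap [simp]: "swap_coeffs (swap_coeffs a) = a"
  by (auto simp: swap_coeffs_def)

lemma abs_conv_swap: "abs_conv a r R \<Longrightarrow> abs_conv (swap_coeffs a) R r"
  unfolding abs_conv_def
  by (subst summable_on_swap[where A=UNIV and B=UNIV, simplified]) (simp add: case_prod_unfold mult_ac)

lemma double_series_swap: "double_series (swap_coeffs a) x y = double_series a y x"
  unfolding double_series_def
  by (rule infsum_reindex_bij_witness[where i="\<lambda>(i,j). (j,i)" and j="\<lambda>(i,j). (j,i)"]) auto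

lemma edge_taylor_at_0:
  assumes "0 < k" "(i0, j0) \<in> edge a k N"
  shows "edge_taylor a k N \<sigma> 0 j0 = a (i0, j0) * \<sigma> ^ i0"
proof -
  have "edge_taylor a k N \<sigma> 0 j0 = (\<Sum>ij\<in>{(i0, j0)}. a (i0, j0) * \<sigma> ^ i0)"
    unfolding edge_taylor_def
  proof (rule sum.mono_neutral_cong_right[OF finite_edge[OF assms(1)]])
    show "\<forall>x\<in>edge a k N - {(i0, j0)}. (case x of (i, j) \<Rightarrow> a (i, j) * \<sigma> ^ i * of_nat (j choose j0) * 0 ^ (j - j0)) = 0"
    proof
      fix x assume x: "x \<in> edge a k N - {(i0, j0)}"
      obtain i j where ij: "x = (i, j)" by force
      have "j \<noteq> j0" using assms x by (auto simp: edge_def ij)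
      then show "(case x of (i, j) \<Rightarrow> a (i, j) * \<sigma> ^ i * of_nat (j choose j0) * 0 ^ (j - j0)) = 0"
        by (cases "j < j0") (auto simp: binomial_eq_0 ij)
    qed
  qed (use assms in auto)
  then show ?thesis by simp
qed

text \<open>
  A punctured neighbourhood of the origin is covered by the sector |y| \<le> C |x|^k and by a sector
  of the same kind with the coordinates exchanged. On the second one only z = 0 matters, provided
  that it is thin; there the end point (i0, j0) of the edge bounds the order by i0.
\<close>
lemma neg_integrable_if_weights:
  fixes a :: "nat \<times> nat \<Rightarrow> 'a::{real_normed_field,euclidean_space}"
  assumes conv: "abs_conv a \<rho> \<rho>" "0 < \<rho>" and k: "0 < k" and N: "weight_ge a k N" and c: "0 < c"
    and cN: "c * N < real DIM('a) * (1 + k)"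
    and nz: "\<And>\<sigma> z. norm \<sigma> = 1 \<Longrightarrow> \<exists>s. edge_taylor a k N \<sigma> z s \<noteq> 0 \<and> c * real s < real DIM('a)"
    and tip: "(i0, j0) \<in> edge a k N" "c * real i0 < real DIM('a)"
  shows "neg_integrable (\<lambda>(x, y). double_series a x y) c"
proof -
  let ?b = "swap_coeffs a"
  have convb: "abs_conv ?b \<rho> \<rho>" by (rule abs_conv_swap[OF conv(1)])
  have k': "0 < 1 / k" using k by simp
  have Nb: "weight_ge ?b (1 / k) (N / k)"
    using N k unfolding weight_ge_def by (auto simp: field_simps)
  have tipb: "(j0, i0) \<in> edge ?b (1 / k) (N / k)" using tip k by (auto simp: edge_def field_simps)
  have cNb: "c * (N / k) < real DIM('a) * (1 + 1 / k)"
    using cN k by (simp add: field_simps)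
  have "\<exists>r>0. \<exists>\<tau>>0. \<exists>M. slice_bound ?b (1 / k) (N / k) c (ball 0 r) \<tau> M"
  proof (rule slice_integral_bound_point[OF convb conv(2) k' Nb c])
    fix \<sigma> :: 'a assume "norm \<sigma> = 1"
    then have "edge_taylor ?b (1 / k) (N / k) \<sigma> 0 i0 \<noteq> 0"
      using edge_taylor_at_0[OF k' tipb, of \<sigma>] tip by (auto simp: edge_def)
    then show "\<exists>s. edge_taylor ?b (1 / k) (N / k) \<sigma> 0 s \<noteq> 0 \<and> c * real s < real DIM('a)" using tip by blast
  qed
  then obtain r \<tau>b Mb where r: "0 < r" "0 < \<tau>b" and Mb: "slice_bound ?b (1 / k) (N / k) c (ball 0 r) \<tau>b Mb"
    by auto
  have "cball 0 (r / 2) \<subseteq> ball (0::'a) r" using r by auto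
  then have Mb': "slice_bound ?b (1 / k) (N / k) c (cball 0 (r / 2)) \<tau>b Mb"
    using Mb order_trans[OF slice_integral_mono] unfolding slice_bound_def by blast
  have r2: "0 < r / 2" using r by simp
  let ?G = "\<lambda>a (p :: 'a \<times> 'a). inverse (ennreal (norm (double_series a (fst p) (snd p)) powr c))"
  obtain \<tau>2 where \<tau>2: "\<tau>2 > 0" and fin2: "(\<integral>\<^sup>+p\<in>sector (1 / k) (r / 2) \<tau>2. ?G ?b p \<partial>lborel) < \<infinity>"
    and meas2: "(\<lambda>p. ?G ?b p * indicator (sector (1 / k) (r / 2) \<tau>2) p) \<in> borel_measurable borel"
    using sector_integral_finite[OF convb conv(2) k' r2 cNb r(2) Mb'] by auto
  (* This C makes the first sector the complement of the second: norm y > C * norm x powr k means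
  norm x < r / 2 * norm y powr (1 / k). *)
  define C where "C = (2 / r) powr k"
  have C: "0 < C" using r by (simp add: C_def)
  obtain \<tau>a Ma where \<tau>a: "0 < \<tau>a" and Ma: "slice_bound a k N c (cball 0 C) \<tau>a Ma"
    using slice_integral_bound_cball[OF conv k N c C nz] by auto
  obtain \<tau>1 where \<tau>1: "\<tau>1 > 0" and fin1: "(\<integral>\<^sup>+p\<in>sector k C \<tau>1. ?G a p \<partial>lborel) < \<infinity>"
    and meas1: "(\<lambda>p. ?G a p * indicator (sector k C \<tau>1) p) \<in> borel_measurable borel"
    using sector_integral_finite[OF conv k C cN \<tau>a Ma] by auto
  define \<epsilon> where "\<epsilon> = min \<tau>1 \<tau>2"
  have \<epsilon>: "\<epsilon> > 0" using \<tau>1 \<tau>2 by (simp add: \<epsilon>_def)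
  let ?sw = "\<lambda>(x :: 'a, y :: 'a). (y, x)"
  have msw: "?sw \<in> measurable borel borel"
    by (intro borel_measurable_continuous_onI) (auto simp: case_prod_unfold intro!: continuous_intros)
  have cover: "?G a p * indicator (ball 0 \<epsilon>) p \<le>
      ?G a p * indicator (sector k C \<tau>1) p + ?G ?b (?sw p) * indicator (sector (1 / k) (r / 2) \<tau>2) (?sw p)"
    if p0: "p \<noteq> 0" for p
  proof (cases "p \<in> ball 0 \<epsilon>")
    case True
    obtain x y where p: "p = (x, y)" by force
    have xy: "norm x < \<tau>1" "norm y < \<tau>2"
      using True norm_fst_le[of x y] norm_snd_le[of y x] by (auto simp: p \<epsilon>_def)
    have "(x, y) \<in> sector k C \<tau>1 \<or> (y, x) \<in> sector (1 / k) (r / 2) \<tau>2"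
    proof (cases "norm y \<le> C * norm x powr k")
      case True
      then show ?thesis using xy p0 p by (auto simp: sector_def zero_prod_def)
    next
      case False
      then have y: "norm y > C * norm x powr k" by simp
      then have ypos: "norm y > 0" using C by (smt (verit) mult_nonneg_nonneg powr_ge_zero)
      have "(C * norm x powr k) powr (1 / k) \<le> norm y powr (1 / k)"
        using y k C by (intro powr_mono2) auto
      also have "(C * norm x powr k) powr (1 / k) = (2 / r) * norm x"
        using k r by (simp add: C_def powr_mult powr_powr)
      finally have "norm x \<le> r / 2 * norm y powr (1 / k)" using r by (simp add: field_simps)
      then show ?thesis using xy ypos by (auto simp: sector_def)
    qed
    then show ?thesis
      by (auto simp: p double_series_swap indicator_def)
  qed simp
  have "AE p in lborel. p \<noteq> (0 :: 'a \<times> 'a)" by (rule AE_lborel_singleton)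
  then have "(\<integral>\<^sup>+p\<in>ball 0 \<epsilon>. ?G a p \<partial>lborel) \<le>
     (\<integral>\<^sup>+p. ?G a p * indicator (sector k C \<tau>1) p + ?G ?b (?sw p) * indicator (sector (1 / k) (r / 2) \<tau>2) (?sw p) \<partial>lborel)"
    using cover by (intro nn_integral_mono_AE) (auto elim!: eventually_mono)
  also have "\<dots> = (\<integral>\<^sup>+p. ?G a p * indicator (sector k C \<tau>1) p \<partial>lborel) +
      (\<integral>\<^sup>+p. ?G ?b (?sw p) * indicator (sector (1 / k) (r / 2) \<tau>2) (?sw p) \<partial>lborel)"
    using meas1 measurable_compose[OF msw meas2] by (intro nn_integral_add) auto
  also have "(\<integral>\<^sup>+p. ?G ?b (?sw p) * indicator (sector (1 / k) (r / 2) \<tau>2) (?sw p) \<partial>lborel)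
     = (\<integral>\<^sup>+p. ?G ?b p * indicator (sector (1 / k) (r / 2) \<tau>2) p \<partial>(distr lborel lborel ?sw))"
    using msw meas2 by (subst nn_integral_distr) auto
  also have "distr lborel lborel ?sw = lborel" by (rule distr_lborel_swap)
  also have "(\<integral>\<^sup>+p. ?G a p * indicator (sector k C \<tau>1) p \<partial>lborel) + (\<integral>\<^sup>+p. ?G ?b p * indicator (sector (1 / k) (r / 2) \<tau>2) p \<partial>lborel) < \<infinity>"
    using fin1 fin2 by simp
  finally show ?thesis
    unfolding neg_integrable_def case_prod_unfold using \<epsilon> by blast
qed

section \<open>The diagonal of the Newton polyhedron and failure of integrability\<close>

text \<open>
  The Newton polyhedron as a function of the coefficients, which are available before a germ with
  these coefficients is fixed.
\<close>
definition newton_hull :: "(nat \<times> nat \<Rightarrow> 'a::zero) \<Rightarrow> (real \<times> real) set"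
  where "newton_hull a = convex hull
    (\<Union>(p, q)\<in>{pq. a pq \<noteq> 0}. {(s, t). real p \<le> s \<and> real q \<le> t})"

text \<open>
  The reciprocal of the Newton distance.
\<close>
definition diagonal_exit :: "(nat \<times> nat \<Rightarrow> 'a::zero) \<Rightarrow> real"
  where "diagonal_exit a = Inf {t. 0 \<le> t \<and> (t, t) \<in> newton_hull a}"

lemma newton_hull_halfplane:
  assumes "0 \<le> \<kappa>1" "0 \<le> \<kappa>2" "\<And>i j. a (i, j) \<noteq> 0 \<Longrightarrow> N \<le> \<kappa>1 * real i + \<kappa>2 * real j"
    and "(s, t) \<in> newton_hull a"
  shows "N \<le> \<kappa>1 * s + \<kappa>2 * t"
proof -
  have "newton_hull a \<subseteq> {x. (\<kappa>1, \<kappa>2) \<bullet> x \<ge> N}"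
    unfolding newton_hull_def
  proof (rule hull_minimal)
    show "(\<Union>(p, q)\<in>{pq. a pq \<noteq> 0}. {(s, t). real p \<le> s \<and> real q \<le> t}) \<subseteq> {x. N \<le> (\<kappa>1, \<kappa>2) \<bullet> x}"
    proof clarify
      fix p q and s t :: real assume *: "a (p, q) \<noteq> 0" "real p \<le> s" "real q \<le> t"
      have "N \<le> \<kappa>1 * real p + \<kappa>2 * real q" using assms(3) * by blast
      also have "\<dots> \<le> \<kappa>1 * s + \<kappa>2 * t" using * assms by (intro add_mono mult_left_mono) auto
      finally show "N \<le> (\<kappa>1, \<kappa>2) \<bullet> (s, t)" by (simp add: inner_prod_def)
    qed
  qed (rule convex_halfspace_ge)
  then show ?thesis using assms(4) by (auto simp: inner_prod_def)
qed

lemma newton_hull_generator: "a (i, j) \<noteq> 0 \<Longrightarrow> real i \<le> s \<Longrightarrow> real j \<le> t \<Longrightarrow> (s, t) \<in> newton_hull a"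
  unfolding newton_hull_def by (rule hull_inc) auto

lemma newton_hull_upward:
  assumes "(s, t) \<in> newton_hull a" "s \<le> s'" "t \<le> t'"
  shows "(s', t') \<in> newton_hull a"
proof -
  let ?S = "\<Union>(p, q)\<in>{pq. a pq \<noteq> 0}. {(s, t). real p \<le> s \<and> real q \<le> t}"
  let ?v = "(s' - s, t' - t)"
  have "(\<lambda>x. ?v + x) ` ?S \<subseteq> ?S" using assms(2,3) by force
  then have "(\<lambda>x. ?v + x) ` (convex hull ?S) \<subseteq> convex hull ?S"
    unfolding convex_hull_translation[symmetric] by (rule hull_mono)
  moreover have "(s', t') = ?v + (s, t)" by simp
  ultimately show ?thesis using assms(1) unfolding newton_hull_def by blast
qed

lemma newton_hull_nonneg:
  assumes "(s, t) \<in> newton_hull a" shows "0 \<le> s" "0 \<le> t"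
  using newton_hull_halfplane[of 1 0 a 0, OF _ _ _ assms] newton_hull_halfplane[of 0 1 a 0, OF _ _ _ assms] by auto

lemma diagonal_set_nonempty:
  assumes "a ij \<noteq> 0" shows "{t. 0 \<le> t \<and> (t, t) \<in> newton_hull a} \<noteq> {}"
proof -
  obtain i j where "ij = (i, j)" by force
  then have "(real (max i j), real (max i j)) \<in> newton_hull a"
    using assms by (intro newton_hull_generator[of a i j]) auto
  then have "real (max i j) \<in> {t. 0 \<le> t \<and> (t, t) \<in> newton_hull a}" by simp
  then show ?thesis by blast
qed

text \<open>
  The polyhedron lies in the half-plane, and so does the point at which the diagonal enters it.
\<close>
lemma weight_le_diagonal_exit:
  assumes "a ij \<noteq> 0" "0 \<le> \<kappa>1" "0 \<le> \<kappa>2" "0 < \<kappa>1 + \<kappa>2"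
    and "\<And>i j. a (i, j) \<noteq> 0 \<Longrightarrow> N \<le> \<kappa>1 * real i + \<kappa>2 * real j"
  shows "N \<le> (\<kappa>1 + \<kappa>2) * diagonal_exit a"
proof -
  have "N / (\<kappa>1 + \<kappa>2) \<le> diagonal_exit a"
    unfolding diagonal_exit_def
  proof (rule cInf_greatest[OF diagonal_set_nonempty[of a ij]])
    fix t assume "t \<in> {t. 0 \<le> t \<and> (t, t) \<in> newton_hull a}"
    then have "N \<le> \<kappa>1 * t + \<kappa>2 * t" using newton_hull_halfplane[OF assms(2,3,5)] by blast
    then show "N / (\<kappa>1 + \<kappa>2) \<le> t" using assms(4) by (simp add: field_simps)
  qed (rule assms(1))
  then show ?thesis using assms(4) by (simp add: field_simps)
qed

lemma diagonal_exit_pos: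
  assumes "a ij \<noteq> 0" "a (0, 0) = 0"
  shows "0 < diagonal_exit a"
proof -
  have "1 \<le> (1 + 1) * diagonal_exit a"
  proof (rule weight_le_diagonal_exit[where a=a, OF assms(1)])
    fix i j assume "a (i, j) \<noteq> 0"
    then have "i \<noteq> 0 \<or> j \<noteq> 0" using assms(2) by metis
    then have "1 \<le> i + j" by auto
    then show "1 \<le> 1 * real i + 1 * real j" by (simp flip: of_nat_add)
  qed auto
  then show ?thesis by simp
qed

text \<open>
  The polyhedron is disjoint from the open quadrant below (d, d), d = diagonal_exit a, because it is
  closed under increasing coordinates. A separating line passes through (d, d), and the quadrant
  forces its normal to have entries of one sign.
\<close>
lemma diagonal_exit_supporting_line:
  assumes "a ij \<noteq> 0"
  obtains \<kappa>1 \<kappa>2 where "0 \<le> \<kappa>1" "0 \<le> \<kappa>2" "0 < \<kappa>1 + \<kappa>2"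
    "\<And>i j. a (i, j) \<noteq> 0 \<Longrightarrow> (\<kappa>1 + \<kappa>2) * diagonal_exit a \<le> \<kappa>1 * real i + \<kappa>2 * real j"
proof -
  define d where "d = diagonal_exit a"
  define T where "T = {(s, t). s < d \<and> t < d}"
  have bdd: "bdd_below {t. 0 \<le> t \<and> (t, t) \<in> newton_hull a}" by (rule bdd_belowI[of _ 0]) auto
  have disj: "newton_hull a \<inter> T = {}"
  proof (rule ccontr)
    assume "newton_hull a \<inter> T \<noteq> {}"
    then obtain s t where st: "(s, t) \<in> newton_hull a" "s < d" "t < d" by (auto simp: T_def)
    have "(max s t, max s t) \<in> newton_hull a" by (rule newton_hull_upward[OF st(1)]) auto
    then have "d \<le> max s t" unfolding d_def diagonal_exit_def
      using newton_hull_nonneg[OF st(1)] by (intro cInf_lower bdd) auto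
    then show False using st by auto
  qed
  have "T = {..<d} \<times> {..<d}" by (auto simp: T_def)
  then have cT: "convex T" by (simp add: convex_Times convex_real_interval)
  have "(d - 1, d - 1) \<in> T" by (simp add: T_def)
  then have neT: "T \<noteq> {}" by blast
  have neS: "newton_hull a \<noteq> {}" using diagonal_set_nonempty[where a=a, OF assms] by blast
  have cS: "convex (newton_hull a)" by (simp add: newton_hull_def)
  obtain v b where v: "v \<noteq> 0" "\<forall>x\<in>newton_hull a. v \<bullet> x \<le> b" "\<forall>x\<in>T. b \<le> v \<bullet> x"
    using separating_hyperplane_sets[OF cS cT neS neT disj] by blast
  obtain v1 v2 where v12: "v = (v1, v2)" by force
  have T: "b \<le> v1 * s + v2 * t" if "s < d" "t < d" for s t
    using v(3) that by (auto simp: T_def v12 inner_prod_def)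
  have le0: "w1 \<le> 0" if *: "\<And>s t. s < d \<Longrightarrow> t < d \<Longrightarrow> b \<le> w1 * s + w2 * t" for w1 w2
  proof (rule ccontr)
    assume "\<not> w1 \<le> 0"
    then have w: "w1 > 0" by simp
    define q where "q = (w1 * d + w2 * (d - 1) - b) / w1"
    define m where "m = \<bar>q\<bar> + 1"
    have "m > 0" unfolding m_def by (rule add_nonneg_pos) auto
    then have "b \<le> w1 * (d - m) + w2 * (d - 1)" by (intro *) auto
    then have "w1 * m \<le> w1 * d + w2 * (d - 1) - b" by (simp add: algebra_simps)
    then have "m \<le> q" using w by (simp add: q_def field_simps)
    then show False by (simp add: m_def)
  qed
  have neg: "v1 \<le> 0" "v2 \<le> 0"
    using le0[of v1 v2] le0[of v2 v1] T by (auto simp: add.commute)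
  have bd: "b \<le> (v1 + v2) * d"
  proof (rule field_le_epsilon)
    fix e :: real assume e: "e > 0"
    define \<delta> where "\<delta> = e / (\<bar>v1 + v2\<bar> + 1)"
    have \<delta>: "\<delta> > 0" using e by (simp add: \<delta>_def add_nonneg_pos)
    have "b \<le> v1 * (d - \<delta>) + v2 * (d - \<delta>)" using \<delta> by (intro T) auto
    also have "\<dots> = (v1 + v2) * d + \<bar>v1 + v2\<bar> * \<delta>" using neg by (simp add: algebra_simps)
    also have "\<bar>v1 + v2\<bar> * \<delta> \<le> (\<bar>v1 + v2\<bar> + 1) * \<delta>" using \<delta> by (intro mult_right_mono) auto
    also have "\<dots> = e" by (simp add: \<delta>_def add_nonneg_pos[THEN less_imp_neq, THEN not_sym])
    finally show "b \<le> (v1 + v2) * d + e" by simp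
  qed
  show ?thesis
  proof (rule that[of "- v1" "- v2"])
    show "0 < - v1 + - v2" using neg v(1) v12 by (auto simp: zero_prod_def)
    fix i j assume "a (i, j) \<noteq> 0"
    then have "(real i, real j) \<in> newton_hull a" by (rule newton_hull_generator) auto
    then have "v1 * real i + v2 * real j \<le> b" using v(2) by (auto simp: v12 inner_prod_def)
    then show "(- v1 + - v2) * diagonal_exit a \<le> - v1 * real i + - v2 * real j"
      using bd by (simp add: d_def algebra_simps)
  qed (use neg in auto)
qed

text \<open>
  With the weights of a supporting line at (d, d), d = diagonal_exit a, the function is
  O(l^((\<kappa>1 + \<kappa>2) d)) on polydiscs of volume proportional to l^((\<kappa>1 + \<kappa>2)
  e), e = DIM('a). So the integral is at least a multiple of l^((\<kappa>1 + \<kappa>2) (e - c d)),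
  which is unbounded as l tends to 0. This is valid in every coordinate system.
\<close>
lemma not_neg_integrable_above_exit:
  fixes a :: "nat \<times> nat \<Rightarrow> 'a::{real_normed_field,euclidean_space}"
  assumes conv: "abs_conv a \<rho> \<rho>" "0 < \<rho>" and nz: "a ij \<noteq> 0" and c: "0 < c"
    and big: "real DIM('a) < c * diagonal_exit a"
  shows "\<not> neg_integrable (\<lambda>(x, y). double_series a x y) c"
proof
  assume "neg_integrable (\<lambda>(x, y). double_series a x y) c"
  then obtain \<epsilon> where \<epsilon>: "\<epsilon> > 0" and
    fin: "(\<integral>\<^sup>+z\<in>ball 0 \<epsilon>. inverse (ennreal (norm (double_series a (fst z) (snd z)) powr c)) \<partial>lborel) < \<infinity>" (is "?I < \<infinity>")
    unfolding neg_integrable_def case_prod_unfold by blast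
  obtain \<kappa>1 \<kappa>2 where \<kappa>: "0 \<le> \<kappa>1" "0 \<le> \<kappa>2" "0 < \<kappa>1 + \<kappa>2"
    "\<And>i j. a (i, j) \<noteq> 0 \<Longrightarrow> (\<kappa>1 + \<kappa>2) * diagonal_exit a \<le> \<kappa>1 * real i + \<kappa>2 * real j"
    using diagonal_exit_supporting_line[where a=a, OF nz] by blast
  define W where "W = (\<kappa>1 + \<kappa>2) * diagonal_exit a"
  define r where "r = min \<rho> (\<epsilon> / 2)"
  have r: "r > 0" "r \<le> \<rho>" "r \<le> \<epsilon> / 2" using conv \<epsilon> by (auto simp: r_def)
  have convr: "abs_conv a r r" using abs_conv_mono[OF conv(1)] r by simp
  define w where "w = (\<lambda>(i, j). norm (a (i, j)) * r ^ i * r ^ j)"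
  have wsum: "w summable_on UNIV" using convr by (simp add: abs_conv_def w_def)
  define A where "A = infsum w UNIV + 1"
  have A: "A > 0" unfolding A_def by (intro add_nonneg_pos infsum_nonneg) (use r in \<open>auto simp: w_def\<close>)
  let ?V = "unit_ball_vol (real DIM('a))"
  define K where "K = A powr (- c) * (?V * r ^ DIM('a))\<^sup>2"
  have K: "K > 0" unfolding K_def using A r by (intro mult_pos_pos zero_less_power) auto
  have lower: "ennreal (K * l powr ((\<kappa>1 + \<kappa>2) * (real DIM('a) - c * diagonal_exit a))) \<le> ?I" if l: "0 < l" "l \<le> 1" for l
  proof -
    define r1 where "r1 = r * l powr \<kappa>1"
    define r2 where "r2 = r * l powr \<kappa>2"
    have pw: "l powr \<kappa>1 \<le> 1" "l powr \<kappa>2 \<le> 1" using l \<kappa> by (auto intro: powr_le1)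
    have r12: "0 < r1" "r1 \<le> r" "0 < r2" "r2 \<le> r"
      using r l pw mult_left_mono[OF pw(1), of r] mult_left_mono[OF pw(2), of r] by (auto simp: r1_def r2_def)
    have fb: "norm (double_series a x y) \<le> A * l powr W" if xy: "norm x < r1" "norm y < r2" for x y
    proof -
      have hs: "((\<lambda>(i, j). a (i, j) * x ^ i * y ^ j) has_sum double_series a x y) UNIV"
        using xy r12 by (intro abs_conv_has_sum[OF convr]) auto
      have "norm (double_series a x y) \<le> l powr W * infsum w UNIV"
      proof (rule norm_infsum_le[OF hs has_sum_cmult_right[OF has_sum_infsum[OF wsum]]])
        fix ij :: "nat \<times> nat"
        obtain i j where ij: "ij = (i, j)" by force
        show "norm (case ij of (i, j) \<Rightarrow> a (i, j) * x ^ i * y ^ j) \<le> l powr W * w ij"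
        proof (cases "a (i, j) = 0")
          case False
          have "norm (a (i, j) * x ^ i * y ^ j) \<le> norm (a (i, j)) * r1 ^ i * r2 ^ j"
            unfolding norm_mult norm_power using xy r12 by (intro mult_mono power_mono) auto
          also have "\<dots> = norm (a (i, j)) * r ^ i * r ^ j * l powr (\<kappa>1 * real i + \<kappa>2 * real j)"
            using l by (simp add: r1_def r2_def power_mult_distrib powr_add powr_realpow[symmetric] powr_powr)
          also have "\<dots> \<le> norm (a (i, j)) * r ^ i * r ^ j * l powr W"
            using l r \<kappa>(4)[OF False] by (intro mult_left_mono powr_mono') (auto simp: W_def)
          finally show ?thesis by (simp add: ij w_def mult_ac)
        qed (simp add: ij w_def)
      qed
      also have "\<dots> \<le> A * l powr W" by (simp add: A_def algebra_simps)
      finally show ?thesis .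
    qed
    let ?P = "ball (0::'a) r1 \<times> ball (0::'a) r2"
    have sub: "?P \<subseteq> ball 0 \<epsilon>"
    proof clarify
      fix x y :: 'a assume "x \<in> ball 0 r1" "y \<in> ball 0 r2"
      then have "norm x < \<epsilon> / 2" "norm y < \<epsilon> / 2" using r12 r by auto
      then show "(x, y) \<in> ball 0 \<epsilon>" using norm_Pair_le[of x y] by auto
    qed
    have "ennreal ((A * l powr W) powr (- c)) * indicator ?P z \<le>
        inverse (ennreal (norm (double_series a (fst z) (snd z)) powr c)) * indicator (ball 0 \<epsilon>) z" for z
    proof (cases "z \<in> ?P")
      case True
      let ?n = "norm (double_series a (fst z) (snd z))"
      have n: "?n \<le> A * l powr W" using True by (intro fb) auto
      have "ennreal ((A * l powr W) powr (- c)) \<le> inverse (ennreal (?n powr c))"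
      proof (cases "?n = 0")
        case False
        have "?n powr c \<le> (A * l powr W) powr c" using n c by (intro powr_mono2) auto
        then have "(A * l powr W) powr (- c) \<le> inverse (?n powr c)"
          unfolding powr_minus using False by (intro le_imp_inverse_le) auto
        then show ?thesis using False by (simp add: inverse_ennreal ennreal_leI)
      qed simp
      then show ?thesis using True sub by (auto simp: indicator_def)
    qed simp
    then have "(\<integral>\<^sup>+z. ennreal ((A * l powr W) powr (- c)) * indicator ?P z \<partial>lborel) \<le> ?I"
      by (intro nn_integral_mono)
    also have "(\<integral>\<^sup>+z. ennreal ((A * l powr W) powr (- c)) * indicator ?P z \<partial>lborel)
       = ennreal ((A * l powr W) powr (- c)) * emeasure lborel ?P"
      by (intro nn_integral_cmult_indicator) (simp add: borel_Times)
    also have "emeasure lborel ?P = ennreal (?V * r1 ^ DIM('a)) * ennreal (?V * r2 ^ DIM('a))"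
      using r12 by (simp add: lborel_prod[symmetric] lborel.emeasure_pair_measure_Times emeasure_ball)
    also have "ennreal ((A * l powr W) powr (- c)) * (ennreal (?V * r1 ^ DIM('a)) * ennreal (?V * r2 ^ DIM('a)))
      = ennreal ((A * l powr W) powr (- c) * ((?V * r1 ^ DIM('a)) * (?V * r2 ^ DIM('a))))"
      using r12 by (simp add: ennreal_mult)
    also have "(A * l powr W) powr (- c) * ((?V * r1 ^ DIM('a)) * (?V * r2 ^ DIM('a)))
       = K * l powr ((\<kappa>1 + \<kappa>2) * (real DIM('a) - c * diagonal_exit a))"
    proof -
      have "(l powr \<kappa>1) ^ DIM('a) * (l powr \<kappa>2) ^ DIM('a) * (l powr W) powr (- c) = l powr ((\<kappa>1 + \<kappa>2) * (real DIM('a) - c * diagonal_exit a))"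
        using l by (simp add: powr_realpow[symmetric] powr_powr powr_add[symmetric] W_def algebra_simps)
      then show ?thesis
        using A l by (simp add: K_def r1_def r2_def power_mult_distrib powr_mult power2_eq_square mult_ac)
    qed
    finally show ?thesis .
  qed
  define \<gamma> where "\<gamma> = (\<kappa>1 + \<kappa>2) * (c * diagonal_exit a - real DIM('a))"
  have \<gamma>: "\<gamma> > 0" using \<kappa> big by (simp add: \<gamma>_def)
  define B where "B = enn2real ?I"
  have B: "?I = ennreal B" "B \<ge> 0" using fin by (auto simp: B_def)
  define l where "l = min 1 ((K / (B + 1)) powr (1 / \<gamma>))"
  have l: "0 < l" "l \<le> 1" using K B by (auto simp: l_def)
  have "l powr \<gamma> \<le> ((K / (B + 1)) powr (1 / \<gamma>)) powr \<gamma>" using l \<gamma> by (intro powr_mono2) (auto simp: l_def)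
  also have "\<dots> = K / (B + 1)" using \<gamma> K B by (simp add: powr_powr)
  finally have "B + 1 \<le> K * inverse (l powr \<gamma>)" using l B by (simp add: field_simps)
  also have "inverse (l powr \<gamma>) = l powr ((\<kappa>1 + \<kappa>2) * (real DIM('a) - c * diagonal_exit a))"
    by (simp add: powr_minus[symmetric] \<gamma>_def algebra_simps)
  finally have "B + 1 \<le> K * l powr ((\<kappa>1 + \<kappa>2) * (real DIM('a) - c * diagonal_exit a))" .
  then have "ennreal (B + 1) \<le> ?I" by (rule order_trans[OF ennreal_leI lower[OF l]])
  then show False using B by (simp add: ennreal_le_iff2)
qed

section \<open>Invariance of integrability under shears and exchange of coordinates\<close>

text \<open>
  The integral over the preimage of a ball is unchanged by a measure preserving map, and continuity
  at 0 puts a ball into that preimage.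
\<close>
lemma neg_integrable_comp:
  fixes f :: "'a::euclidean_space \<Rightarrow> 'b::real_normed_vector"
  assumes T: "T \<in> measurable borel borel" "distr lborel lborel T = (lborel :: 'a measure)" "isCont T 0" "T 0 = 0"
    and f: "continuous_on (ball 0 \<rho>) f" "0 < \<rho>"
    and int: "neg_integrable f c"
  shows "neg_integrable (f \<circ> T) c"
proof -
  obtain \<epsilon>0 where \<epsilon>0: "\<epsilon>0 > 0" "(\<integral>\<^sup>+z\<in>ball 0 \<epsilon>0. inverse (ennreal (norm (f z) powr c)) \<partial>lborel) < \<infinity>"
    using int unfolding neg_integrable_def by blast
  define \<epsilon> where "\<epsilon> = min \<epsilon>0 \<rho>"
  have \<epsilon>: "\<epsilon> > 0" "\<epsilon> \<le> \<epsilon>0" "\<epsilon> \<le> \<rho>" using \<epsilon>0 f by (auto simp: \<epsilon>_def)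
  define G where "G z = inverse (ennreal (norm (f z) powr c)) * indicator (ball 0 \<epsilon>) z" for z
  have G: "G \<in> borel_measurable borel"
    unfolding G_def using \<epsilon> by (intro neg_power_measurable continuous_on_subset[OF f(1)]) auto
  have Gfin: "(\<integral>\<^sup>+z. G z \<partial>lborel) < \<infinity>"
    by (rule le_less_trans[OF nn_integral_mono \<epsilon>0(2)]) (use \<epsilon> in \<open>auto simp: G_def indicator_def\<close>)
  obtain \<epsilon>' where \<epsilon>': "\<epsilon>' > 0" "\<And>z. dist z 0 < \<epsilon>' \<Longrightarrow> dist (T z) 0 < \<epsilon>"
    using T(3,4) \<epsilon>(1) unfolding continuous_at_eps_delta by metis
  have "(\<integral>\<^sup>+z\<in>ball 0 \<epsilon>'. inverse (ennreal (norm ((f \<circ> T) z) powr c)) \<partial>lborel) \<le> (\<integral>\<^sup>+z. G (T z) \<partial>lborel)"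
    using \<epsilon>'(2) by (intro nn_integral_mono) (auto simp: G_def indicator_def dist_commute)
  also have "\<dots> = (\<integral>\<^sup>+z. G z \<partial>(distr lborel lborel T))"
    using T(1) G by (subst nn_integral_distr) auto
  also have "\<dots> < \<infinity>" using Gfin by (simp add: T(2))
  finally show ?thesis unfolding neg_integrable_def using \<epsilon>' by blast
qed

text \<open>
  By Fubini, as every vertical slice is translated.
\<close>
lemma distr_lborel_shear:
  fixes Q :: "'a::euclidean_space \<Rightarrow> 'b::euclidean_space"
  assumes [measurable]: "Q \<in> borel_measurable borel"
  shows "(\<lambda>(x, y). (x, y + Q x)) \<in> measurable borel borel"
    and "distr lborel lborel (\<lambda>(x, y). (x, y + Q x)) = (lborel :: ('a \<times> 'b) measure)"
proof -
  let ?T = "\<lambda>(x, y). (x, y + Q x)"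
  have "?T \<in> measurable (borel \<Otimes>\<^sub>M borel) (borel \<Otimes>\<^sub>M borel)" by measurable
  then show m: "?T \<in> measurable borel borel" by (simp add: borel_prod)
  show "distr lborel lborel ?T = (lborel :: ('a \<times> 'b) measure)"
  proof (rule measure_eqI)
    fix A assume "A \<in> sets (distr lborel lborel ?T)"
    then have A: "A \<in> sets borel" by simp
    let ?I = "indicator A :: 'a \<times> 'b \<Rightarrow> ennreal"
    have I: "?I \<in> borel_measurable borel" using A by simp
    have Isec: "(\<lambda>y. ?I (x, y)) \<in> borel_measurable borel" for x
      using measurable_compose[OF measurable_Pair1' I[folded borel_prod]] by simp
    have "emeasure (distr lborel lborel ?T) A = (\<integral>\<^sup>+p. ?I p \<partial>(distr lborel lborel ?T))"
      using A by simp
    also have "\<dots> = (\<integral>\<^sup>+p. ?I (?T p) \<partial>lborel)"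
      using m I by (subst nn_integral_distr) auto
    also have "\<dots> = (\<integral>\<^sup>+x. \<integral>\<^sup>+y. ?I (x, y + Q x) \<partial>lborel \<partial>lborel)"
      using nn_integral_lborel_pair[OF measurable_compose[OF m I]] by simp
    also have "\<dots> = (\<integral>\<^sup>+x. \<integral>\<^sup>+y. ?I (x, y) \<partial>lborel \<partial>lborel)"
    proof (rule nn_integral_cong)
      fix x
      have "(\<integral>\<^sup>+y. ?I (x, y) \<partial>lborel) = (\<integral>\<^sup>+y. ?I (x, y) \<partial>(distr lborel borel ((+) (Q x))))"
        by (simp add: lborel_distr_plus)
      also have "\<dots> = (\<integral>\<^sup>+y. ?I (x, Q x + y) \<partial>lborel)"
        using Isec by (subst nn_integral_distr) auto
      finally show "(\<integral>\<^sup>+y. ?I (x, y + Q x) \<partial>lborel) = (\<integral>\<^sup>+y. ?I (x, y) \<partial>lborel)"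
        by (simp add: add.commute)
    qed
    also have "\<dots> = (\<integral>\<^sup>+p. ?I p \<partial>lborel)" by (rule nn_integral_lborel_pair[OF I, symmetric])
    also have "\<dots> = emeasure lborel A" using A by simp
    finally show "emeasure (distr lborel lborel ?T) A = emeasure lborel A" .
  qed simp
qed

lemma isCont_shear:
  fixes P :: "'a::real_normed_vector \<Rightarrow> 'b::real_normed_vector"
  assumes "isCont P 0"
  shows "isCont (\<lambda>p. (fst p, snd p + P (fst p))) (0, 0)"
proof -
  have "isCont (\<lambda>p :: 'a \<times> 'b. P (fst p)) (0, 0)"
  proof (rule isCont_o2[where f=fst and g=P])
    show "isCont fst (0 :: 'a, 0 :: 'b)" by (intro continuous_intros)
  qed (use assms in simp)
  then show ?thesis by (intro continuous_intros)
qed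

text \<open>
  The inverse of a shear is the shear by - Q, so one direction implies the other.
\<close>
lemma neg_integrable_shear_iff:
  fixes f :: "'a::{real_normed_field,euclidean_space} \<times> 'a \<Rightarrow> 'a"
  assumes Q: "Q \<in> borel_measurable borel" "isCont Q 0" "Q 0 = 0"
    and f: "continuous_on (ball 0 \<rho>) f" "0 < \<rho>"
    and g: "continuous_on (ball 0 \<rho>') (\<lambda>(x, y). f (x, y + Q x))" "0 < \<rho>'"
  shows "neg_integrable (\<lambda>(x, y). f (x, y + Q x)) c \<longleftrightarrow> neg_integrable f c"
proof
  have cont: "isCont (\<lambda>(x, y). (x, y + P x)) (0 :: 'a \<times> 'a)" if "isCont P 0" for P :: "'a \<Rightarrow> 'a"
    using isCont_shear[OF that] by (simp add: case_prod_unfold zero_prod_def)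
  {
    assume "neg_integrable f c"
    then have "neg_integrable (f \<circ> (\<lambda>(x, y). (x, y + Q x))) c"
      using Q by (intro neg_integrable_comp[OF distr_lborel_shear cont _ f]) (auto simp: zero_prod_def)
    then show "neg_integrable (\<lambda>(x, y). f (x, y + Q x)) c" by (simp add: o_def case_prod_unfold)
  next
    assume "neg_integrable (\<lambda>(x, y). f (x, y + Q x)) c"
    then have "neg_integrable ((\<lambda>(x, y). f (x, y + Q x)) \<circ> (\<lambda>(x, y). (x, y + (- Q x)))) c"
      using Q by (intro neg_integrable_comp[OF distr_lborel_shear cont _ g]) (auto simp: zero_prod_def)
    then show "neg_integrable f c" by (simp add: o_def case_prod_unfold)
  }
qed

lemma neg_integrable_swap:
  fixes f :: "'a::{real_normed_field,euclidean_space} \<times> 'a \<Rightarrow> 'a"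
  assumes f: "continuous_on (ball 0 \<rho>) f" "0 < \<rho>" "neg_integrable f c"
  shows "neg_integrable (\<lambda>(x, y). f (y, x)) c"
proof -
  have "isCont (\<lambda>(x, y). (y, x)) (0 :: 'a \<times> 'a)"
    unfolding case_prod_unfold by (intro continuous_intros)
  moreover have "(\<lambda>(x, y). (y, x)) \<in> measurable borel (borel :: ('a \<times> 'a) measure)"
    by (intro borel_measurable_continuous_onI) (auto simp: case_prod_unfold intro!: continuous_intros)
  ultimately have "neg_integrable (f \<circ> (\<lambda>(x, y). (y, x))) c"
    by (intro neg_integrable_comp[OF _ distr_lborel_swap _ _ f]) (auto simp: zero_prod_def)
  then show ?thesis by (simp add: o_def case_prod_unfold)
qed

lemma neg_integrable_cong:
  assumes "\<forall>\<^sub>F z in nhds 0. f z = g z" "neg_integrable f c"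
  shows "neg_integrable g c"
proof -
  obtain e where e: "e > 0" "\<And>z. dist z 0 < e \<Longrightarrow> f z = g z"
    using assms(1) unfolding eventually_nhds_metric by blast
  obtain d where d: "d > 0" "(\<integral>\<^sup>+z\<in>ball 0 d. inverse (ennreal (norm (f z) powr c)) \<partial>lborel) < \<infinity>"
    using assms(2) unfolding neg_integrable_def by blast
  have "(\<integral>\<^sup>+z\<in>ball 0 (min d e). inverse (ennreal (norm (g z) powr c)) \<partial>lborel)
      \<le> (\<integral>\<^sup>+z\<in>ball 0 d. inverse (ennreal (norm (f z) powr c)) \<partial>lborel)"
    using e by (intro nn_integral_mono) (auto simp: indicator_def)
  also note d(2)
  finally show ?thesis unfolding neg_integrable_def using d(1) e(1) by (intro exI[of _ "min d e"]) auto
qed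

text \<open>
  The admissible exponents need not be known at C itself, since the supremum is insensitive to it.
\<close>
lemma critical_index_eqI:
  fixes f :: "'a::euclidean_space \<Rightarrow> 'b::real_normed_vector"
  assumes "0 < C" "\<And>c. 0 < c \<Longrightarrow> c < C \<Longrightarrow> neg_integrable f c" "\<And>c. C < c \<Longrightarrow> \<not> neg_integrable f c"
  shows "critical_integrability_index f = ereal C"
proof -
  have "critical_integrability_index f = (SUP c\<in>{c. 0 < c \<and> neg_integrable f c}. ereal c)"
    unfolding critical_integrability_index_def neg_integrable_def ..
  also have "\<dots> = ereal C"
  proof (rule antisym)
    show "(SUP c\<in>{c. 0 < c \<and> neg_integrable f c}. ereal c) \<le> ereal C"
    proof (rule SUP_least)
      fix c assume "c \<in> {c. 0 < c \<and> neg_integrable f c}"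
      then show "ereal c \<le> ereal C" using assms(3)[of c] by force
    qed
    show "ereal C \<le> (SUP c\<in>{c. 0 < c \<and> neg_integrable f c}. ereal c)"
    proof (rule dense_le)
      fix x assume x: "x < ereal C"
      define c where "c = (C + max 0 (real_of_ereal x)) / 2"
      have "max 0 (real_of_ereal x) < C" using x assms(1) by (cases x) auto
      then have "0 < c" "c < C" "real_of_ereal x \<le> c" using assms(1) by (auto simp: c_def)
      then have "x \<le> ereal c" using x by (cases x) auto
      also have "ereal c \<le> (SUP c\<in>{c. 0 < c \<and> neg_integrable f c}. ereal c)"
        using assms(2) \<open>0 < c\<close> \<open>c < C\<close> by (intro SUP_upper) auto
      finally show "x \<le> (SUP c\<in>{c. 0 < c \<and> neg_integrable f c}. ereal c)" .
    qed
  qed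
  finally show ?thesis .
qed

section \<open>Orders of polynomials with few terms\<close>

text \<open>
  A polynomial with T terms has order less than T at every nonzero point. With v e = c e * z^(\<phi>
  e), the assumption says that the v e are orthogonal to the first T binomial coefficients of the
  exponents. These span the polynomials of degree less than T in \<phi> e, among them one vanishing
  at all exponents but a single one.
\<close>
lemma sparse_taylor_vanish:
  fixes c :: "'e \<Rightarrow> 'a::field_char_0"
  assumes fin: "finite E" and inj: "inj_on \<phi> E" and z: "z \<noteq> 0"
    and van: "\<And>s. s < card E \<Longrightarrow> (\<Sum>e\<in>E. c e * of_nat (\<phi> e choose s) * z ^ (\<phi> e - s)) = 0"
    and e0: "e0 \<in> E"
  shows "c e0 = 0"
proof -
  define v where "v e = c e * z ^ \<phi> e" for e
  have v: "(\<Sum>e\<in>E. v e * of_nat (\<phi> e choose s)) = 0" if "s < card E" for s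
  proof -
    have "(\<Sum>e\<in>E. v e * of_nat (\<phi> e choose s)) = z ^ s * (\<Sum>e\<in>E. c e * of_nat (\<phi> e choose s) * z ^ (\<phi> e - s))"
      unfolding sum_distrib_left v_def
    proof (rule sum.cong[OF refl])
      fix e
      show "c e * z ^ \<phi> e * of_nat (\<phi> e choose s) = z ^ s * (c e * of_nat (\<phi> e choose s) * z ^ (\<phi> e - s))"
        by (cases "s \<le> \<phi> e") (auto simp: binomial_eq_0 power_add[symmetric] mult_ac)
    qed
    then show ?thesis using van[OF that] by simp
  qed
  (* Multiplication by a linear factor in the exponent raises the lower binomial index by at most
  one. *)
  have absorb: "of_nat (n choose s) * (of_nat n - of_nat t) =
      of_nat (Suc s) * of_nat (n choose Suc s) + (of_nat s - of_nat t) * (of_nat (n choose s) :: 'a)" for n s t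
  proof -
    have "(n choose s) * n = Suc s * (n choose Suc s) + s * (n choose s)"
    proof (cases "s \<le> n")
      case True
      have "Suc s * (n choose Suc s) = (n - s) * (n choose s)" by (metis binomial_absorb_comp binomial_absorption)
      then have "Suc s * (n choose Suc s) + s * (n choose s) = ((n - s) + s) * (n choose s)"
        by (simp only: add_mult_distrib)
      then show ?thesis using True by (simp add: mult.commute)
    qed (auto simp: binomial_eq_0)
    then have "of_nat (n choose s) * of_nat n = of_nat (Suc s) * of_nat (n choose Suc s) + of_nat s * (of_nat (n choose s) :: 'a)"
      by (metis of_nat_add of_nat_mult)
    then show ?thesis by (simp add: algebra_simps)
  qed
  have "finite I \<Longrightarrow> s + card I < card E \<Longrightarrow>
      (\<Sum>e\<in>E. v e * of_nat (\<phi> e choose s) * (\<Prod>t\<in>I. of_nat (\<phi> e) - of_nat (\<phi> t))) = 0" for I s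
  proof (induction I arbitrary: s rule: finite_induct)
    case empty
    then show ?case using v by simp
  next
    case (insert t I)
    have "(\<Sum>e\<in>E. v e * of_nat (\<phi> e choose s) * (\<Prod>t\<in>insert t I. of_nat (\<phi> e) - of_nat (\<phi> t)))
       = (\<Sum>e\<in>E. of_nat (Suc s) * (v e * of_nat (\<phi> e choose Suc s) * (\<Prod>t\<in>I. of_nat (\<phi> e) - of_nat (\<phi> t)))
          + (of_nat s - of_nat (\<phi> t)) * (v e * of_nat (\<phi> e choose s) * (\<Prod>t\<in>I. of_nat (\<phi> e) - of_nat (\<phi> t))))"
    proof (rule sum.cong[OF refl])
      fix e
      have "v e * of_nat (\<phi> e choose s) * (\<Prod>t\<in>insert t I. of_nat (\<phi> e) - of_nat (\<phi> t))
        = v e * (of_nat (\<phi> e choose s) * (of_nat (\<phi> e) - of_nat (\<phi> t))) * (\<Prod>t\<in>I. of_nat (\<phi> e) - of_nat (\<phi> t))"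
        using insert.hyps by (simp add: mult_ac)
      also note absorb
      finally show "v e * of_nat (\<phi> e choose s) * (\<Prod>t\<in>insert t I. of_nat (\<phi> e) - of_nat (\<phi> t))
        = of_nat (Suc s) * (v e * of_nat (\<phi> e choose Suc s) * (\<Prod>t\<in>I. of_nat (\<phi> e) - of_nat (\<phi> t)))
          + (of_nat s - of_nat (\<phi> t)) * (v e * of_nat (\<phi> e choose s) * (\<Prod>t\<in>I. of_nat (\<phi> e) - of_nat (\<phi> t)))"
        by (simp add: distrib_left distrib_right mult_ac)
    qed
    also have "\<dots> = 0"
      unfolding sum.distrib sum_distrib_left[symmetric]
      using insert.IH[of s] insert.IH[of "Suc s"] insert.prems insert.hyps by simp
    finally show ?case .
  qed
  (* The product over all exponents other than that of e0 isolates the summand of e0. *)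
  from this[of "E - {e0}" 0]
  have "(\<Sum>e\<in>E. v e * (\<Prod>t\<in>E - {e0}. of_nat (\<phi> e) - of_nat (\<phi> t))) = 0"
    using fin e0 by (simp add: card_gt_0_iff) (metis One_nat_def card_gt_0_iff diff_less empty_iff zero_less_one)
  also have "(\<Sum>e\<in>E. v e * (\<Prod>t\<in>E - {e0}. of_nat (\<phi> e) - of_nat (\<phi> t)))
     = v e0 * (\<Prod>t\<in>E - {e0}. of_nat (\<phi> e0) - of_nat (\<phi> t))"
  proof -
    have "v e * (\<Prod>t\<in>E - {e0}. of_nat (\<phi> e) - of_nat (\<phi> t)) = 0" if "e \<in> E - {e0}" for e
      using that fin by (auto simp: prod_zero_iff)
    then have "(\<Sum>e\<in>E - {e0}. v e * (\<Prod>t\<in>E - {e0}. of_nat (\<phi> e) - of_nat (\<phi> t))) = 0"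
      by (intro sum.neutral) blast
    then show ?thesis using fin e0 by (subst sum.remove[of _ e0]) auto
  qed
  finally have "v e0 = 0"
    using fin e0 inj by (auto simp: prod_zero_iff inj_on_def)
  then show ?thesis using z by (simp add: v_def)
qed

lemma edge_inj_snd: "inj_on snd (edge a k N)"
  by (auto simp: inj_on_def edge_def)

lemma edge_taylor_vanish_imp_empty:
  fixes a :: "nat \<times> nat \<Rightarrow> 'a::field_char_0"
  assumes "0 < k" "\<sigma> \<noteq> 0" "z \<noteq> 0" "\<And>s. s < card (edge a k N) \<Longrightarrow> edge_taylor a k N \<sigma> z s = 0"
  shows "edge a k N = {}"
proof (rule ccontr)
  assume "edge a k N \<noteq> {}"
  then obtain e0 where e0: "e0 \<in> edge a k N" by blast
  have "a e0 * \<sigma> ^ fst e0 = 0"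
    by (rule sparse_taylor_vanish[OF finite_edge[OF assms(1)] edge_inj_snd assms(3) _ e0])
      (use assms(4) in \<open>simp add: edge_taylor_def case_prod_unfold\<close>)
  then show False using e0 assms(2) by (auto simp: edge_def)
qed

lemma card_no_consecutive:
  fixes J :: "nat set"
  assumes "J \<subseteq> {..M}" "\<And>j. j \<in> J \<Longrightarrow> Suc j \<notin> J"
  shows "2 * card J \<le> M + 2"
proof -
  have fin: "finite J" using assms(1) finite_subset by blast
  have "2 * card J = card J + card (Suc ` J)" by (simp add: card_image)
  also have "\<dots> = card (J \<union> Suc ` J)" using fin assms(2) by (subst card_Un_disjoint) auto
  also have "\<dots> \<le> card {..Suc M}" using assms(1) by (intro card_mono) auto
  finally show ?thesis by simp
qed

text \<open>
  If (i, j) and (i', j + 1) lie on the same edge then k = i - i' is an integer. So for other k at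
  most every second power of y occurs, and the edge polynomial is sparse enough.
\<close>
lemma card_edge_le:
  assumes k: "1 \<le> k" "\<not> (\<exists>K::nat. k = real K)" and ne: "edge a k N \<noteq> {}"
  shows "real (card (edge a k N)) - 1 \<le> N / (1 + k)"
proof -
  let ?J = "snd ` edge a k N"
  have fin: "finite (edge a k N)" by (rule finite_edge) (use k in simp)
  define M where "M = Max ?J"
  have "M \<in> ?J" unfolding M_def using fin ne by (intro Max_in) auto
  then have kM: "k * real M \<le> N" by (auto simp: edge_def)
  have "2 * card ?J \<le> M + 2"
  proof (rule card_no_consecutive)
    show "?J \<subseteq> {..M}" unfolding M_def using fin by (auto intro!: Max_ge rev_image_eqI)
    fix j assume "j \<in> ?J"
    then obtain i where i: "real i + k * real j = N" by (auto simp: edge_def)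
    show "Suc j \<notin> ?J"
    proof
      assume "Suc j \<in> ?J"
      then obtain i' where i': "real i' + k * real (Suc j) = N" by (auto simp: edge_def)
      have "real i - real i' = k" using i i' by (simp add: algebra_simps)
      then have "k = real (i - i')" using k by (simp add: of_nat_diff)
      then show False using k by blast
    qed
  qed
  then have "2 * (real (card (edge a k N)) - 1) \<le> real M" using edge_inj_snd[of a k N] by (simp add: card_image)
  then have "(1 + k) * (2 * (real (card (edge a k N)) - 1)) \<le> (1 + k) * real M"
    using k by (intro mult_left_mono) auto
  moreover have "1 * real M \<le> k * real M" using k by (intro mult_right_mono) auto
  ultimately have "2 * ((1 + k) * (real (card (edge a k N)) - 1)) \<le> 2 * N"
    using kM by (simp add: algebra_simps)
  then have "(1 + k) * (real (card (edge a k N)) - 1) \<le> N" by linarith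
  then show ?thesis using k by (simp add: field_simps)
qed

section \<open>Shears and adapted coordinates\<close>

definition convergent_coeffs :: "(nat \<times> nat \<Rightarrow> 'a::{real_normed_field,banach}) \<Rightarrow> bool"
  where "convergent_coeffs a \<longleftrightarrow> (\<exists>\<rho>>0. abs_conv a \<rho> \<rho>)"

text \<open>
  The family b consists of the coefficients of the germ a in the coordinates (x, y - Q(x)). The
  function Q is constrained only near the origin.
\<close>
definition shear_of :: "('a \<Rightarrow> 'a) \<Rightarrow> (nat \<times> nat \<Rightarrow> 'a::{real_normed_field,banach}) \<Rightarrow> (nat \<times> nat \<Rightarrow> 'a) \<Rightarrow> bool"
  where "shear_of Q a b \<longleftrightarrow> (\<exists>F. Q has_fps_expansion F) \<and> Q 0 = 0 \<and> convergent_coeffs a \<and> convergent_coeffs b \<and>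
    (\<forall>\<^sub>F p in nhds (0, 0). double_series a (fst p) (snd p + Q (fst p)) = double_series b (fst p) (snd p))"

lemma shear_of_refl: "convergent_coeffs a \<Longrightarrow> shear_of (\<lambda>_. 0) a a"
  by (auto simp: shear_of_def)

lemma fps_expansion_isCont:
  fixes Q :: "'a::{banach,real_normed_field} \<Rightarrow> 'a"
  assumes "Q has_fps_expansion F" shows "isCont Q 0"
  using has_fps_expansion_imp_continuous[OF assms] by (simp add: continuous_at_imp_continuous_within)

lemma tendsto_shear:
  fixes P :: "'a::real_normed_vector \<Rightarrow> 'a"
  assumes "isCont P 0" "P 0 = 0"
  shows "filterlim (\<lambda>p. (fst p, snd p + P (fst p))) (nhds (0, 0)) (nhds (0, 0))"
  using isCont_shear[OF assms(1)] assms(2)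
    tendsto_at_iff_tendsto_nhds[of "\<lambda>p. (fst p, snd p + P (fst p))" "(0, 0)"]
  by (simp add: isCont_def)

lemma shear_of_trans:
  assumes "shear_of Q a b" "shear_of P b c"
  shows "shear_of (\<lambda>x. Q x + P x) a c"
proof -
  obtain F G where FG: "Q has_fps_expansion F" "P has_fps_expansion G" using assms by (auto simp: shear_of_def)
  have P0: "P 0 = 0" using assms by (auto simp: shear_of_def)
  have "\<forall>\<^sub>F p in nhds (0, 0). double_series a (fst p) (snd p + Q (fst p)) = double_series b (fst p) (snd p)"
    using assms(1) by (simp add: shear_of_def)
  from eventually_compose_filterlim[OF this tendsto_shear[OF fps_expansion_isCont[OF FG(2)] P0]]
  have "\<forall>\<^sub>F p in nhds (0, 0). double_series a (fst p) (snd p + P (fst p) + Q (fst p)) = double_series b (fst p) (snd p + P (fst p))"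
    by simp
  moreover have "\<forall>\<^sub>F p in nhds (0, 0). double_series b (fst p) (snd p + P (fst p)) = double_series c (fst p) (snd p)"
    using assms(2) by (simp add: shear_of_def)
  ultimately have "\<forall>\<^sub>F p in nhds (0, 0). double_series a (fst p) (snd p + (Q (fst p) + P (fst p))) = double_series c (fst p) (snd p)"
    by eventually_elim (simp add: add_ac)
  then show ?thesis using assms has_fps_expansion_add[OF FG] by (auto simp: shear_of_def)
qed

text \<open>
  The critical integrability index is at least DIM('a) / diagonal_exit a; the opposite inequality
  holds in all coordinates.
\<close>
definition adapted :: "(nat \<times> nat \<Rightarrow> 'a::{real_normed_field,euclidean_space}) \<Rightarrow> bool"
  where "adapted a \<longleftrightarrow> (\<forall>c>0. c * diagonal_exit a < real DIM('a) \<longrightarrow>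
    neg_integrable (\<lambda>(x, y). double_series a x y) c)"

text \<open>
  The diagonal meets the horizontal ray from (l, m), so that diagonal_exit a = m. A ray has no edge
  weight of its own, but N / (1 + k) = (l + k m) / (1 + k) tends to m for k tending to infinity, so
  a large k depending on c works.
\<close>
lemma adapted_horizontal:
  fixes a :: "nat \<times> nat \<Rightarrow> 'a::{real_normed_field,euclidean_space}"
  assumes conv: "convergent_coeffs a" and lm: "a (l, m) \<noteq> 0" "l \<le> m"
    and m: "\<And>i j. a (i, j) \<noteq> 0 \<Longrightarrow> m \<le> j" and l: "\<And>i. a (i, m) \<noteq> 0 \<Longrightarrow> l \<le> i"
  shows "adapted a"
  unfolding adapted_def
proof (intro allI impI)
  fix c :: real assume c: "0 < c" "c * diagonal_exit a < real DIM('a)"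
  let ?e = "real DIM('a)"
  obtain \<rho> where \<rho>: "0 < \<rho>" "abs_conv a \<rho> \<rho>" using conv by (auto simp: convergent_coeffs_def)
  have "real m \<le> (0 + 1) * diagonal_exit a"
    by (rule weight_le_diagonal_exit[where a=a, OF lm(1)]) (use m in auto)
  then have "c * real m \<le> c * diagonal_exit a" using c by simp
  then have cm: "c * real m < ?e" using c by linarith
  (* The first bound makes (l, m) the only point of its weight, the second one is c (l + k m) < e (1
  + k) solved for k. *)
  define k where "k = max (real l + 1) (c * real l / (?e - c * real m) + 1)"
  have k: "real l < k" "0 < k" by (auto simp: k_def)
  have cN: "c * (real l + k * real m) < ?e * (1 + k)"
  proof -
    have "c * real l / (?e - c * real m) < k" by (auto simp: k_def)
    then have "c * real l < k * (?e - c * real m)" using cm by (simp add: field_simps)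
    moreover have "0 < ?e" by simp
    ultimately show ?thesis by (simp add: algebra_simps)
  qed
  have strict: "real l + k * real m < real i + k * real j" if "m < j" for i j
  proof -
    have "k * real m + k \<le> k * real j" using that k mult_left_mono[of "real m + 1" "real j" k]
      by (simp add: algebra_simps)
    then show ?thesis using k by linarith
  qed
  have wt: "weight_ge a k (real l + k * real m)"
    unfolding weight_ge_def
  proof (intro allI impI)
    fix i j assume a: "a (i, j) \<noteq> 0"
    show "real l + k * real m \<le> real i + k * real j"
    proof (cases "j = m")
      case True then show ?thesis using l a by simp
    next
      case False then show ?thesis using strict[of j i] m[OF a] by simp
    qed
  qed
  have edge: "edge a k (real l + k * real m) = {(l, m)}"
  proof -
    have "i = l \<and> j = m" if "a (i, j) \<noteq> 0" "real i + k * real j = real l + k * real m" for i j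
    proof -
      have "j = m" using strict[of j i] m[OF that(1)] that(2) by (cases "m = j") auto
      then show ?thesis using that(2) by simp
    qed
    then show ?thesis using lm by (auto simp: edge_def)
  qed
  show "neg_integrable (\<lambda>(x, y). double_series a x y) c"
  proof (rule neg_integrable_if_weights[OF \<rho>(2,1) k(2) wt c(1) cN])
    fix \<sigma> z :: 'a assume "norm \<sigma> = 1"
    then have "edge_taylor a k (real l + k * real m) \<sigma> z m \<noteq> 0"
      using lm by (auto simp: edge_taylor_def edge)
    then show "\<exists>s. edge_taylor a k (real l + k * real m) \<sigma> z s \<noteq> 0 \<and> c * real s < ?e" using cm by blast
  next
    show "(l, m) \<in> edge a k (real l + k * real m)" by (simp add: edge)
    have "c * real l \<le> c * real m" using lm c by simp
    then show "c * real l < ?e" using cm by simp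
  qed
qed

text \<open>
  All quantities in the integrability criterion are bounded by N / (1 + k), the diagonal coordinate
  of the supporting line, which is at most diagonal_exit a.
\<close>
lemma adapted_if_small_orders:
  fixes a :: "nat \<times> nat \<Rightarrow> 'a::{real_normed_field,euclidean_space}"
  assumes conv: "convergent_coeffs a" and k: "0 < k" and wt: "weight_ge a k N"
    and tip: "(i0, j0) \<in> edge a k N" "real i0 \<le> N / (1 + k)"
    and ord: "\<And>\<sigma> z. norm \<sigma> = 1 \<Longrightarrow> \<exists>s. edge_taylor a k N \<sigma> z s \<noteq> 0 \<and> real s \<le> N / (1 + k)"
  shows "adapted a"
  unfolding adapted_def
proof (intro allI impI)
  fix c :: real assume c: "0 < c" "c * diagonal_exit a < real DIM('a)"
  obtain \<rho> where \<rho>: "0 < \<rho>" "abs_conv a \<rho> \<rho>" using conv by (auto simp: convergent_coeffs_def)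
  have "a (i0, j0) \<noteq> 0" using tip by (auto simp: edge_def)
  then have "N \<le> (1 + k) * diagonal_exit a"
    by (rule weight_le_diagonal_exit[where a=a]) (use k wt in \<open>auto simp: weight_ge_def\<close>)
  then have "N / (1 + k) \<le> diagonal_exit a" using k by (simp add: field_simps)
  then have "c * (N / (1 + k)) \<le> c * diagonal_exit a" using c by (intro mult_left_mono) auto
  then have cd: "c * (N / (1 + k)) < real DIM('a)" using c by simp
  have small: "c * real s < real DIM('a)" if "real s \<le> N / (1 + k)" for s
    using mult_left_mono[OF that, of c] c cd by simp
  show "neg_integrable (\<lambda>(x, y). double_series a x y) c"
  proof (rule neg_integrable_if_weights[OF \<rho>(2,1) k wt c(1) _ _ tip(1) small[OF tip(2)]])
    show "c * N < real DIM('a) * (1 + k)" using cd k by (simp add: field_simps)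
    show "\<exists>s. edge_taylor a k N \<sigma> z s \<noteq> 0 \<and> c * real s < real DIM('a)" if "norm \<sigma> = 1" for \<sigma> z
      using ord[OF that, of z] small by blast
  qed
qed

text \<open>
  A root of order greater than N / (1 + k) at z = 0 is excluded by the end point (i1, j1). At z
  \<noteq> 0 it is excluded by sparsity unless k is an integer. For integral k, homogeneity moves a
  root in direction \<sigma> to one in direction 1.
\<close>
lemma adapted_or_root:
  fixes a :: "nat \<times> nat \<Rightarrow> 'a::{real_normed_field,euclidean_space}"
  assumes conv: "convergent_coeffs a" and k: "1 \<le> k" and wt: "weight_ge a k N"
    and tip: "(i0, j0) \<in> edge a k N" "real i0 \<le> N / (1 + k)"
    and tip': "(i1, j1) \<in> edge a k N" "real j1 \<le> N / (1 + k)"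
  shows "adapted a \<or> (\<exists>K n :: nat. \<exists>z0. k = real K \<and> N = real n \<and> z0 \<noteq> 0 \<and>
     (\<forall>s. real s \<le> N / (1 + k) \<longrightarrow> edge_taylor a k N 1 z0 s = 0))"
proof (cases "\<forall>\<sigma> z. norm \<sigma> = 1 \<longrightarrow> (\<exists>s. edge_taylor a k N \<sigma> z s \<noteq> 0 \<and> real s \<le> N / (1 + k))")
  case True
  then have "adapted a" using adapted_if_small_orders[OF conv _ wt tip] k by simp
  then show ?thesis ..
next
  case False
  then obtain \<sigma> z where \<sigma>: "norm \<sigma> = 1" and van: "\<And>s. real s \<le> N / (1 + k) \<Longrightarrow> edge_taylor a k N \<sigma> z s = 0"
    by blast
  have k0: "0 < k" using k by simp
  have \<sigma>0: "\<sigma> \<noteq> 0" using \<sigma> by auto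
  have z0: "z \<noteq> 0"
  proof
    assume "z = 0"
    then have "a (i1, j1) * \<sigma> ^ i1 = 0" using edge_taylor_at_0[OF k0 tip'(1), of \<sigma>] van[OF tip'(2)] by simp
    then show False using \<sigma>0 tip'(1) by (auto simp: edge_def)
  qed
  have "\<exists>K::nat. k = real K"
  proof (rule ccontr)
    assume nat: "\<not> (\<exists>K::nat. k = real K)"
    have "real (card (edge a k N)) - 1 \<le> N / (1 + k)"
      using card_edge_le[OF k nat] tip by blast
    then have "edge_taylor a k N \<sigma> z s = 0" if "s < card (edge a k N)" for s
      using that by (intro van) linarith
    then have "edge a k N = {}" using edge_taylor_vanish_imp_empty[OF k0 \<sigma>0 z0] by blast
    then show False using tip by blast
  qed
  then obtain K :: nat where K: "k = real K" by blast
  define n where "n = i0 + K * j0"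
  have n: "N = real n" using tip by (auto simp: n_def edge_def K)
  have edge: "i + K * j = n" if "(i, j) \<in> edge a k N" for i j
  proof -
    have "real (i + K * j) = real n" using that by (auto simp: edge_def K n)
    then show ?thesis by (simp only: of_nat_eq_iff)
  qed
  have "edge_taylor a k N 1 (z / \<sigma> ^ K) s = 0" if s: "real s \<le> N / (1 + k)" for s
  proof -
    have "real s * 1 \<le> real s * (1 + k)" using k by (intro mult_left_mono) auto
    have Ks: "K * s \<le> n"
    proof -
      have "real s * (1 + k) \<le> N" using s k by (simp add: field_simps)
      then have "real (K * s) \<le> real n" by (simp add: K n algebra_simps)
      then show ?thesis by (simp only: of_nat_le_iff)
    qed
    have "edge_taylor a k N \<sigma> z s = \<sigma> ^ (n - K * s) * edge_taylor a k N 1 (z / \<sigma> ^ K) s"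
      unfolding edge_taylor_def sum_distrib_left
    proof (rule sum.cong[OF refl])
      fix ij assume "ij \<in> edge a k N"
      then obtain i j where ij: "ij = (i, j)" "i + K * j = n" using edge by (metis surj_pair)
      show "(case ij of (i, j) \<Rightarrow> a (i, j) * \<sigma> ^ i * of_nat (j choose s) * z ^ (j - s)) =
         \<sigma> ^ (n - K * s) * (case ij of (i, j) \<Rightarrow> a (i, j) * 1 ^ i * of_nat (j choose s) * (z / \<sigma> ^ K) ^ (j - s))"
      proof (cases "s \<le> j")
        case True
        then obtain t where t: "j = s + t" using le_Suc_ex by blast
        have "n - K * s = i + K * t" using ij(2) by (simp add: t algebra_simps)
        then show ?thesis using \<sigma>0 by (simp add: ij t power_add power_mult power_divide)
      qed (simp add: ij binomial_eq_0)
    qed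
    then show ?thesis using van[OF s] \<sigma>0 by simp
  qed
  moreover have "z / \<sigma> ^ K \<noteq> 0" using z0 \<sigma>0 by simp
  ultimately show ?thesis using K n by blast
qed

section \<open>Existence of adapted coordinates\<close>

text \<open>
  If the (m-1)-st but not the m-th Taylor coefficient of the edge polynomial vanishes at z, a shear
  has to exist after which the edge polynomial is translated by z and the power y^(m-1) does not
  occur in any term. This is the only property of the field that the construction of adapted
  coordinates needs, and \<real> and \<complex> establish it in different ways.
\<close>
definition straightenable :: "(nat \<times> nat \<Rightarrow> 'a::{real_normed_field,banach}) \<Rightarrow> bool"
  where "straightenable a \<longleftrightarrow> (\<forall>K n z m. 1 \<le> K \<longrightarrow> 1 \<le> m \<longrightarrow> weight_ge a (real K) (real n) \<longrightarrow>
    edge_taylor a (real K) (real n) 1 z (m - 1) = 0 \<longrightarrow> edge_taylor a (real K) (real n) 1 z m \<noteq> 0 \<longrightarrow>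
    (\<exists>Q b. shear_of Q a b \<and> weight_ge b (real K) (real n) \<and>
      (\<forall>i j. i + K * j = n \<longrightarrow> b (i, j) = edge_taylor a (real K) (real n) 1 z j) \<and>
      (\<forall>i. b (i, m - 1) = 0)))"

text \<open>
  (l, m) lies above the diagonal and is the lowest point on its supporting line of weights (1, k).
  The number k bounds from below the weights of all edges that follow in the direction of the
  diagonal. For k = 0 the line is vertical.
\<close>
definition vertex :: "(nat \<times> nat \<Rightarrow> 'a::zero) \<Rightarrow> nat \<Rightarrow> nat \<Rightarrow> real \<Rightarrow> bool"
  where "vertex a l m k \<longleftrightarrow> a (l, m) \<noteq> 0 \<and> l < m \<and> weight_ge a k (real l + k * real m) \<and>
    (\<forall>i j. (i, j) \<in> edge a k (real l + k * real m) \<longrightarrow> m \<le> j)"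

text \<open>
  Rotate the supporting line about (l, m) until it meets an exponent of lower height.
\<close>
lemma vertex_next_edge:
  assumes v: "vertex a l m k" and k: "0 \<le> k" and ex: "a (i', j') \<noteq> 0" "j' < m"
  obtains k' i1 j1 where "k < k'" "weight_ge a k' (real l + k' * real m)"
    "(i1, j1) \<in> edge a k' (real l + k' * real m)" "j1 < m"
    "\<forall>i j. (i, j) \<in> edge a k' (real l + k' * real m) \<longrightarrow> j \<le> m \<and> j1 \<le> j"
proof -
  have wt: "real l + k * real m \<le> real i + k * real j" if "a (i, j) \<noteq> 0" for i j
    using v that by (auto simp: vertex_def weight_ge_def)
  have below: "real l + k * (real m - real j) < real i" if "a (i, j) \<noteq> 0" "j < m" for i j
  proof -
    have "(i, j) \<notin> edge a k (real l + k * real m)" using v that by (force simp: vertex_def)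
    then have "real l + k * real m \<noteq> real i + k * real j" using that by (auto simp: edge_def)
    then show ?thesis using wt[OF that(1)] by (simp add: algebra_simps)
  qed
  have li: "l < i" if "a (i, j) \<noteq> 0" "j < m" for i j
  proof -
    have "0 \<le> k * (real m - real j)" using k that by simp
    then have "real l < real i" using below[OF that] by linarith
    then show ?thesis by simp
  qed
  (* The slopes (i - l) / (m - j) attain a minimum because m! times them are natural numbers. *)
  define g where "g = (\<lambda>(i, j). (i - l) * (fact m div (m - j)))"
  have g: "real (g (i, j)) = fact m * ((real i - real l) / (real m - real j))" if "a (i, j) \<noteq> 0" "j < m" for i j
  proof -
    have "(m - j) dvd fact m" using that by (intro dvd_fact) auto
    then have "real (fact m div (m - j)) = fact m / (real m - real j)"
      using that by (simp add: real_of_nat_div of_nat_diff)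
    then show ?thesis using li[OF that] by (simp add: g_def of_nat_diff)
  qed
  let ?P = "\<lambda>(i, j). a (i, j) \<noteq> 0 \<and> j < m"
  have "?P (i', j')" using ex by simp
  then obtain x where x: "?P x" "\<forall>y. ?P y \<longrightarrow> g x \<le> g y"
    using ex_has_least_nat[of ?P "(i', j')" g] by blast
  obtain i0 j0 where x0: "x = (i0, j0)" by force
  have P0: "a (i0, j0) \<noteq> 0" "j0 < m" using x by (auto simp: x0)
  define k' where "k' = (real i0 - real l) / (real m - real j0)"
  have kk: "k < k'"
    using below[OF P0] P0 by (simp add: k'_def field_simps)
  have slope: "k' \<le> (real i - real l) / (real m - real j)" if "a (i, j) \<noteq> 0" "j < m" for i j
  proof -
    have "real (g (i0, j0)) \<le> real (g (i, j))" using x(2) that by (auto simp: x0)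
    then have "fact m * k' \<le> fact m * ((real i - real l) / (real m - real j))"
      unfolding g[OF that] g[OF P0] k'_def .
    then show ?thesis by (rule mult_left_le_imp_le) simp
  qed
  let ?N = "real l + k' * real m"
  have wt': "weight_ge a k' ?N"
    unfolding weight_ge_def
  proof (intro allI impI)
    fix i j assume a: "a (i, j) \<noteq> 0"
    show "?N \<le> real i + k' * real j"
    proof (cases "j < m")
      case True
      then have "k' * (real m - real j) \<le> real i - real l" using slope[OF a True] by (simp add: field_simps)
      then show ?thesis by (simp add: algebra_simps)
    next
      case False
      then have "(k' - k) * real m \<le> (k' - k) * real j" using kk by (intro mult_left_mono) auto
      then show ?thesis using wt[OF a] by (simp add: algebra_simps)
    qed
  qed
  have edge_le: "j \<le> m" if "(i, j) \<in> edge a k' ?N" for i j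
  proof (rule ccontr)
    assume "\<not> j \<le> m"
    then have "(k' - k) * real m < (k' - k) * real j" using kk by (intro mult_strict_left_mono) auto
    moreover have "real l + k * real m \<le> real i + k * real j" "?N = real i + k' * real j"
      using that wt by (auto simp: edge_def)
    ultimately show False by (simp add: algebra_simps)
  qed
  have "real i0 + k' * real j0 = ?N"
  proof -
    have "k' * (real m - real j0) = real i0 - real l" using P0 by (simp add: k'_def)
    then show ?thesis by (simp add: algebra_simps)
  qed
  then have e0: "(i0, j0) \<in> edge a k' ?N" using P0 by (simp add: edge_def)
  define j1 where "j1 = (LEAST j. j \<in> snd ` edge a k' ?N)"
  have "j0 \<in> snd ` edge a k' ?N" using e0 by force
  then have j1: "j1 \<in> snd ` edge a k' ?N" "j1 \<le> j0" unfolding j1_def by (auto intro: LeastI Least_le)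
  have j1_le: "j1 \<le> j" if "(i, j) \<in> edge a k' ?N" for i j
    unfolding j1_def using that by (intro Least_le) force
  obtain i1 where "(i1, j1) \<in> edge a k' ?N" using j1 by force
  then show ?thesis using that[OF kk wt', of i1 j1] edge_le j1_le j1(2) P0 by auto
qed

text \<open>
  The polyhedron below (l, m) is empty, or the next edge ends above the diagonal, or it reaches or
  crosses the diagonal. In the last case both end points satisfy the bounds that make the criterion
  for integrability applicable.
\<close>
lemma vertex_step:
  fixes a :: "nat \<times> nat \<Rightarrow> 'a::{real_normed_field,euclidean_space}"
  assumes conv: "convergent_coeffs a" and v: "vertex a l m k" and k: "0 \<le> k"
  obtains (adapted) "adapted a"
  | (lower) l' m' k' where "m' < m" "k < k'" "vertex a l' m' k'"
  | (crossing) k' i1 j1 where "k < k'" "weight_ge a k' (real l + k' * real m)"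
      "(l, m) \<in> edge a k' (real l + k' * real m)"
      "(i1, j1) \<in> edge a k' (real l + k' * real m)" "j1 < m"
      "real l \<le> (real l + k' * real m) / (1 + k')" "real j1 \<le> (real l + k' * real m) / (1 + k')"
      "\<And>i j. (i, j) \<in> edge a k' (real l + k' * real m) \<Longrightarrow> j \<le> m"
proof (cases "\<exists>i' j'. a (i', j') \<noteq> 0 \<and> j' < m")
  case False
  have "adapted a"
  proof (rule adapted_horizontal[OF conv])
    show "a (l, m) \<noteq> 0" "l \<le> m" using v by (auto simp: vertex_def)
    show "m \<le> j" if "a (i, j) \<noteq> 0" for i j using False that not_less by blast
    show "l \<le> i" if "a (i, m) \<noteq> 0" for i
    proof -
      have "real l + k * real m \<le> real i + k * real m"
        using v that unfolding vertex_def weight_ge_def by blast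
      then show ?thesis by simp
    qed
  qed
  then show ?thesis by (rule that(1))
next
  case True
  then obtain i' j' where ex: "a (i', j') \<noteq> 0" "j' < m" by blast
  obtain k' i1 j1 where k': "k < k'" "weight_ge a k' (real l + k' * real m)"
    "(i1, j1) \<in> edge a k' (real l + k' * real m)" "j1 < m"
    and edge: "\<forall>i j. (i, j) \<in> edge a k' (real l + k' * real m) \<longrightarrow> j \<le> m \<and> j1 \<le> j"
    by (rule vertex_next_edge[OF v k ex])
  have N: "real l + k' * real m = real i1 + k' * real j1" using k'(3) by (simp add: edge_def)
  have lm: "a (l, m) \<noteq> 0" "l < m" using v by (auto simp: vertex_def)
  show ?thesis
  proof (cases "i1 < j1")
    case True
    have "vertex a i1 j1 k'"
      using True k' edge unfolding vertex_def N by (auto simp: edge_def)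
    then show ?thesis using that(2) k' by blast
  next
    case False
    then have "real j1 * (1 + k') \<le> real l + k' * real m" by (simp add: N algebra_simps)
    then have j1: "real j1 \<le> (real l + k' * real m) / (1 + k')" using k k' by (simp add: field_simps)
    have "k' * real l \<le> k' * real m" using lm k k' by (intro mult_left_mono) auto
    then have l: "real l \<le> (real l + k' * real m) / (1 + k')" using k k' by (simp add: field_simps)
    show ?thesis
      by (rule that(3)[OF k'(1,2) _ k'(3,4) l j1]) (use lm edge in \<open>auto simp: edge_def\<close>)
  qed
qed

text \<open>
  Let m be the exact order of the root. As m > n / (1 + K), the point on the edge at height m lies
  above the diagonal. It becomes the lowest point of the edge, because the translated edge
  polynomial has order m at 0.
\<close>
lemma straighten_root:
  fixes a :: "nat \<times> nat \<Rightarrow> 'a::{real_normed_field,banach}"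
  assumes st: "straightenable a" and K: "1 \<le> K" and wt: "weight_ge a (real K) (real n)"
    and van: "\<And>s. real s \<le> real n / (1 + real K) \<Longrightarrow> edge_taylor a (real K) (real n) 1 z s = 0"
    and ne: "(i0, M) \<in> edge a (real K) (real n)" and M: "\<And>i j. (i, j) \<in> edge a (real K) (real n) \<Longrightarrow> j \<le> M"
  obtains Q b l m where "shear_of Q a b" "vertex b l m (real K)" "l + K * m = n" "m \<le> M" "\<forall>i. b (i, m - 1) = 0" "1 \<le> m"
    "\<forall>s<m. edge_taylor a (real K) (real n) 1 z s = 0"
proof -
  let ?T = "edge_taylor a (real K) (real n) 1 z"
  have K0: "0 < real K" using K by simp
  have "?T M = a (i0, M)"
  proof -
    have "?T M = (\<Sum>ij\<in>{(i0, M)}. a (i0, M))"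
      unfolding edge_taylor_def
    proof (rule sum.mono_neutral_cong_right[OF finite_edge[OF K0]])
      show "\<forall>x\<in>edge a (real K) (real n) - {(i0, M)}. (case x of (i, j) \<Rightarrow> a (i, j) * 1 ^ i * of_nat (j choose M) * z ^ (j - M)) = 0"
      proof
        fix x assume x: "x \<in> edge a (real K) (real n) - {(i0, M)}"
        obtain i j where ij: "x = (i, j)" by force
        have "j \<noteq> M" using ne x by (auto simp: edge_def ij)
        then have "j < M" using M[of i j] x by (auto simp: ij)
        then show "(case x of (i, j) \<Rightarrow> a (i, j) * 1 ^ i * of_nat (j choose M) * z ^ (j - M)) = 0"
          by (simp add: ij binomial_eq_0)
      qed
    qed (use ne in auto)
    then show ?thesis by simp
  qed
  then have TM: "?T M \<noteq> 0" using ne by (auto simp: edge_def)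
  define m where "m = (LEAST s. ?T s \<noteq> 0)"
  have Tm: "?T m \<noteq> 0" unfolding m_def using TM by (rule LeastI)
  have mM: "m \<le> M" unfolding m_def using TM by (rule Least_le)
  have Tlt: "?T s = 0" if "s < m" for s using not_less_Least[of s "\<lambda>s. ?T s \<noteq> 0"] that by (auto simp: m_def)
  have big: "real n / (1 + real K) < real m" using van[of m] Tm by force
  then have m1: "1 \<le> m" using K by (cases m) (auto simp: field_simps)
  have KM: "i0 + K * M = n"
  proof -
    have "real (i0 + K * M) = real n" using ne by (simp add: edge_def)
    then show ?thesis by (simp only: of_nat_eq_iff)
  qed
  define l where "l = n - K * m"
  have "K * m \<le> n" using mult_le_mono2[OF mM, of K] KM by linarith
  then have ln: "l + K * m = n" by (simp add: l_def)
  have "real n < real m * (1 + real K)" using big K by (simp add: field_simps)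
  then have "real (l + K * m) < real (m * (1 + K))" by (simp only: ln of_nat_mult of_nat_add of_nat_1)
  then have "l + K * m < m * (1 + K)" by (simp only: of_nat_less_iff)
  then have lm: "l < m" by (simp add: algebra_simps)
  have T0: "?T (m - 1) = 0" by (rule Tlt) (use m1 in simp)
  obtain Q b where b: "shear_of Q a b" "weight_ge b (real K) (real n)"
    "\<forall>i j. i + K * j = n \<longrightarrow> b (i, j) = ?T j" "\<forall>i. b (i, m - 1) = 0"
    using st[unfolded straightenable_def, rule_format, OF K m1 wt T0 Tm] by blast
  have N: "real l + real K * real m = real n" using ln by (simp flip: of_nat_mult of_nat_add)
  have "vertex b l m (real K)"
    unfolding vertex_def N
  proof (intro conjI allI impI)
    show "b (l, m) \<noteq> 0" using b(3) ln Tm by simp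
    fix i j assume e: "(i, j) \<in> edge b (real K) (real n)"
    then have "real (i + K * j) = real n" by (simp add: edge_def)
    then have "i + K * j = n" by (simp only: of_nat_eq_iff)
    then have "?T j \<noteq> 0" using b(3) e by (auto simp: edge_def)
    then show "m \<le> j" using Tlt not_less by blast
  qed (use lm b in auto)
  then show ?thesis using that[of Q b l m] b ln mM m1 Tlt by blast
qed

text \<open>
  Let n be the least height of a vertex in any sheared coordinates with k \<ge> 1. If these
  coordinates are not adapted, the next edge crosses the diagonal and its polynomial has a root of
  too large an order. Straightening it gives a vertex of height at most n, hence n, and the power
  y^(n-1) disappears. In the new coordinates the same reasoning gives, on a further edge with upper
  end at height n, a root z \<noteq> 0 of order at least n. But the (n-1)-st Taylor coefficient at z
  of a polynomial of degree n without a term of degree n - 1 is a nonzero multiple of z.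
\<close>
lemma adapted_shear_from_vertex:
  fixes a :: "nat \<times> nat \<Rightarrow> 'a::{real_normed_field,euclidean_space}"
  assumes st: "\<And>b :: nat \<times> nat \<Rightarrow> 'a. convergent_coeffs b \<Longrightarrow> straightenable b"
    and conv: "convergent_coeffs a" and v: "vertex a l m k" and k: "1 \<le> k"
  obtains Q b where "shear_of Q a b" "adapted b"
proof -
  define P where "P n \<longleftrightarrow> (\<exists>Q b l k. shear_of Q a b \<and> 1 \<le> k \<and> vertex b l n k)" for n
  have "P m" unfolding P_def using shear_of_refl[OF conv] v k by blast
  define n where "n = (LEAST n. P n)"
  have Pn: "P n" unfolding n_def using \<open>P m\<close> by (rule LeastI)
  have least: "n \<le> n'" if "P n'" for n' unfolding n_def using that by (rule Least_le)
  (* Used twice: for coordinates of minimal height, and again after straightening once. *)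
  have step: "adapted b \<or> (\<exists>Q' b' l' z K N. shear_of Q' b b' \<and> vertex b' l' n (real K) \<and> 1 \<le> K \<and> z \<noteq> 0 \<and>
      (\<forall>i. b' (i, n - 1) = 0) \<and> 1 \<le> n \<and> edge_taylor b (real K) (real N) 1 z (n - 1) = 0 \<and>
      (\<exists>i. (i, n) \<in> edge b (real K) (real N)) \<and> (\<forall>i j. (i, j) \<in> edge b (real K) (real N) \<longrightarrow> j \<le> n))"
    if b: "shear_of Q b0 b" "shear_of Q0 a b" "vertex b l n k" "1 \<le> k" for Q Q0 b0 b l k
  proof -
    have convb: "convergent_coeffs b" using b by (simp add: shear_of_def)
    have k0: "0 \<le> k" using b by simp
    show ?thesis
    proof (rule vertex_step[OF convb b(3) k0])
      assume "adapted b" then show ?thesis ..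
    next
      fix l' m' k' assume "m' < n" "k < k'" "vertex b l' m' k'"
      then have "P m'" unfolding P_def using b(2,4) by (intro exI[of _ Q0] exI[of _ b] exI[of _ l'] exI[of _ k']) auto
      then have "n \<le> m'" by (rule least)
      then show ?thesis using \<open>m' < n\<close> by simp
    next
      fix k' i1 j1
      let ?N = "real l + k' * real n"
      assume *: "k < k'" "weight_ge b k' ?N" "(l, n) \<in> edge b k' ?N" "(i1, j1) \<in> edge b k' ?N" "j1 < n"
        "real l \<le> ?N / (1 + k')" "real j1 \<le> ?N / (1 + k')"
        and edge: "\<And>i j. (i, j) \<in> edge b k' ?N \<Longrightarrow> j \<le> n"
      have k1: "1 \<le> k'" using b * by simp
      from adapted_or_root[OF convb k1 *(2,3,6,4,7)] show ?thesis
      proof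
        assume "\<exists>K nn :: nat. \<exists>z0. k' = real K \<and> ?N = real nn \<and> z0 \<noteq> 0 \<and>
          (\<forall>s. real s \<le> ?N / (1 + k') \<longrightarrow> edge_taylor b k' ?N 1 z0 s = 0)"
        then obtain K nn z where K: "k' = real K" "?N = real nn" "z \<noteq> 0"
          and van: "\<And>s. real s \<le> real nn / (1 + real K) \<Longrightarrow> edge_taylor b (real K) (real nn) 1 z s = 0"
          by auto
        have K1: "1 \<le> K" using k1 K by simp
        have wt': "weight_ge b (real K) (real nn)" and e': "(l, n) \<in> edge b (real K) (real nn)"
          and edge': "\<And>i j. (i, j) \<in> edge b (real K) (real nn) \<Longrightarrow> j \<le> n"
          using * edge unfolding K(2) by (auto simp: K(1))
        obtain Q' b' l' m' where b': "shear_of Q' b b'" "vertex b' l' m' (real K)" "m' \<le> n"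
          "\<forall>i. b' (i, m' - 1) = 0" "1 \<le> m'" "\<forall>s<m'. edge_taylor b (real K) (real nn) 1 z s = 0"
          by (rule straighten_root[OF st[OF convb] K1 wt' van e' edge'])
        have "shear_of (\<lambda>x. Q0 x + Q' x) a b'" by (rule shear_of_trans[OF b(2) b'(1)])
        then have "P m'" unfolding P_def using b'(2) k1 K(1) by blast
        then have [simp]: "m' = n" using least b'(3) by (simp add: antisym)
        have "edge_taylor b (real K) (real nn) 1 z (n - 1) = 0"
          using b'(5,6) by simp
        then show ?thesis
          using b' K1 K(3) e' edge' by - (rule disjI2, rule exI[of _ Q'], rule exI[of _ b'], rule exI[of _ l'], rule exI[of _ z],
                rule exI[of _ K], rule exI[of _ nn], auto)
      qed simp
    qed
  qed
  obtain Q b l k where b: "shear_of Q a b" "1 \<le> k" "vertex b l n k" using Pn unfolding P_def by blast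
  show ?thesis
  proof (cases "adapted b")
    case True then show ?thesis using that b by blast
  next
    case False
    obtain Q' b' l' K where b': "shear_of Q' b b'" "vertex b' l' n (real K)" "1 \<le> K" "\<forall>i. b' (i, n - 1) = 0"
      using step[OF b(1,1,3,2)] False by blast
    have ab': "shear_of (\<lambda>x. Q x + Q' x) a b'" by (rule shear_of_trans[OF b(1) b'(1)])
    have K1: "1 \<le> real K" using b' by simp
    show ?thesis
    proof (cases "adapted b'")
      case True then show ?thesis using that ab' by blast
    next
      case False
      obtain z K' N i where z: "z \<noteq> 0" "1 \<le> n" "edge_taylor b' (real K') (real N) 1 z (n - 1) = 0" "1 \<le> K'"
        "(i, n) \<in> edge b' (real K') (real N)" "\<And>i j. (i, j) \<in> edge b' (real K') (real N) \<Longrightarrow> j \<le> n"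
        using step[OF b'(1) ab' b'(2) K1] False by blast
      have K'0: "0 < real K'" using z by simp
      have "edge_taylor b' (real K') (real N) 1 z (n - 1) = (\<Sum>ij\<in>{(i, n)}. b' (i, n) * of_nat n * z)"
        unfolding edge_taylor_def
      proof (rule sum.mono_neutral_cong_right[OF finite_edge[OF K'0]])
        show "\<forall>x\<in>edge b' (real K') (real N) - {(i, n)}. (case x of (i, j) \<Rightarrow> b' (i, j) * 1 ^ i * of_nat (j choose (n - 1)) * z ^ (j - (n - 1))) = 0"
        proof
          fix x assume x: "x \<in> edge b' (real K') (real N) - {(i, n)}"
          obtain i' j where ij: "x = (i', j)" by force
          have "j \<noteq> n" using z(5) x by (auto simp: edge_def ij)
          then have "j < n" using z(6)[of i' j] x by (auto simp: ij)
          moreover have "j \<noteq> n - 1" using b'(4) x by (auto simp: ij edge_def)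
          ultimately have "j < n - 1" by simp
          then show "(case x of (i, j) \<Rightarrow> b' (i, j) * 1 ^ i * of_nat (j choose (n - 1)) * z ^ (j - (n - 1))) = 0"
            by (simp add: ij binomial_eq_0)
        qed
        show "(case x of (i, j) \<Rightarrow> b' (i, j) * 1 ^ i * of_nat (j choose (n - 1)) * z ^ (j - (n - 1))) = b' (i, n) * of_nat n * z"
          if "x \<in> {(i, n)}" for x
          using that z(2) binomial_symmetric[of "n - 1" n] by simp
      qed (use z in auto)
      then have False using z by (auto simp: edge_def)
      then show ?thesis ..
    qed
  qed
qed

lemma convergent_coeffs_swap: "convergent_coeffs a \<Longrightarrow> convergent_coeffs (swap_coeffs a)"
  unfolding convergent_coeffs_def using abs_conv_swap by blast

lemma edge_swap_iff: "0 < k \<Longrightarrow> (j, i) \<in> edge (swap_coeffs a) (1 / k) (N / k) \<longleftrightarrow> (i, j) \<in> edge a k N"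
  by (auto simp: edge_def field_simps)

text \<open>
  The start is the lowest point (l, m) of the leftmost column of exponents; if it is not above the
  diagonal, the exchanged coordinates are adapted. A shear in y can only treat edges with k \<ge> 1;
  if the edge that meets the diagonal has k < 1, exchanging the coordinates turns k into 1 / k.
  After one straightening a vertex with k \<ge> 1 is available, and the values of k only increase
  from edge to edge.
\<close>
theorem adapted_shear_exists:
  fixes a :: "nat \<times> nat \<Rightarrow> 'a::{real_normed_field,euclidean_space}"
  assumes st: "\<And>b :: nat \<times> nat \<Rightarrow> 'a. convergent_coeffs b \<Longrightarrow> straightenable b"
    and conv: "convergent_coeffs a" and nz: "a ij \<noteq> 0"
  shows "\<exists>Q b. (shear_of Q a b \<or> shear_of Q (swap_coeffs a) b) \<and> adapted b"
proof -
  note convs = convergent_coeffs_swap[OF conv]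
  have root: "\<exists>Q b'. shear_of Q b b' \<and> adapted b'"
    if convb: "convergent_coeffs b" and K: "1 \<le> K" and wt: "weight_ge b (real K) (real n)"
      and van: "\<And>s. real s \<le> real n / (1 + real K) \<Longrightarrow> edge_taylor b (real K) (real n) 1 z s = 0"
      and ne: "e \<in> edge b (real K) (real n)" for b :: "nat \<times> nat \<Rightarrow> 'a" and K n z e
  proof -
    let ?E = "edge b (real K) (real n)"
    have fin: "finite ?E" by (rule finite_edge) (use K in simp)
    define M where "M = Max (snd ` ?E)"
    have "M \<in> snd ` ?E" unfolding M_def using fin ne by (intro Max_in) auto
    then obtain i0 where i0: "(i0, M) \<in> ?E" by force
    have M: "j \<le> M" if "(i, j) \<in> ?E" for i j
      unfolding M_def using fin that by (intro Max_ge) force+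
    obtain Q b' l m where b': "shear_of Q b b'" "vertex b' l m (real K)"
      by (rule straighten_root[OF st[OF convb] K wt van i0 M])
    have "convergent_coeffs b'" "1 \<le> real K" using b' K by (auto simp: shear_of_def)
    then obtain Q' b'' where "shear_of Q' b' b''" "adapted b''"
      using adapted_shear_from_vertex[OF st _ b'(2)] by blast
    then show ?thesis using shear_of_trans[OF b'(1)] by blast
  qed
  define l where "l = (LEAST i. \<exists>j. a (i, j) \<noteq> 0)"
  have "\<exists>i j. a (i, j) \<noteq> 0" using nz by (cases ij) auto
  then have l: "\<exists>j. a (l, j) \<noteq> 0" unfolding l_def by (rule LeastI_ex)
  have l_le: "l \<le> i" if "a (i, j) \<noteq> 0" for i j unfolding l_def using that by (intro Least_le) blast
  define m where "m = (LEAST j. a (l, j) \<noteq> 0)"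
  have m: "a (l, m) \<noteq> 0" unfolding m_def using l by (rule LeastI_ex)
  have m_le: "m \<le> j" if "a (l, j) \<noteq> 0" for j unfolding m_def using that by (rule Least_le)
  show ?thesis
  proof (cases "m \<le> l")
    case True
    have "adapted (swap_coeffs a)"
      by (rule adapted_horizontal[OF convs, of m l]) (use m True l_le m_le in auto)
    then show ?thesis using shear_of_refl[OF convs] by blast
  next
    case False
    have "vertex a l m 0"
      using False m l_le m_le unfolding vertex_def weight_ge_def edge_def by auto
    define P where "P n \<longleftrightarrow> (\<exists>l k. 0 \<le> k \<and> vertex a l n k)" for n
    have "P m" unfolding P_def using \<open>vertex a l m 0\<close> by blast
    define n where "n = (LEAST n. P n)"
    have "P n" unfolding n_def using \<open>P m\<close> by (rule LeastI)
    have least: "n \<le> n'" if "P n'" for n' unfolding n_def using that by (rule Least_le)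
    obtain l k where v: "0 \<le> k" "vertex a l n k" using \<open>P n\<close> unfolding P_def by blast
    show ?thesis
    proof (rule vertex_step[OF conv v(2,1)])
      assume "adapted a" then show ?thesis using shear_of_refl[OF conv] by blast
    next
      fix l' m' k' assume "m' < n" "k < k'" "vertex a l' m' k'"
      then have "P m'" unfolding P_def using v by (intro exI[of _ l'] exI[of _ k']) auto
      then show ?thesis using least[of m'] \<open>m' < n\<close> by simp
    next
      fix k' i1 j1
      let ?N = "real l + k' * real n"
      assume *: "k < k'" "weight_ge a k' ?N" "(l, n) \<in> edge a k' ?N" "(i1, j1) \<in> edge a k' ?N" "j1 < n"
        "real l \<le> ?N / (1 + k')" "real j1 \<le> ?N / (1 + k')"
      have k0: "0 < k'" using v * by simp
      show ?thesis
      proof (cases "1 \<le> k'")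
        case True
        from adapted_or_root[OF conv True *(2,3,6,4,7)] show ?thesis
        proof
          assume "adapted a" then show ?thesis using shear_of_refl[OF conv] by blast
        next
          assume "\<exists>K nn :: nat. \<exists>z0. k' = real K \<and> ?N = real nn \<and> z0 \<noteq> 0 \<and>
            (\<forall>s. real s \<le> ?N / (1 + k') \<longrightarrow> edge_taylor a k' ?N 1 z0 s = 0)"
          then obtain K nn z where K: "k' = real K" "?N = real nn" "z \<noteq> 0"
            and van: "\<And>s. real s \<le> real nn / (1 + real K) \<Longrightarrow> edge_taylor a (real K) (real nn) 1 z s = 0"
            by auto
          have "1 \<le> K" using True K by simp
          moreover have "weight_ge a (real K) (real nn)" "(l, n) \<in> edge a (real K) (real nn)"
            using * unfolding K(2) by (auto simp: K(1))
          ultimately show ?thesis using root[OF conv _ _ van] by blast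
        qed
      next
        case False
        let ?b = "swap_coeffs a"
        have k1: "1 \<le> 1 / k'" using False k0 by simp
        have d: "?N / k' / (1 + 1 / k') = ?N / (1 + k')"
          using k0 by (simp only: divide_divide_eq_left distrib_left) (simp add: add.commute)
        have wts: "weight_ge ?b (1 / k') (?N / k')"
          unfolding weight_ge_def
        proof (intro allI impI)
          fix i j assume "?b (i, j) \<noteq> 0"
          then have "?N \<le> real j + k' * real i" using *(2) by (simp add: weight_ge_def)
          then have "?N / k' \<le> (real j + k' * real i) / k'" using k0 by (intro divide_right_mono) auto
          then show "?N / k' \<le> real i + 1 / k' * real j" using k0 by (simp add: add_divide_distrib)
        qed
        have e: "(n, l) \<in> edge ?b (1 / k') (?N / k')" "(j1, i1) \<in> edge ?b (1 / k') (?N / k')"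
          using *(3,4) k0 by (simp_all only: edge_swap_iff)
        have "real j1 \<le> ?N / k' / (1 + 1 / k')" "real l \<le> ?N / k' / (1 + 1 / k')"
          using * by (simp_all only: d)
        from adapted_or_root[OF convs k1 wts e(2) this(1) e(1) this(2)] show ?thesis
        proof
          assume "adapted ?b" then show ?thesis using shear_of_refl[OF convs] by blast
        next
          assume "\<exists>K nn :: nat. \<exists>z0. 1 / k' = real K \<and> ?N / k' = real nn \<and> z0 \<noteq> 0 \<and>
            (\<forall>s. real s \<le> ?N / k' / (1 + 1 / k') \<longrightarrow> edge_taylor ?b (1 / k') (?N / k') 1 z0 s = 0)"
          then obtain K nn z where K: "1 / k' = real K" "?N / k' = real nn"
            and van: "\<And>s. real s \<le> ?N / k' / (1 + 1 / k') \<Longrightarrow> edge_taylor ?b (1 / k') (?N / k') 1 z s = 0"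
            by blast
          have "1 \<le> K" using k1 K by simp
          then show ?thesis using root[OF convs _ wts[unfolded K] van[unfolded K] e(1)[unfolded K]] by blast
        qed
      qed
    qed
  qed
qed

section \<open>Composition and differentiation of complex double series\<close>

text \<open>
  The partial sums are holomorphic, and the convergence is uniform by the Weierstrass test.
\<close>
lemma holomorphic_on_double_series_comp:
  fixes a :: "nat \<times> nat \<Rightarrow> complex"
  assumes conv: "abs_conv a r R" and S: "open S"
    and hol: "f holomorphic_on S" "g holomorphic_on S"
    and bd: "\<And>t. t \<in> S \<Longrightarrow> norm (f t) \<le> r" "\<And>t. t \<in> S \<Longrightarrow> norm (g t) \<le> R"
  shows "(\<lambda>t. double_series a (f t) (g t)) holomorphic_on S"
proof -
  have unif: "uniform_limit S (\<lambda>X t. \<Sum>ij\<in>X. (case ij of (i, j) \<Rightarrow> a (i, j) * f t ^ i * g t ^ j))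
      (\<lambda>t. double_series a (f t) (g t)) (finite_subsets_at_top UNIV)"
  proof (rule Weierstrass_m_test_general')
    show "(\<lambda>(i, j). norm (a (i, j)) * r ^ i * R ^ j) summable_on UNIV"
      using conv by (simp add: abs_conv_def)
    fix ij :: "nat \<times> nat" and t assume t: "t \<in> S"
    obtain i j where ij: "ij = (i, j)" by force
    have "0 \<le> r" "0 \<le> R" using bd[OF t] norm_ge_zero order_trans by blast+
    then show "norm (case ij of (i, j) \<Rightarrow> a (i, j) * f t ^ i * g t ^ j) \<le> (case ij of (i, j) \<Rightarrow> norm (a (i, j)) * r ^ i * R ^ j)"
      using bd[OF t] by (auto simp: ij norm_mult norm_power intro!: mult_mono power_mono)
  next
    fix t assume "t \<in> S"
    then show "((\<lambda>ij. case ij of (i, j) \<Rightarrow> a (i, j) * f t ^ i * g t ^ j) has_sum double_series a (f t) (g t)) UNIV"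
      using abs_conv_has_sum[OF conv] bd by blast
  qed
  have "(\<lambda>t. double_series a (f t) (g t)) field_differentiable (at t)" if t: "t \<in> S" for t
  proof -
    obtain d where d: "d > 0" "cball t d \<subseteq> S" using S t open_contains_cball by blast
    let ?F = "\<lambda>X t. \<Sum>ij\<in>X. (case ij of (i, j) \<Rightarrow> a (i, j) * f t ^ i * g t ^ j)"
    have "?F X holomorphic_on S" for X
      unfolding case_prod_unfold by (intro holomorphic_intros hol)
    then have "?F X holomorphic_on cball t d" for X using d holomorphic_on_subset by blast
    note hF = this
    have ev: "eventually (\<lambda>X. continuous_on (cball t d) (?F X) \<and> ?F X holomorphic_on ball t d) (finite_subsets_at_top UNIV)"
      by (rule always_eventually, rule allI)
        (rule conjI[OF holomorphic_on_imp_continuous_on[OF hF] holomorphic_on_subset[OF hF ball_subset_cball]])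
    have ul: "uniform_limit (cball t d) ?F (\<lambda>t. double_series a (f t) (g t)) (finite_subsets_at_top UNIV)"
      using unif d uniform_limit_on_subset by blast
    have "(\<lambda>t. double_series a (f t) (g t)) holomorphic_on ball t d"
      using holomorphic_uniform_limit[OF ev ul] finite_subsets_at_top_neq_bot by blast
    then show ?thesis using d(1) by (simp add: holomorphic_on_open field_differentiable_def)
  qed
  then show ?thesis by (simp add: holomorphic_on_def field_differentiable_at_within)
qed

text \<open>
  The coefficients of the s-th partial derivative in the second variable, divided by s!.
\<close>
definition taylor_coeffs :: "nat \<Rightarrow> (nat \<times> nat \<Rightarrow> 'a::semiring_1) \<Rightarrow> nat \<times> nat \<Rightarrow> 'a"
  where "taylor_coeffs s a = (\<lambda>(i, j). of_nat ((j + s) choose s) * a (i, j + s))"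

lemma abs_conv_imp_bounded:
  assumes "abs_conv a r R" "0 \<le> r" "0 \<le> R"
  shows "\<exists>M\<ge>0. \<forall>i j. norm (a (i, j)) * r ^ i * R ^ j \<le> M"
proof -
  obtain M where M: "\<forall>ij\<in>UNIV. norm ((\<lambda>(i, j). norm (a (i, j)) * r ^ i * R ^ j) ij) \<le> M"
    using has_sum_imp_bounded_terms[OF has_sum_infsum[OF assms(1)[unfolded abs_conv_def]]] by (elim exE)
  have "norm (a (i, j)) * r ^ i * R ^ j \<le> max 0 M" for i j
    using bspec[OF M UNIV_I, of "(i, j)"] by simp
  then show ?thesis by (intro exI[of _ "max 0 M"]) auto
qed

text \<open>
  The binomial factors are bounded by 2^(j+s), which halves the radius in the second variable.
\<close>
lemma abs_conv_taylor_coeffs: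
  fixes a :: "nat \<times> nat \<Rightarrow> 'a::{real_normed_field,banach}"
  assumes "abs_conv a r R" "0 < R" "0 \<le> r'" "r' < r" "0 \<le> R'" "R' < R / 2"
  shows "abs_conv (taylor_coeffs s a) r' R'"
proof -
  obtain M where M: "M \<ge> 0" "\<And>i j. norm (a (i, j)) * r ^ i * R ^ j \<le> M"
    using abs_conv_imp_bounded[OF assms(1)] assms by force
  show ?thesis
  proof (rule abs_conv_if_bounded[where r=r and R="R / 2" and M="(2 / R) ^ s * M"])
    fix i j
    have "real ((j + s) choose s) \<le> 2 ^ (j + s)"
      using binomial_le_pow2[of "j + s" s] by (metis of_nat_le_iff of_nat_numeral of_nat_power)
    then have "norm (taylor_coeffs s a (i, j)) \<le> 2 ^ (j + s) * norm (a (i, j + s))"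
      by (simp add: taylor_coeffs_def norm_mult mult_right_mono)
    then have "norm (taylor_coeffs s a (i, j)) * r ^ i * (R / 2) ^ j \<le> 2 ^ (j + s) * norm (a (i, j + s)) * r ^ i * (R / 2) ^ j"
      using assms by (intro mult_right_mono) auto
    also have "\<dots> = (2 / R) ^ s * (norm (a (i, j + s)) * r ^ i * R ^ (j + s))"
      using assms by (simp add: power_add power_divide field_simps)
    also have "\<dots> \<le> (2 / R) ^ s * M" using M(2)[of i "j + s"] assms by (intro mult_left_mono) auto
    finally show "norm (taylor_coeffs s a (i, j)) * r ^ i * (R / 2) ^ j \<le> (2 / R) ^ s * M" .
  qed (use assms in auto)
qed

lemma double_series_has_derivative_snd:
  fixes a :: "nat \<times> nat \<Rightarrow> complex"
  assumes conv: "abs_conv a r R" and x: "norm x \<le> r" and z: "norm z < R"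
  shows "((\<lambda>z. double_series a x z) has_field_derivative double_series (taylor_coeffs 1 a) x z) (at z)"
proof -
  have R: "0 < R" using z norm_ge_zero le_less_trans by blast
  let ?F = "\<lambda>X z. \<Sum>ij\<in>X. (case ij of (i, j) \<Rightarrow> a (i, j) * x ^ i * z ^ j)"
  let ?F' = "\<lambda>X z. \<Sum>ij\<in>X. (case ij of (i, j) \<Rightarrow> a (i, j) * x ^ i * (of_nat j * z ^ (j - 1)))"
  have unif: "uniform_limit (cball 0 R) ?F (\<lambda>z. double_series a x z) (finite_subsets_at_top UNIV)"
  proof (rule Weierstrass_m_test_general')
    show "(\<lambda>(i, j). norm (a (i, j)) * r ^ i * R ^ j) summable_on UNIV"
      using conv by (simp add: abs_conv_def)
    fix ij :: "nat \<times> nat" and z :: complex assume z: "z \<in> cball 0 R"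
    obtain i j where ij: "ij = (i, j)" by force
    have "0 \<le> r" using x norm_ge_zero order_trans by blast
    then show "norm (case ij of (i, j) \<Rightarrow> a (i, j) * x ^ i * z ^ j) \<le> (case ij of (i, j) \<Rightarrow> norm (a (i, j)) * r ^ i * R ^ j)"
      using x z R by (auto simp: ij norm_mult norm_power intro!: mult_mono power_mono)
  next
    fix z :: complex assume "z \<in> cball 0 R"
    then show "((\<lambda>ij. case ij of (i, j) \<Rightarrow> a (i, j) * x ^ i * z ^ j) has_sum double_series a x z) UNIV"
      using abs_conv_has_sum[OF conv x] by auto
  qed
  have deriv: "(?F X has_field_derivative ?F' X w) (at w)" for X w
    unfolding case_prod_unfold by (auto intro!: derivative_eq_intros sum.cong)
  have ev: "eventually (\<lambda>X. continuous_on (cball 0 R) (?F X) \<and>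
      (\<forall>w\<in>ball 0 R. (?F X has_field_derivative ?F' X w) (at w))) (finite_subsets_at_top UNIV)"
    using deriv by (intro always_eventually allI conjI ballI)
      (auto simp: case_prod_unfold intro!: continuous_intros)
  obtain g' where g': "\<And>w. w \<in> ball 0 R \<Longrightarrow> ((\<lambda>z. double_series a x z) has_field_derivative g' w) (at w) \<and>
      ((\<lambda>X. ?F' X w) \<longlongrightarrow> g' w) (finite_subsets_at_top UNIV)"
    using has_complex_derivative_uniform_limit[OF ev unif finite_subsets_at_top_neq_bot R] by blast
  have zR: "z \<in> ball 0 R" using z by simp
  have "((\<lambda>ij. case ij of (i, j) \<Rightarrow> a (i, j) * x ^ i * (of_nat j * z ^ (j - 1))) has_sum g' z) UNIV"
    using g'[OF zR] by (simp add: has_sum_def)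
  then have "((\<lambda>ij. case ij of (i, j) \<Rightarrow> a (i, j) * x ^ i * (of_nat j * z ^ (j - 1))) has_sum g' z) ((\<lambda>(i, j). (i, Suc j)) ` UNIV)"
  proof (subst (asm) has_sum_cong_neutral)
    fix ij :: "nat \<times> nat" assume "ij \<in> UNIV - (\<lambda>(i, j). (i, Suc j)) ` UNIV"
    then have "snd ij = 0" by (cases ij, cases "snd ij") (auto simp: image_iff)
    then show "(case ij of (i, j) \<Rightarrow> a (i, j) * x ^ i * (of_nat j * z ^ (j - 1))) = 0" by (simp add: case_prod_unfold)
  qed auto
  then have "((\<lambda>ij. case ij of (i, j) \<Rightarrow> taylor_coeffs 1 a (i, j) * x ^ i * z ^ j) has_sum g' z) UNIV"
    by (subst (asm) has_sum_reindex) (auto simp: inj_on_def o_def case_prod_unfold taylor_coeffs_def mult_ac)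
  then have "double_series (taylor_coeffs 1 a) x z = g' z"
    unfolding double_series_def by (rule infsumI)
  then show ?thesis using g'[OF zR] by simp
qed

lemma taylor_coeffs_Suc: "taylor_coeffs 1 (taylor_coeffs s a) ij = of_nat (Suc s) * (taylor_coeffs (Suc s) a ij :: 'a :: comm_semiring_1)"
proof -
  obtain i j where ij: "ij = (i, j)" by force
  have "(j + 1) * ((j + 1 + s) choose s) = Suc s * ((j + Suc s) choose Suc s)"
    using binomial_absorb_comp[of "j + Suc s" s] binomial_absorption[of s "j + Suc s"] by simp
  then have "of_nat (j + 1) * of_nat ((j + 1 + s) choose s) = of_nat (Suc s) * (of_nat ((j + Suc s) choose Suc s) :: 'a)"
    by (metis of_nat_mult)
  then show ?thesis by (simp add: taylor_coeffs_def ij mult.assoc[symmetric])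
qed

lemma double_series_cmult:
  fixes a :: "nat \<times> nat \<Rightarrow> 'a::{real_normed_field,banach}"
  shows "double_series (\<lambda>ij. c * a ij) x y = c * double_series a x y"
proof -
  have "double_series (\<lambda>ij. c * a ij) x y = (\<Sum>\<^sub>\<infinity>ij. c * (case ij of (i, j) \<Rightarrow> a (i, j) * x ^ i * y ^ j))"
    unfolding double_series_def by (intro infsum_cong) (simp add: case_prod_unfold mult_ac)
  then show ?thesis unfolding double_series_def by (simp add: infsum_cmult_right')
qed

lemma higher_deriv_double_series:
  fixes a :: "nat \<times> nat \<Rightarrow> complex"
  assumes conv: "abs_conv a r R" "0 < R" and x: "norm x < r" and c: "norm c + d \<le> R / 2"
    and F: "\<And>w. norm w < d \<Longrightarrow> F w = double_series a x (w + c)"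
    and w: "norm w < d"
  shows "(deriv ^^ s) F w = fact s * double_series (taylor_coeffs s a) x (w + c)"
  using w
proof (induction s arbitrary: w)
  case 0
  have "taylor_coeffs 0 a = a" by (auto simp: taylor_coeffs_def)
  then show ?case using F[OF 0] by simp
next
  case (Suc s)
  have wc: "norm (w + c) < R / 2" using c Suc.prems norm_triangle_ineq[of w c] by simp
  obtain R' where R': "norm (w + c) < R'" "R' < R / 2" using dense[OF wc] by blast
  have conv': "abs_conv (taylor_coeffs s a) (norm x) R'"
  proof -
    have "0 \<le> R'" using R' norm_ge_zero[of "w + c"] by linarith
    then show ?thesis using R' x by (intro abs_conv_taylor_coeffs[OF conv]) auto
  qed
  have "((\<lambda>z. double_series (taylor_coeffs s a) x z) has_field_derivative
      double_series (taylor_coeffs 1 (taylor_coeffs s a)) x (w + c)) (at (w + c))"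
    by (rule double_series_has_derivative_snd[OF conv' order_refl R'(1)])
  then have "((\<lambda>w. fact s * double_series (taylor_coeffs s a) x (w + c)) has_field_derivative
      fact s * double_series (taylor_coeffs 1 (taylor_coeffs s a)) x (w + c)) (at w)"
    by (intro DERIV_cmult) (simp only: DERIV_shift)
  moreover have "double_series (taylor_coeffs 1 (taylor_coeffs s a)) x (w + c) = of_nat (Suc s) * double_series (taylor_coeffs (Suc s) a) x (w + c)"
    unfolding double_series_cmult[symmetric] by (rule arg_cong3[where f=double_series], rule ext, rule taylor_coeffs_Suc) (rule refl)+
  moreover have "\<forall>\<^sub>F w in nhds w. (deriv ^^ s) F w = fact s * double_series (taylor_coeffs s a) x (w + c)"
  proof -
    have "\<forall>\<^sub>F w in nhds w. w \<in> ball 0 d" using Suc.prems by (intro eventually_nhds_in_open) auto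
    then show ?thesis by eventually_elim (auto intro: Suc.IH)
  qed
  ultimately have "((deriv ^^ s) F has_field_derivative fact s * (of_nat (Suc s) * double_series (taylor_coeffs (Suc s) a) x (w + c))) (at w)"
    using DERIV_cong_ev[of w w "(deriv ^^ s) F" "\<lambda>w. fact s * double_series (taylor_coeffs s a) x (w + c)"] by simp
  then show ?case by (simp add: DERIV_imp_deriv mult_ac)
qed

section \<open>Power series of separately holomorphic functions\<close>

text \<open>
  A bounded form of Osgood's lemma. The Taylor coefficients c j in the second variable are
  holomorphic by induction on j, being uniform limits of (H x w - (\<Sum>i<j. c i x * w^i)) / w^j as
  w tends to 0. Cauchy's inequalities in both variables give absolute convergence. This gives
  expansions of compositions without rearranging series.
\<close>
lemma separately_holomorphic_power_series:
  fixes H :: "complex \<Rightarrow> complex \<Rightarrow> complex"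
  assumes r: "0 < r" and R: "0 < R"
    and bd: "\<And>x w. norm x < r \<Longrightarrow> norm w < R \<Longrightarrow> norm (H x w) \<le> M"
    and hol1: "\<And>w. norm w < R \<Longrightarrow> (\<lambda>x. H x w) holomorphic_on ball 0 r"
    and hol2: "\<And>x. norm x < r \<Longrightarrow> H x holomorphic_on ball 0 R"
  shows "\<exists>g. \<forall>r' R'. 0 \<le> r' \<longrightarrow> r' < r \<longrightarrow> 0 \<le> R' \<longrightarrow> R' < R \<longrightarrow>
     abs_conv g r' R' \<and> (\<forall>x w. norm x \<le> r' \<longrightarrow> norm w \<le> R' \<longrightarrow> H x w = double_series g x w)"
proof -
  have M: "0 \<le> M" using order_trans[OF norm_ge_zero bd[of 0 0]] r R by simp
  define c where "c j x = (deriv ^^ j) (H x) 0 / fact j" for j x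
  have H_sums: "(\<lambda>j. c j x * w ^ j) sums H x w" if "norm x < r" "norm w < R" for x w
    using holomorphic_power_series[OF hol2[OF that(1)], of w] that by (simp add: c_def)
  have c_bound: "norm (c j x) \<le> M / R' ^ j" if x: "norm x < r" and R': "0 < R'" "R' < R" for j x R'
  proof -
    have "norm ((deriv ^^ j) (H x) 0) \<le> fact j * M / R' ^ j"
    proof (rule Cauchy_inequality[OF _ _ R'(1)])
      have sub: "cball 0 R' \<subseteq> ball (0::complex) R" using R' by auto
      show "continuous_on (cball 0 R') (H x)"
        using holomorphic_on_imp_continuous_on[OF hol2[OF x]] continuous_on_subset sub by blast
      show "H x holomorphic_on ball 0 R'"
        using hol2[OF x] by (rule holomorphic_on_subset) (use R' in auto)
      show "norm (H x w) \<le> M" if "norm (0 - w) = R'" for w using that x R' by (intro bd) auto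
    qed
    then show ?thesis by (simp add: c_def norm_divide field_simps)
  qed
  have c_hol: "c j holomorphic_on ball 0 r" for j
  proof (induction j rule: less_induct)
    case (less j)
    define R' where "R' = R / 2"
    have R': "0 < R'" "R' < R" using R by (auto simp: R'_def)
    (* A null sequence of nonzero points; the uniform convergence of q n in x comes from Cauchy's
    inequality for c. *)
    define w where "w n = complex_of_real (R' / 2 / (real n + 1))" for n
    have w: "norm (w n) = R' / 2 / (real n + 1)" "w n \<noteq> 0" "norm (w n) \<le> R' / 2" for n
    proof -
      have t: "0 < R' / 2 / (real n + 1)" "R' / 2 / (real n + 1) \<le> R' / 2"
        using R' by (auto simp: field_simps)
      show "norm (w n) = R' / 2 / (real n + 1)" "norm (w n) \<le> R' / 2"
        unfolding w_def norm_of_real using t by linarith+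
      show "w n \<noteq> 0" unfolding w_def of_real_eq_0_iff using t(1) by linarith
    qed
    define q where "q n x = (H x (w n) - (\<Sum>i<j. c i x * w n ^ i)) / w n ^ j" for n x
    have q_hol: "q n holomorphic_on ball 0 r" for n
    proof -
      have "norm (w n) < R" using w(3)[of n] R' by simp
      then show ?thesis unfolding q_def using w(2) by (intro holomorphic_intros hol1 less.IH) auto
    qed
    have q_bound: "norm (q n x - c j x) \<le> (M / R' ^ j) / (real n + 1)" if x: "norm x < r" for n x
    proof -
      define \<theta> where "\<theta> = norm (w n) / R'"
      have \<theta>: "0 \<le> \<theta>" "\<theta> \<le> 1 / 2" "\<theta> = 1 / 2 / (real n + 1)" using w(3)[of n] R' by (auto simp: \<theta>_def w(1))
      have wR: "norm (w n) < R" using w(3)[of n] R' by simp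
      have "(\<lambda>i. c (i + Suc j) x * w n ^ (i + Suc j)) sums (H x (w n) - (\<Sum>i<Suc j. c i x * w n ^ i))"
        by (rule sums_iff_shift[THEN iffD2, of "\<lambda>i. c i x * w n ^ i"]) (use H_sums[OF x wR] in simp)
      moreover have "(\<lambda>i. M * \<theta> ^ Suc j * \<theta> ^ i) sums (M * \<theta> ^ Suc j * (1 / (1 - \<theta>)))"
        using \<theta> by (intro sums_mult geometric_sums) auto
      moreover have "norm (c (i + Suc j) x * w n ^ (i + Suc j)) \<le> M * \<theta> ^ Suc j * \<theta> ^ i" for i
      proof -
        have "norm (c (i + Suc j) x * w n ^ (i + Suc j)) \<le> M / R' ^ (i + Suc j) * norm (w n) ^ (i + Suc j)"
          unfolding norm_mult norm_power by (intro mult_right_mono c_bound x R') auto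
        also have "\<dots> = M * \<theta> ^ Suc j * \<theta> ^ i" by (simp add: \<theta>_def power_divide power_add mult_ac)
        finally show ?thesis .
      qed
      ultimately have "norm (H x (w n) - (\<Sum>i<Suc j. c i x * w n ^ i)) \<le> M * \<theta> ^ Suc j * (1 / (1 - \<theta>))"
        by (rule norm_sums_le)
      also have "\<dots> \<le> M * \<theta> ^ Suc j * 2"
      proof (rule mult_left_mono)
        show "1 / (1 - \<theta>) \<le> 2" using \<theta>(1,2) by (simp add: divide_le_eq)
        show "0 \<le> M * \<theta> ^ Suc j" using \<theta>(1) M by (intro mult_nonneg_nonneg zero_le_power)
      qed
      finally have *: "norm (H x (w n) - (\<Sum>i<Suc j. c i x * w n ^ i)) \<le> 2 * M * \<theta> ^ Suc j" by simp
      have "q n x - c j x = (H x (w n) - (\<Sum>i<Suc j. c i x * w n ^ i)) / w n ^ j"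
        using w(2) by (simp add: q_def field_simps)
      then have "norm (q n x - c j x) \<le> 2 * M * \<theta> ^ Suc j / norm (w n) ^ j"
        using * by (simp add: norm_divide norm_power divide_right_mono)
      also have "\<dots> = 2 * M * \<theta> / R' ^ j"
        using R' w(2)[of n] by (simp add: \<theta>_def power_divide)
      also have "\<dots> = (M / R' ^ j) / (real n + 1)"
      proof -
        have "2 * M * (1 / 2 / L) / P = M / P / L" for L P :: real
          by (cases "L = 0"; cases "P = 0"; simp add: field_simps)
        then show ?thesis unfolding \<theta>(3) .
      qed
      finally show ?thesis .
    qed
    have unif: "uniform_limit (ball 0 r) q (c j) sequentially"
    proof (rule uniform_limitI)
      fix e :: real assume e: "e > 0"
      have "(\<lambda>n. (M / R' ^ j) * inverse (real (Suc n))) \<longlonglongrightarrow> (M / R' ^ j) * 0"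
        by (intro tendsto_intros LIMSEQ_inverse_real_of_nat)
      then have "eventually (\<lambda>n. (M / R' ^ j) * inverse (real (Suc n)) < e) sequentially"
        using e by (auto intro: order_tendstoD(2))
      then show "\<forall>\<^sub>F n in sequentially. \<forall>x\<in>ball 0 r. dist (q n x) (c j x) < e"
      proof eventually_elim
        case (elim n)
        have "(M / R' ^ j) / (real n + 1) < e" using elim by (simp add: divide_inverse add.commute)
        show ?case
        proof
          fix x :: complex assume "x \<in> ball 0 r"
          then have "norm (q n x - c j x) \<le> (M / R' ^ j) / (real n + 1)" by (intro q_bound) simp
          then show "dist (q n x) (c j x) < e" using \<open>(M / R' ^ j) / (real n + 1) < e\<close> by (simp add: dist_norm)
        qed
      qed
    qed
    show ?case
    proof (rule holomorphic_uniform_sequence[OF open_ball q_hol])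
      fix x :: complex assume x: "x \<in> ball 0 r"
      obtain d where d: "d > 0" "cball x d \<subseteq> ball 0 r" using open_contains_cball[of "ball (0::complex) r"] x by blast
      then show "\<exists>d>0. cball x d \<subseteq> ball 0 r \<and> uniform_limit (cball x d) q (c j) sequentially"
        using uniform_limit_on_subset[OF unif] by blast
    qed
  qed
  define g where "g = (\<lambda>(i, j). (deriv ^^ i) (c j) 0 / fact i)"
  have g_bound: "norm (g (i, j)) * r' ^ i * R' ^ j \<le> M" if r': "0 < r'" "r' < r" and R': "0 < R'" "R' < R" for i j r' R'
  proof -
    have "norm ((deriv ^^ i) (c j) 0) \<le> fact i * (M / R' ^ j) / r' ^ i"
    proof (rule Cauchy_inequality[OF _ _ r'(1)])
      have sub: "cball 0 r' \<subseteq> ball (0::complex) r" using r' by auto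
      show "continuous_on (cball 0 r') (c j)"
        using holomorphic_on_imp_continuous_on[OF c_hol] continuous_on_subset sub by blast
      show "c j holomorphic_on ball 0 r'"
        using c_hol by (rule holomorphic_on_subset) (use r' in auto)
      show "norm (c j x) \<le> M / R' ^ j" if "norm (0 - x) = r'" for x using that r' R' by (intro c_bound) auto
    qed
    then have "norm (g (i, j)) \<le> M / R' ^ j / r' ^ i" by (simp add: g_def norm_divide field_simps)
    then show ?thesis using r' R' by (simp add: field_simps)
  qed
  have conv: "abs_conv g r' R'" if "0 \<le> r'" "r' < r" "0 \<le> R'" "R' < R" for r' R'
  proof -
    have "r' < (r' + r) / 2" "(r' + r) / 2 < r" "R' < (R' + R) / 2" "(R' + R) / 2 < R" using that by auto
    then show ?thesis using that
      by (intro abs_conv_if_bounded[where r="(r' + r) / 2" and R="(R' + R) / 2" and M=M] g_bound) auto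
  qed
  have "H x w = double_series g x w" if x: "norm x \<le> r'" "0 \<le> r'" "r' < r" and w: "norm w \<le> R'" "0 \<le> R'" "R' < R" for x w r' R'
  proof -
    define R1 where "R1 = (R' + R) / 2"
    have R1: "0 < R1" "R1 < R" "norm w \<le> R1" using w R by (auto simp: R1_def)
    have cs: "abs_conv (swap_coeffs g) R1 r'" using conv[of r' R1] x R1 by (intro abs_conv_swap) auto
    have inner: "(\<Sum>\<^sub>\<infinity>i. swap_coeffs g (j, i) * x ^ i) = c j x" for j
    proof -
      have "(\<lambda>i. swap_coeffs g (j, i) * x ^ i) sums (\<Sum>\<^sub>\<infinity>i. swap_coeffs g (j, i) * x ^ i)"
        by (rule has_sum_imp_sums[OF double_series_iterated(2)[OF cs R1(3) x(1) R1(1)]])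
      moreover have "(\<lambda>i. swap_coeffs g (j, i) * x ^ i) sums c j x"
        using holomorphic_power_series[OF c_hol, of x j] x by (simp add: g_def)
      ultimately show ?thesis by (rule sums_unique2)
    qed
    have "(\<lambda>j. c j x * w ^ j) sums double_series (swap_coeffs g) w x"
      using has_sum_imp_sums[OF double_series_iterated(1)[OF cs R1(3) x(1) R1(1)]] unfolding inner .
    moreover have "(\<lambda>j. c j x * w ^ j) sums H x w" using x w by (intro H_sums) auto
    ultimately have "H x w = double_series (swap_coeffs g) w x" by (rule sums_unique2[symmetric])
    then show ?thesis by (simp add: double_series_swap)
  qed
  with conv show ?thesis by (intro exI[of _ g]) blast
qed

text \<open>
  Complex differentiability implies holomorphy in each variable, and continuity implies local
  boundedness.
\<close>
lemma holomorphic2_has_power_series: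
  assumes "open U" "0 \<in> U" "holomorphic2_on f U"
  shows "\<exists>a. has_power_series2 f a 0"
proof -
  have der: "\<exists>A B. (f has_derivative (\<lambda>(h, k). A * h + B * k)) (at z)" if "z \<in> U" for z
    using assms(3) that by (auto simp: holomorphic2_on_def)
  have cont: "isCont f z" if "z \<in> U" for z
    using der[OF that] has_derivative_continuous by blast
  obtain e where e: "e > 0" "cball 0 e \<subseteq> U" using assms(1,2) open_contains_cball by blast
  have "compact (f ` cball 0 e)"
    using e cont by (intro compact_continuous_image continuous_at_imp_continuous_on) auto
  then obtain M where M: "\<And>z. z \<in> cball 0 e \<Longrightarrow> norm (f z) \<le> M"
    using compact_imp_bounded bounded_iff by (metis imageI)
  define r where "r = e / 2"
  have r: "r > 0" using e by (simp add: r_def)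
  have in_ball: "(x, w) \<in> cball 0 e" if "norm x < r" "norm w < r" for x w :: complex
    using that norm_Pair_le[of x w] by (simp add: r_def)
  have slice1: "(\<lambda>x. f (x, w)) holomorphic_on ball 0 r" if w: "norm w < r" for w
  proof (rule holomorphic_on_open[THEN iffD2, OF open_ball], rule ballI)
    fix x :: complex assume "x \<in> ball 0 r"
    then have "(x, w) \<in> U" using in_ball[of x w] w e by auto
    then obtain A B where f: "(f has_derivative (\<lambda>(h, k). A * h + B * k)) (at (x, w))" using der by blast
    have p: "((\<lambda>x. (x, w)) has_derivative (\<lambda>h. (h, 0))) (at x)" by (auto intro!: derivative_eq_intros)
    have "((\<lambda>x. f (x, w)) has_derivative (\<lambda>h. A * h)) (at x)"
      using has_derivative_compose[OF p, of f "\<lambda>(h, k). A * h + B * k"] f by simp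
    then show "\<exists>f'. ((\<lambda>x. f (x, w)) has_field_derivative f') (at x)" by (auto simp: has_field_derivative_def)
  qed
  have slice2: "(\<lambda>w. f (x, w)) holomorphic_on ball 0 r" if x: "norm x < r" for x
  proof (rule holomorphic_on_open[THEN iffD2, OF open_ball], rule ballI)
    fix w :: complex assume "w \<in> ball 0 r"
    then have "(x, w) \<in> U" using in_ball[of x w] x e by auto
    then obtain A B where f: "(f has_derivative (\<lambda>(h, k). A * h + B * k)) (at (x, w))" using der by blast
    have p: "((\<lambda>w. (x, w)) has_derivative (\<lambda>k. (0, k))) (at w)" by (auto intro!: derivative_eq_intros)
    have "((\<lambda>w. f (x, w)) has_derivative (\<lambda>k. B * k)) (at w)"
      using has_derivative_compose[OF p, of f "\<lambda>(h, k). A * h + B * k"] f by simp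
    then show "\<exists>f'. ((\<lambda>w. f (x, w)) has_field_derivative f') (at w)" by (auto simp: has_field_derivative_def)
  qed
  obtain g where g: "\<forall>r' R'. 0 \<le> r' \<longrightarrow> r' < r \<longrightarrow> 0 \<le> R' \<longrightarrow> R' < r \<longrightarrow>
     abs_conv g r' R' \<and> (\<forall>x w. norm x \<le> r' \<longrightarrow> norm w \<le> R' \<longrightarrow> f (x, w) = double_series g x w)"
    using separately_holomorphic_power_series[OF r r, of "\<lambda>x w. f (x, w)" M] M in_ball slice1 slice2 by blast
  have r2: "0 \<le> r / 2" "r / 2 < r" using r by auto
  have "has_power_series2 f g 0"
    unfolding has_power_series2_iff
    using g[rule_format, OF r2 r2] r by (intro exI[of _ "r / 2"]) auto
  then show ?thesis by (rule exI[of _ g])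
qed

section \<open>Solving an analytic equation for the second variable\<close>

lemma double_series_Reals:
  fixes a :: "nat \<times> nat \<Rightarrow> complex"
  assumes "abs_conv a r R" "norm x \<le> r" "norm y \<le> R" "\<And>ij. a ij \<in> \<real>" "x \<in> \<real>" "y \<in> \<real>"
  shows "double_series a x y \<in> \<real>"
proof -
  have "((\<lambda>ij. Im (case ij of (i, j) \<Rightarrow> a (i, j) * x ^ i * y ^ j)) has_sum Im (double_series a x y)) UNIV"
    by (rule has_sum_Im[OF abs_conv_has_sum[OF assms(1-3)]])
  moreover have "Im (case ij of (i, j) \<Rightarrow> a (i, j) * x ^ i * y ^ j) = 0" for ij
    using assms(4-6) by (cases ij) (simp add: complex_is_Real_iff[symmetric])
  ultimately have "Im (double_series a x y) = 0" by (rule has_sum_unique[OF _ has_sum_0])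
  then show ?thesis by (simp add: complex_is_Real_iff)
qed

text \<open>
  The simplified Newton iteration z \<mapsto> z - \<alpha>(x, z) / b with b = \<partial>_z
  \<alpha>(0, z0) is a contraction with factor 1/2 for small x. The iterates are holomorphic in x
  and converge uniformly, and each of them is real at real x if \<alpha> and z0 are, so that the
  limit inherits both properties.
\<close>
lemma implicit_zero:
  fixes \<alpha> :: "nat \<times> nat \<Rightarrow> complex"
  assumes conv: "abs_conv \<alpha> r R" and r: "0 < r" and z0: "norm z0 < R / 2"
    and zero: "double_series \<alpha> 0 z0 = 0" and B: "double_series (taylor_coeffs 1 \<alpha>) 0 z0 \<noteq> 0"
  shows "\<exists>\<tau> z. 0 < \<tau> \<and> \<tau> < r \<and> z holomorphic_on ball 0 \<tau> \<and> z 0 = z0 \<and>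
    (\<forall>x. norm x < \<tau> \<longrightarrow> norm (z x) \<le> R / 2 \<and> double_series \<alpha> x (z x) = 0) \<and>
    ((\<forall>ij. \<alpha> ij \<in> \<real>) \<longrightarrow> z0 \<in> \<real> \<longrightarrow> (\<forall>x\<in>\<real>. norm x < \<tau> \<longrightarrow> z x \<in> \<real>))"
proof -
  define \<beta> where "\<beta> = taylor_coeffs 1 \<alpha>"
  define b where "b = double_series \<beta> 0 z0"
  have b: "b \<noteq> 0" using B by (simp add: b_def \<beta>_def)
  define R1 where "R1 = (norm z0 + R / 2) / 2"
  have "0 < R" using z0 norm_ge_zero[of z0] by linarith
  then have R1: "norm z0 < R1" "R1 < R / 2" "0 < R" using z0 by (auto simp: R1_def)
  have R1': "0 < R1" using R1(1) norm_ge_zero[of z0] by linarith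
  have conv\<beta>: "abs_conv \<beta> (r / 2) R1"
    unfolding \<beta>_def using r R1 R1' by (intro abs_conv_taylor_coeffs[OF conv]) auto
  have "isCont (\<lambda>(x, y). double_series \<beta> x y) (0, z0)"
  proof (rule continuous_on_interior[OF continuous_on_double_series[OF conv\<beta>]])
    have "(0 :: complex, z0) \<in> ball 0 (r / 2) \<times> ball 0 R1" using r R1 by simp
    moreover have "ball 0 (r / 2) \<times> ball 0 R1 \<subseteq> interior (cball (0::complex) (r / 2) \<times> cball (0::complex) R1)"
      by (rule interior_maximal[OF Sigma_mono[OF ball_subset_cball ball_subset_cball] open_Times[OF open_ball open_ball]])
    ultimately show "(0 :: complex, z0) \<in> interior (cball 0 (r / 2) \<times> cball 0 R1)" by (rule rev_subsetD)
  qed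
  then have near: "\<forall>e>0. \<exists>d>0. \<forall>p. dist p (0, z0) < d \<longrightarrow> dist (case p of (x, y) \<Rightarrow> double_series \<beta> x y) b < e"
    unfolding continuous_at_eps_delta b_def by simp
  have "0 < norm b / 2" using b by simp
  from near[rule_format, OF this]
  obtain d where "d > 0" and d': "\<forall>p. dist p (0, z0) < d \<longrightarrow> dist (case p of (x, y) \<Rightarrow> double_series \<beta> x y) b < norm b / 2"
    by (elim exE conjE)
  note d = \<open>d > 0\<close> d'[rule_format]
  define \<epsilon> where "\<epsilon> = min (d / 2) ((R1 - norm z0) / 2)"
  have \<epsilon>: "\<epsilon> > 0" "\<epsilon> \<le> d / 2" "norm z0 + \<epsilon> < R1" using d R1 by (auto simp: \<epsilon>_def min_def field_simps)
  have zR: "norm z < R1" if "z \<in> cball z0 \<epsilon>" for z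
    using that \<epsilon>(3) norm_triangle_sub[of z z0] by (simp add: dist_norm norm_minus_commute)
  have "isCont (\<lambda>x. double_series \<alpha> x z0) 0"
  proof -
    have "continuous_on (ball 0 r) ((\<lambda>(x, y). double_series \<alpha> x y) \<circ> (\<lambda>x. (x, z0)))"
      using z0 R1 by (intro continuous_on_compose continuous_on_subset[OF continuous_on_double_series[OF conv]] continuous_intros) auto
    then show ?thesis using r by (simp add: o_def continuous_on_eq_continuous_at)
  qed
  moreover have "norm b * \<epsilon> / 2 > 0" using b \<epsilon> by simp
  ultimately obtain d' where d': "d' > 0" "\<And>x. dist x 0 < d' \<Longrightarrow> dist (double_series \<alpha> x z0) 0 < norm b * \<epsilon> / 2"
    unfolding continuous_at_eps_delta zero by blast
  define \<tau> where "\<tau> = Min {r / 2, d / 2, d'}"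
  have \<tau>: "0 < \<tau>" "\<tau> \<le> r / 2" "\<tau> \<le> d / 2" "\<tau> \<le> d'" using r d d' by (auto simp: \<tau>_def)
  define T where "T x z = z - double_series \<alpha> x z / b" for x z
  have contract: "norm (T x z - T x z') \<le> 1 / 2 * norm (z - z')"
    if x: "norm x < \<tau>" and z: "z \<in> cball z0 \<epsilon>" "z' \<in> cball z0 \<epsilon>" for x z z'
  proof (rule field_differentiable_bound[OF convex_cball _ _ z])
    fix y assume y: "y \<in> cball z0 \<epsilon>"
    have "norm x \<le> r" "norm y < R" using x \<tau> r zR[OF y] R1 by auto
    then show "(T x has_field_derivative 1 - double_series \<beta> x y / b) (at y within cball z0 \<epsilon>)"
      unfolding T_def \<beta>_def
      by (intro DERIV_diff DERIV_ident DERIV_cdivide has_field_derivative_at_within[OF double_series_has_derivative_snd[OF conv]])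
    have "dist (x, y) (0, z0) < d"
      using x y \<tau> \<epsilon> norm_Pair_le[of x "y - z0"] by (simp add: dist_norm norm_minus_commute)
    then have "norm (double_series \<beta> x y - b) < norm b / 2" using d(2)[of "(x, y)"] by (simp add: dist_norm)
    moreover have "1 - double_series \<beta> x y / b = - (double_series \<beta> x y - b) / b" using b by (simp add: field_simps)
    ultimately show "norm (1 - double_series \<beta> x y / b) \<le> 1 / 2"
      using b by (simp only: norm_divide norm_minus_cancel) (simp add: divide_le_eq)
  qed
  have start: "norm (T x z0 - z0) \<le> \<epsilon> / 2" if x: "norm x < \<tau>" for x
  proof -
    have "norm (double_series \<alpha> x z0) \<le> norm b * \<epsilon> / 2" using d'(2)[of x] x \<tau> by (simp add: less_imp_le)
    then show ?thesis using b by (simp add: T_def norm_divide field_simps)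
  qed
  define Z where "Z n = (\<lambda>x. (T x ^^ n) z0)" for n
  have Z0: "Z 0 = (\<lambda>x. z0)" and ZSuc: "Z (Suc n) x = T x (Z n x)" for n x by (auto simp: Z_def)
  have Zin: "Z n x \<in> cball z0 \<epsilon>" if x: "norm x < \<tau>" for n x
  proof (induction n)
    case 0 then show ?case using \<epsilon> by (simp add: Z0)
  next
    case (Suc n)
    have "z0 \<in> cball z0 \<epsilon>" using \<epsilon> by simp
    then have "norm (T x (Z n x) - T x z0) \<le> 1 / 2 * norm (Z n x - z0)" by (rule contract[OF x Suc])
    also have "\<dots> \<le> \<epsilon> / 2" using Suc by (simp add: dist_norm norm_minus_commute)
    finally have "norm (T x (Z n x) - z0) \<le> \<epsilon>"
      using start[OF x] norm_triangle_ineq[of "T x (Z n x) - T x z0" "T x z0 - z0"] by simp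
    then show ?case by (simp add: ZSuc dist_norm norm_minus_commute)
  qed
  have Zstep: "norm (Z (Suc n) x - Z n x) \<le> \<epsilon> / 2 * (1 / 2) ^ n" if x: "norm x < \<tau>" for n x
  proof (induction n)
    case 0 then show ?case using start[OF x] by (simp add: ZSuc Z0)
  next
    case (Suc n)
    have "norm (T x (Z (Suc n) x) - T x (Z n x)) \<le> 1 / 2 * norm (Z (Suc n) x - Z n x)"
      by (rule contract[OF x Zin[OF x] Zin[OF x]])
    then show ?case using Suc by (simp add: ZSuc)
  qed
  have Zhol: "Z n holomorphic_on ball 0 \<tau>" for n
  proof (induction n)
    case 0 then show ?case by (simp add: Z0)
  next
    case (Suc n)
    have "(\<lambda>x. double_series \<alpha> x (Z n x)) holomorphic_on ball 0 \<tau>"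
    proof (rule holomorphic_on_double_series_comp[OF conv open_ball _ Suc])
      fix x assume "x \<in> ball (0::complex) \<tau>"
      then have x: "norm x < \<tau>" by simp
      show "norm x \<le> r" using x \<tau> r by simp
      show "norm (Z n x) \<le> R" using zR[OF Zin[OF x, of n]] R1 by linarith
    qed auto
    then have "(\<lambda>x. T x (Z n x)) holomorphic_on ball 0 \<tau>"
      unfolding T_def using b Suc by (intro holomorphic_intros) auto
    then show ?case by (simp add: ZSuc[abs_def])
  qed
  have "uniformly_convergent_on (ball 0 \<tau>) (\<lambda>n x. \<Sum>k<n. Z (Suc k) x - Z k x)"
  proof (rule Weierstrass_m_test')
    show "norm (Z (Suc n) x - Z n x) \<le> \<epsilon> / 2 * (1 / 2) ^ n" if "x \<in> ball 0 \<tau>" for n x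
      using that by (intro Zstep) auto
    show "summable (\<lambda>n. \<epsilon> / 2 * (1 / 2) ^ n)" by (intro summable_mult summable_geometric) auto
  qed
  then obtain s where "uniform_limit (ball 0 \<tau>) (\<lambda>n x. \<Sum>k<n. Z (Suc k) x - Z k x) s sequentially"
    by (auto simp: uniformly_convergent_on_def)
  then have "uniform_limit (ball 0 \<tau>) (\<lambda>n x. z0 + (\<Sum>k<n. Z (Suc k) x - Z k x)) (\<lambda>x. z0 + s x) sequentially"
    by (intro uniform_limit_intros)
  moreover have "z0 + (\<Sum>k<n. Z (Suc k) x - Z k x) = Z n x" for n x
    using sum_lessThan_telescope[of "\<lambda>k. Z k x" n] by (simp add: Z0)
  ultimately have unif: "uniform_limit (ball 0 \<tau>) Z (\<lambda>x. z0 + s x) sequentially" by simp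
  define z where "z x = z0 + s x" for x
  have lim: "(\<lambda>n. Z n x) \<longlonglongrightarrow> z x" if "norm x < \<tau>" for x
    using tendsto_uniform_limitI[OF unif, of x] that by (simp add: z_def)
  have zin: "z x \<in> cball z0 \<epsilon>" if x: "norm x < \<tau>" for x
    using closed_sequentially[OF closed_cball, of "\<lambda>n. Z n x"] Zin[OF x] lim[OF x] by blast
  have zhol: "z holomorphic_on ball 0 \<tau>"
  proof (rule holomorphic_uniform_sequence[OF open_ball Zhol])
    fix x :: complex assume x: "x \<in> ball 0 \<tau>"
    obtain d where "d > 0" "cball x d \<subseteq> ball 0 \<tau>" using open_contains_cball[of "ball (0::complex) \<tau>"] x by blast
    then show "\<exists>d>0. cball x d \<subseteq> ball 0 \<tau> \<and> uniform_limit (cball x d) Z z sequentially"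
      using uniform_limit_on_subset[OF unif] unfolding z_def[abs_def] by blast
  qed
  have zzero: "double_series \<alpha> x (z x) = 0" if x: "norm x < \<tau>" for x
  proof -
    have "(\<lambda>n. T x (Z n x)) \<longlonglongrightarrow> T x (z x)"
    proof (rule Lim_null[THEN iffD2], rule Lim_null_comparison)
      show "\<forall>\<^sub>F n in sequentially. norm (T x (Z n x) - T x (z x)) \<le> 1 / 2 * norm (Z n x - z x)"
        by (intro always_eventually allI contract[OF x Zin[OF x] zin[OF x]])
      have "(\<lambda>n. norm (Z n x - z x)) \<longlonglongrightarrow> 0"
        using tendsto_norm[OF Lim_null[THEN iffD1, OF lim[OF x]]] by simp
      then show "(\<lambda>n. 1 / 2 * norm (Z n x - z x)) \<longlonglongrightarrow> 0" using tendsto_mult_right_zero by blast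
    qed
    moreover have "(\<lambda>n. T x (Z n x)) \<longlonglongrightarrow> z x"
      using LIMSEQ_Suc[OF lim[OF x]] by (simp add: ZSuc)
    ultimately have "T x (z x) = z x" by (rule LIMSEQ_unique)
    then show ?thesis using b by (simp add: T_def)
  qed
  have z00: "z 0 = z0"
  proof -
    have "Z n 0 = z0" for n by (induction n) (auto simp: Z0 ZSuc T_def zero)
    then show ?thesis using lim[of 0] \<tau>(1) by (simp add: LIMSEQ_const_iff)
  qed
  have zreal: "z x \<in> \<real>" if real: "\<forall>ij. \<alpha> ij \<in> \<real>" "z0 \<in> \<real>" and x: "x \<in> \<real>" "norm x < \<tau>" for x
  proof -
    have "0 \<le> r / 2" "0 \<le> R1" using r R1' by auto
    have "b \<in> \<real>"
      unfolding b_def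
    proof (rule double_series_Reals[OF conv\<beta>])
      show "\<beta> ij \<in> \<real>" for ij using real by (cases ij) (auto simp: \<beta>_def taylor_coeffs_def)
    qed (use r R1 real in auto)
    have "Z n x \<in> \<real>" for n
    proof (induction n)
      case 0 then show ?case using real by (simp add: Z0)
    next
      case (Suc n)
      have "double_series \<alpha> x (Z n x) \<in> \<real>"
      proof (rule double_series_Reals[OF conv])
        show "norm x \<le> r" using x \<tau> r by simp
        show "norm (Z n x) \<le> R" using zR[OF Zin[OF x(2)], of n] R1 by simp
      qed (use real x Suc in auto)
      then show ?case using Suc \<open>b \<in> \<real>\<close> by (simp add: ZSuc T_def)
    qed
    then show ?thesis using closed_sequentially[OF closed_complex_Reals, of "\<lambda>n. Z n x"] lim[OF x(2)] by blast
  qed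
  show ?thesis
  proof (rule exI[of _ \<tau>], rule exI[of _ z], intro conjI allI impI ballI)
    show "\<tau> < r" using \<tau> r by simp
    show "norm (z x) \<le> R / 2" if "norm x < \<tau>" for x using zR[OF zin[OF that]] R1 by simp
    show "double_series \<alpha> x (z x) = 0" if "norm x < \<tau>" for x using that by (rule zzero)
    show "z x \<in> \<real>" if "\<forall>ij. \<alpha> ij \<in> \<real>" "z0 \<in> \<real>" "x \<in> \<real>" "norm x < \<tau>" for x
      using that by (rule zreal)
  qed (rule \<tau>(1) zhol z00)+
qed

section \<open>Weighted blow-up of a double series\<close>

text \<open>
  The coefficients of a(x, x^K z) in powers of x and z. The exponent (i, j) moves to (i + K j, j),
  so weights become powers of x.
\<close>
definition blow_up :: "nat \<Rightarrow> (nat \<times> nat \<Rightarrow> 'a::zero) \<Rightarrow> nat \<times> nat \<Rightarrow> 'a"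
  where "blow_up K a = (\<lambda>(p, j). if K * j \<le> p then a (p - K * j, j) else 0)"

lemma blow_up_has_sum_iff:
  fixes a :: "nat \<times> nat \<Rightarrow> 'a::{real_normed_field,banach}"
  shows "((\<lambda>(p, j). blow_up K a (p, j) * x ^ p * z ^ j) has_sum S) UNIV \<longleftrightarrow>
    ((\<lambda>(i, j). a (i, j) * x ^ i * (x ^ K * z) ^ j) has_sum S) UNIV"
proof -
  let ?\<phi> = "\<lambda>(i, j). (i + K * j, j) :: nat \<times> nat"
  have "((\<lambda>(p, j). blow_up K a (p, j) * x ^ p * z ^ j) has_sum S) UNIV \<longleftrightarrow>
     ((\<lambda>(p, j). blow_up K a (p, j) * x ^ p * z ^ j) has_sum S) (range ?\<phi>)"
  proof (rule has_sum_cong_neutral)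
    fix pj assume "pj \<in> UNIV - range ?\<phi>"
    moreover obtain p j where pj: "pj = (p, j)" by force
    moreover have "(p, j) \<in> range ?\<phi>" if "K * j \<le> p"
      by (rule image_eqI[of _ _ "(p - K * j, j)"]) (use that in auto)
    ultimately have "\<not> K * j \<le> p" by blast
    then show "(case pj of (p, j) \<Rightarrow> blow_up K a (p, j) * x ^ p * z ^ j) = 0" by (simp add: blow_up_def pj)
  qed auto
  also have "\<dots> \<longleftrightarrow> (((\<lambda>(p, j). blow_up K a (p, j) * x ^ p * z ^ j) \<circ> ?\<phi>) has_sum S) UNIV"
    by (rule has_sum_reindex) (auto simp: inj_on_def)
  also have "(\<lambda>(p, j). blow_up K a (p, j) * x ^ p * z ^ j) \<circ> ?\<phi> = (\<lambda>(i, j). a (i, j) * x ^ i * (x ^ K * z) ^ j)"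
  proof (rule ext)
    fix ij :: "nat \<times> nat"
    obtain i j where ij: "ij = (i, j)" by force
    have "x ^ (i + K * j) = x ^ i * (x ^ K) ^ j" by (simp only: power_add power_mult)
    then show "((\<lambda>(p, j). blow_up K a (p, j) * x ^ p * z ^ j) \<circ> ?\<phi>) ij = (case ij of (i, j) \<Rightarrow> a (i, j) * x ^ i * (x ^ K * z) ^ j)"
      by (simp add: ij blow_up_def power_mult_distrib mult.assoc)
  qed
  finally show ?thesis .
qed

lemma abs_conv_blow_up:
  fixes a :: "nat \<times> nat \<Rightarrow> 'a::{real_normed_field,banach}"
  assumes "abs_conv a r (r ^ K * R)"
  shows "abs_conv (blow_up K a) r R"
proof -
  have "((\<lambda>(i, j). norm (a (i, j)) * r ^ i * (r ^ K * R) ^ j) has_sum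
      (\<Sum>\<^sub>\<infinity>(i, j). norm (a (i, j)) * r ^ i * (r ^ K * R) ^ j)) UNIV"
    using assms unfolding abs_conv_def by (rule has_sum_infsum)
  then have "((\<lambda>(p, j). blow_up K (\<lambda>ij. norm (a ij)) (p, j) * r ^ p * R ^ j) has_sum
      (\<Sum>\<^sub>\<infinity>(i, j). norm (a (i, j)) * r ^ i * (r ^ K * R) ^ j)) UNIV"
    by (rule blow_up_has_sum_iff[THEN iffD2])
  moreover have "blow_up K (\<lambda>ij. norm (a ij)) = (\<lambda>ij. norm (blow_up K a ij))"
    by (auto simp: blow_up_def)
  ultimately show ?thesis unfolding abs_conv_def by (auto simp: summable_on_def)
qed

lemma double_series_blow_up:
  fixes a :: "nat \<times> nat \<Rightarrow> 'a::{real_normed_field,banach}"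
  assumes "abs_conv a \<rho> \<rho>" "norm x \<le> \<rho>" "norm (x ^ K * z) \<le> \<rho>"
  shows "double_series (blow_up K a) x z = double_series a x (x ^ K * z)"
  using blow_up_has_sum_iff[THEN iffD2, OF abs_conv_has_sum[OF assms]]
  unfolding double_series_def[of "blow_up K a"] by (rule infsumI)

text \<open>
  Division by x^n. After a blow-up with weights at least n this gives the strict transform.
\<close>
definition drop_x :: "nat \<Rightarrow> (nat \<times> nat \<Rightarrow> 'a) \<Rightarrow> nat \<times> nat \<Rightarrow> 'a"
  where "drop_x n h = (\<lambda>(p, j). h (p + n, j))"

lemma double_series_drop_x:
  fixes h :: "nat \<times> nat \<Rightarrow> 'a::{real_normed_field,banach}"
  assumes zero: "\<And>p j. p < n \<Longrightarrow> h (p, j) = 0"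
    and conv: "abs_conv (drop_x n h) r R" "norm x \<le> r" "norm z \<le> R"
  shows "double_series h x z = x ^ n * double_series (drop_x n h) x z"
proof -
  let ?\<phi> = "\<lambda>(p, j). (p + n, j) :: nat \<times> nat"
  have "((\<lambda>ij. x ^ n * (case ij of (i, j) \<Rightarrow> drop_x n h (i, j) * x ^ i * z ^ j)) has_sum
      x ^ n * double_series (drop_x n h) x z) UNIV"
    by (intro has_sum_cmult_right abs_conv_has_sum[OF conv])
  then have "(((\<lambda>(p, j). h (p, j) * x ^ p * z ^ j) \<circ> ?\<phi>) has_sum x ^ n * double_series (drop_x n h) x z) UNIV"
    by (simp add: o_def case_prod_unfold drop_x_def power_add mult_ac)
  then have "((\<lambda>(p, j). h (p, j) * x ^ p * z ^ j) has_sum x ^ n * double_series (drop_x n h) x z) (range ?\<phi>)"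
    by (subst has_sum_reindex) (auto simp: inj_on_def)
  then have "((\<lambda>(p, j). h (p, j) * x ^ p * z ^ j) has_sum x ^ n * double_series (drop_x n h) x z) UNIV"
  proof (rule has_sum_cong_neutral[THEN iffD1, rotated -1])
    fix pj assume "pj \<in> UNIV - range ?\<phi>"
    moreover obtain p j where pj: "pj = (p, j)" by force
    moreover have "(p, j) \<in> range ?\<phi>" if "n \<le> p"
      by (rule image_eqI[of _ _ "(p - n, j)"]) (use that in auto)
    ultimately have "\<not> n \<le> p" by blast
    then show "(case pj of (p, j) \<Rightarrow> h (p, j) * x ^ p * z ^ j) = 0" using zero by (simp add: pj)
  qed auto
  then show ?thesis unfolding double_series_def[of h] by (rule infsumI)
qed

lemma abs_conv_drop_x:
  fixes h :: "nat \<times> nat \<Rightarrow> 'a::{real_normed_field,banach}"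
  assumes "abs_conv h r R" "0 \<le> r'" "r' < r" "0 \<le> R'" "R' < R"
  shows "abs_conv (drop_x n h) r' R'"
proof -
  have rR: "0 < r" "0 < R" using assms by auto
  obtain M where M: "M \<ge> 0" "\<And>i j. norm (h (i, j)) * r ^ i * R ^ j \<le> M"
    using abs_conv_imp_bounded[OF assms(1)] rR by force
  show ?thesis
  proof (rule abs_conv_if_bounded[where r=r and R=R and M="M / r ^ n"])
    fix i j
    have "norm (drop_x n h (i, j)) * r ^ i * R ^ j = (norm (h (i + n, j)) * r ^ (i + n) * R ^ j) / r ^ n"
      using rR by (simp add: drop_x_def power_add)
    then show "norm (drop_x n h (i, j)) * r ^ i * R ^ j \<le> M / r ^ n"
      using M(2)[of "i + n" j] rR by (simp add: divide_right_mono)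
  qed (use assms in auto)
qed

definition raise_x :: "nat \<Rightarrow> (nat \<times> nat \<Rightarrow> 'a::zero) \<Rightarrow> nat \<times> nat \<Rightarrow> 'a"
  where "raise_x n g = (\<lambda>(p, j). if n \<le> p then g (p - n, j) else 0)"

lemma drop_raise_x [simp]: "drop_x n (raise_x n g) = g"
  by (auto simp: drop_x_def raise_x_def)

lemma abs_conv_raise_x:
  fixes g :: "nat \<times> nat \<Rightarrow> 'a::{real_normed_field,banach}"
  assumes "abs_conv g r R" "0 \<le> r'" "r' < r" "0 \<le> R'" "R' < R"
  shows "abs_conv (raise_x n g) r' R'"
proof -
  have rR: "0 < r" "0 < R" using assms by auto
  obtain M where M: "M \<ge> 0" "\<And>i j. norm (g (i, j)) * r ^ i * R ^ j \<le> M"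
    using abs_conv_imp_bounded[OF assms(1)] rR by force
  show ?thesis
  proof (rule abs_conv_if_bounded[where r=r and R=R and M="M * r ^ n"])
    fix i j
    show "norm (raise_x n g (i, j)) * r ^ i * R ^ j \<le> M * r ^ n"
    proof (cases "n \<le> i")
      case True
      then have "norm (raise_x n g (i, j)) * r ^ i * R ^ j = (norm (g (i - n, j)) * r ^ (i - n) * R ^ j) * r ^ n"
        by (simp add: raise_x_def power_add[symmetric] mult_ac)
      then show ?thesis using M(2)[of "i - n" j] rR by (simp add: mult_right_mono)
    qed (use M rR in \<open>simp add: raise_x_def\<close>)
  qed (use assms in auto)
qed

lemma infsum_mult_zero_power:
  fixes c :: "nat \<Rightarrow> 'a::{real_normed_field,banach}"
  shows "(\<Sum>\<^sub>\<infinity>j. c j * 0 ^ j) = c 0"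
proof -
  have "((\<lambda>j. c j * 0 ^ j) has_sum c 0) UNIV"
    by (rule has_sum_finite_neutralI[of "{0}"]) auto
  then show ?thesis by (rule infsumI)
qed

lemma double_series_snd_zero:
  fixes c :: "nat \<times> nat \<Rightarrow> 'a::{real_normed_field,banach}"
  assumes "abs_conv c r R" "0 < r" "0 \<le> R" "norm x \<le> r"
  shows "((\<lambda>i. c (i, 0) * x ^ i) has_sum double_series c x 0) UNIV"
  using double_series_iterated(1)[OF assms(1,4), of 0] assms by (simp add: infsum_mult_zero_power)

lemma double_series_zero_zero: "double_series c 0 0 = c (0, 0)"
proof -
  have "((\<lambda>(i, j). c (i, j) * 0 ^ i * 0 ^ j) has_sum c (0, 0)) UNIV"
    by (rule has_sum_finite_neutralI[of "{(0, 0)}"]) (auto simp: power_0_left split: if_splits)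
  then show ?thesis unfolding double_series_def by (rule infsumI)
qed

text \<open>
  The restriction of the strict transform to x = 0 is the edge polynomial.
\<close>
lemma exceptional_divisor_taylor:
  fixes a :: "nat \<times> nat \<Rightarrow> 'a::{real_normed_field,banach}"
  assumes "1 \<le> K"
  shows "double_series (taylor_coeffs s (drop_x n (blow_up K a))) 0 z = edge_taylor a (real K) (real n) 1 z s"
proof -
  let ?E = "edge a (real K) (real n)"
  let ?f = "\<lambda>(i, j). taylor_coeffs s (drop_x n (blow_up K a)) (i, j) * 0 ^ i * z ^ j"
  let ?E' = "{(i, j)\<in>?E. s \<le> j}"
  let ?\<psi> = "\<lambda>(i :: nat, j). (0 :: nat, j - s)"
  have fin: "finite ?E" by (rule finite_edge) (use assms in simp)
  have edge_iff: "(i, j) \<in> ?E \<longleftrightarrow> a (i, j) \<noteq> 0 \<and> i + K * j = n" for i j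
  proof -
    have "real i + real K * real j = real n \<longleftrightarrow> i + K * j = n"
      by (metis of_nat_add of_nat_eq_iff of_nat_mult)
    then show ?thesis by (simp add: edge_def)
  qed
  have inj: "inj_on ?\<psi> ?E'"
  proof (rule inj_onI, clarify)
    fix i j i' j' assume *: "(i, j) \<in> ?E" "s \<le> j" "(i', j') \<in> ?E" "s \<le> j'" "j - s = j' - s"
    then have "j = j'" by simp
    then show "i = i' \<and> j = j'" using * by (auto simp: edge_iff)
  qed
  have "(?f has_sum (\<Sum>ij\<in>?\<psi> ` ?E'. ?f ij)) UNIV"
  proof (rule has_sum_finite_neutralI)
    show "finite (?\<psi> ` ?E')" by (intro finite_imageI finite_subset[OF _ fin]) auto
    show "?f x = 0" if x: "x \<in> UNIV - ?\<psi> ` ?E'" for x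
    proof (rule ccontr)
      assume nz: "?f x \<noteq> 0"
      obtain i j where ij: "x = (i, j)" by force
      have i: "i = 0" using nz by (auto simp: ij power_0_left split: if_splits)
      then have "K * (j + s) \<le> n" "a (n - K * (j + s), j + s) \<noteq> 0"
        using nz by (auto simp: ij taylor_coeffs_def drop_x_def blow_up_def split: if_splits)
      then have "(n - K * (j + s), j + s) \<in> ?E'" by (simp add: edge_iff)
      then have "?\<psi> (n - K * (j + s), j + s) \<in> ?\<psi> ` ?E'" by (rule imageI)
      then show False using x by (simp add: ij i)
    qed
  qed auto
  then have "double_series (taylor_coeffs s (drop_x n (blow_up K a))) 0 z = (\<Sum>ij\<in>?\<psi> ` ?E'. ?f ij)"
    unfolding double_series_def by (rule infsumI)
  also have "\<dots> = (\<Sum>ij\<in>?E'. ?f (?\<psi> ij))" using inj by (simp add: sum.reindex)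
  also have "\<dots> = (\<Sum>(i, j)\<in>?E'. a (i, j) * 1 ^ i * of_nat (j choose s) * z ^ (j - s))"
  proof (rule sum.cong[OF refl])
    fix ij assume "ij \<in> ?E'"
    then obtain i j where ij: "ij = (i, j)" "i + K * j = n" "s \<le> j" by (auto simp: edge_iff)
    then have "K * j \<le> n" "n - K * j = i" by auto
    then show "?f (?\<psi> ij) = (case ij of (i, j) \<Rightarrow> a (i, j) * 1 ^ i * of_nat (j choose s) * z ^ (j - s))"
      using ij by (simp add: taylor_coeffs_def drop_x_def blow_up_def)
  qed
  also have "\<dots> = edge_taylor a (real K) (real n) 1 z s"
    unfolding edge_taylor_def by (rule sum.mono_neutral_left[OF fin]) (auto simp: binomial_eq_0)
  finally show ?thesis .
qed

section \<open>Straightening a root over the complex numbers\<close>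

text \<open>
  Let a' be the strict transform a(x, x^K w) / x^n. Its Taylor coefficient of order m - 1 in w
  vanishes at (0, z), with a nonzero derivative in w, so it vanishes along a curve Z through this
  point. For Q(x) = x^K Z(x) the strict transform of the sheared series b is a'(x, w + Z(x)), whose
  Taylor coefficients at w = 0 are those of a' along the curve.
\<close>
lemma straighten_complex:
  fixes a :: "nat \<times> nat \<Rightarrow> complex"
  assumes conv: "abs_conv a \<rho> \<rho>" "0 < \<rho>" and K: "1 \<le> K" and m: "1 \<le> m"
    and wt: "weight_ge a (real K) (real n)"
    and T0: "edge_taylor a (real K) (real n) 1 z (m - 1) = 0" and T1: "edge_taylor a (real K) (real n) 1 z m \<noteq> 0"
  shows "\<exists>Q b. shear_of Q a b \<and> weight_ge b (real K) (real n) \<and>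
      (\<forall>i j. i + K * j = n \<longrightarrow> b (i, j) = edge_taylor a (real K) (real n) 1 z j) \<and> (\<forall>i. b (i, m - 1) = 0) \<and>
      ((\<forall>ij. a ij \<in> \<real>) \<longrightarrow> z \<in> \<real> \<longrightarrow> (\<exists>\<tau>>0. \<forall>x\<in>\<real>. norm x < \<tau> \<longrightarrow> Q x \<in> \<real>))"
proof -
  (* Radii in the second variable: the curve satisfies norm (Z x) \<le> 3 L / 2 and norm w < L, so w
  + Z x stays below R / 2, and each differentiation or division by x costs part of the radius. *)
  define L where "L = norm z + 1"
  have L: "L \<ge> 1" "norm z < L" by (auto simp: L_def)
  define R where "R = 8 * L"
  define r0 where "r0 = Min {1, \<rho>, \<rho> / (2 * R)}"
  have r0: "0 < r0" "r0 \<le> 1" "r0 \<le> \<rho>" "r0 \<le> \<rho> / (2 * R)" using conv L by (auto simp: r0_def R_def)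
  have r0K: "r0 ^ K * (2 * R) \<le> \<rho>"
  proof -
    have "r0 ^ K \<le> r0 ^ 1" using r0 K by (intro power_decreasing) auto
    then have "r0 ^ K * (2 * R) \<le> \<rho> / (2 * R) * (2 * R)" using r0 L by (intro mult_right_mono) (auto simp: R_def)
    then show ?thesis using L by (simp add: R_def)
  qed
  define h where "h = blow_up K a"
  have convh: "abs_conv h r0 (2 * R)"
    unfolding h_def by (rule abs_conv_blow_up, rule abs_conv_mono[OF conv(1)]) (use r0 r0K L in \<open>auto simp: R_def\<close>)
  have h0: "h (p, j) = 0" if "p < n" for p j
  proof (rule ccontr)
    assume nz: "h (p, j) \<noteq> 0"
    then have kp: "K * j \<le> p" "a (p - K * j, j) \<noteq> 0" by (auto simp: h_def blow_up_def split: if_splits)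
    then have "real n \<le> real (p - K * j) + real K * real j" using wt unfolding weight_ge_def by blast
    also have "\<dots> = real p" using \<open>K * j \<le> p\<close> by (simp add: of_nat_diff)
    finally show False using that by simp
  qed
  define a' where "a' = drop_x n h"
  have a'_eq: "a' = drop_x n (blow_up K a)" by (simp add: a'_def h_def)
  have conva': "abs_conv a' (r0 / 2) R"
    unfolding a'_def by (rule abs_conv_drop_x[OF convh]) (use r0 L in \<open>auto simp: R_def\<close>)
  have fact_h: "double_series h x w = x ^ n * double_series a' x w" if "norm x \<le> r0 / 2" "norm w \<le> R" for x w
    unfolding a'_def by (rule double_series_drop_x[OF h0 conva'[unfolded a'_def] that])
  define \<alpha> where "\<alpha> = taylor_coeffs (m - 1) a'"
  have conv\<alpha>: "abs_conv \<alpha> (r0 / 4) (3 * L)"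
    unfolding \<alpha>_def by (rule abs_conv_taylor_coeffs[OF conva']) (use r0 L in \<open>auto simp: R_def\<close>)
  have z32: "norm z < 3 * L / 2" using L by simp
  have zero: "double_series \<alpha> 0 z = 0"
    unfolding \<alpha>_def a'_eq using exceptional_divisor_taylor[OF K] T0 by metis
  have nonzero: "double_series (taylor_coeffs 1 \<alpha>) 0 z \<noteq> 0"
  proof -
    have "taylor_coeffs 1 \<alpha> = (\<lambda>ij. of_nat m * taylor_coeffs m a' ij)"
      unfolding \<alpha>_def using taylor_coeffs_Suc[of "m - 1" a'] m by (auto simp: fun_eq_iff)
    then have "double_series (taylor_coeffs 1 \<alpha>) 0 z = of_nat m * double_series (taylor_coeffs m a') 0 z"
      by (simp only: double_series_cmult)
    also have "double_series (taylor_coeffs m a') 0 z = edge_taylor a (real K) (real n) 1 z m"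
      unfolding a'_eq by (rule exceptional_divisor_taylor[OF K])
    finally show ?thesis using T1 m by simp
  qed
  have r04: "0 < r0 / 4" using r0 by simp
  obtain \<tau> Z where \<tau>: "0 < \<tau>" "\<tau> < r0 / 4" and Z: "Z holomorphic_on ball 0 \<tau>" "Z 0 = z"
    and Zz: "\<And>x. norm x < \<tau> \<Longrightarrow> norm (Z x) \<le> 3 * L / 2 \<and> double_series \<alpha> x (Z x) = 0"
    and Zreal: "(\<forall>ij. \<alpha> ij \<in> \<real>) \<longrightarrow> z \<in> \<real> \<longrightarrow> (\<forall>x\<in>\<real>. norm x < \<tau> \<longrightarrow> Z x \<in> \<real>)"
    using implicit_zero[OF conv\<alpha> r04 z32 zero nonzero] by blast
  define Q where "Q x = x ^ K * Z x" for x
  have Qhol: "Q holomorphic_on ball 0 \<tau>" unfolding Q_def by (intro holomorphic_intros Z)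
  have Q0: "Q 0 = 0" using K by (simp add: Q_def)
  have "Q analytic_on {0}" unfolding analytic_at
    by (rule exI[of _ "ball 0 \<tau>"]) (use Qhol \<tau>(1) in auto)
  then have Qfps: "\<exists>F. Q has_fps_expansion F" using analytic_at_imp_has_fps_expansion_0 by blast

  obtain M where M: "\<And>x w. norm x \<le> r0 / 2 \<Longrightarrow> norm w \<le> R \<Longrightarrow> norm (double_series a' x w) \<le> M"
  proof -
    have "compact ((\<lambda>(x, y). double_series a' x y) ` (cball 0 (r0 / 2) \<times> cball 0 R))"
      by (intro compact_continuous_image continuous_on_double_series[OF conva'] compact_Times compact_cball)
    then obtain M where "\<And>y. y \<in> (\<lambda>(x, y). double_series a' x y) ` (cball 0 (r0 / 2) \<times> cball 0 R) \<Longrightarrow> norm y \<le> M"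
      using compact_imp_bounded bounded_iff by metis
    then show ?thesis using that by (force simp: image_iff)
  qed
  have wZ: "norm (w + Z x) \<le> R / 2" if "norm x < \<tau>" "norm w < L" for x w
    using Zz[OF that(1)] that(2) norm_triangle_ineq[of w "Z x"] L by (simp add: R_def)
  obtain g where g: "\<forall>r' R'. 0 \<le> r' \<longrightarrow> r' < \<tau> \<longrightarrow> 0 \<le> R' \<longrightarrow> R' < L \<longrightarrow>
     abs_conv g r' R' \<and> (\<forall>x w. norm x \<le> r' \<longrightarrow> norm w \<le> R' \<longrightarrow> double_series a' x (w + Z x) = double_series g x w)"
  proof -
    have "\<exists>g. \<forall>r' R'. 0 \<le> r' \<longrightarrow> r' < \<tau> \<longrightarrow> 0 \<le> R' \<longrightarrow> R' < L \<longrightarrow>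
     abs_conv g r' R' \<and> (\<forall>x w. norm x \<le> r' \<longrightarrow> norm w \<le> R' \<longrightarrow> (\<lambda>x w. double_series a' x (w + Z x)) x w = double_series g x w)"
    proof (rule separately_holomorphic_power_series[OF \<tau>(1), where M=M])
      show "0 < L" using L by simp
      show "norm (double_series a' x (w + Z x)) \<le> M" if "norm x < \<tau>" "norm w < L" for x w
        using that wZ[OF that] \<tau> L r0 by (intro M) (auto simp: R_def)
      show "(\<lambda>x. double_series a' x (w + Z x)) holomorphic_on ball 0 \<tau>" if w: "norm w < L" for w
      proof (rule holomorphic_on_double_series_comp[OF conva' open_ball])
        show "(\<lambda>t. w + Z t) holomorphic_on ball 0 \<tau>" by (intro holomorphic_intros Z)
        show "norm t \<le> r0 / 2" if "t \<in> ball 0 \<tau>" for t :: complex using that \<tau> r0 by simp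
        show "norm (w + Z t) \<le> R" if "t \<in> ball 0 \<tau>" for t using wZ[of t w] that w L by (simp add: R_def)
      qed auto
      show "(\<lambda>w. double_series a' x (w + Z x)) holomorphic_on ball 0 L" if x: "norm x < \<tau>" for x
      proof (rule holomorphic_on_double_series_comp[OF conva' open_ball])
        show "norm x \<le> r0 / 2" using x \<tau> r0 by simp
        show "norm (t + Z x) \<le> R" if "t \<in> ball 0 L" for t using wZ[of x t] that x L by (simp add: R_def)
      qed (auto intro!: holomorphic_intros)
    qed
    then show ?thesis using that by auto
  qed
  have "isCont Q 0"
    using Qhol \<tau>(1) by (auto intro: holomorphic_on_imp_continuous_on simp: continuous_on_eq_continuous_at dest!: holomorphic_on_imp_continuous_on)
  then obtain \<tau>Q where \<tau>Q: "\<tau>Q > 0" "\<And>x. dist x 0 < \<tau>Q \<Longrightarrow> dist (Q x) (Q 0) < \<rho> / 2"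
    using conv(2) unfolding continuous_at_eps_delta by (metis half_gt_zero)
  define \<tau>1 where "\<tau>1 = Min {\<tau>, \<tau>Q, \<rho> / 2}"
  have \<tau>1: "0 < \<tau>1" "\<tau>1 \<le> \<tau>" "\<tau>1 \<le> \<tau>Q" "\<tau>1 \<le> \<rho> / 2" using \<tau> \<tau>Q conv by (auto simp: \<tau>1_def)
  have yQ: "norm (y + Q x) \<le> \<rho>" if "norm x < \<tau>1" "norm y < \<tau>1" for x y
    using that \<tau>1 \<tau>Q(2)[of x] norm_triangle_ineq[of y "Q x"] by (simp add: Q0)
  obtain Mb where Mb: "\<And>x w. norm x \<le> \<rho> \<Longrightarrow> norm w \<le> \<rho> \<Longrightarrow> norm (double_series a x w) \<le> Mb"
  proof -
    have "compact ((\<lambda>(x, y). double_series a x y) ` (cball 0 \<rho> \<times> cball 0 \<rho>))"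
      by (intro compact_continuous_image continuous_on_double_series[OF conv(1)] compact_Times compact_cball)
    then obtain M where "\<And>y. y \<in> (\<lambda>(x, y). double_series a x y) ` (cball 0 \<rho> \<times> cball 0 \<rho>) \<Longrightarrow> norm y \<le> M"
      using compact_imp_bounded bounded_iff by metis
    then show ?thesis using that by (force simp: image_iff)
  qed
  obtain b where b: "\<forall>r' R'. 0 \<le> r' \<longrightarrow> r' < \<tau>1 \<longrightarrow> 0 \<le> R' \<longrightarrow> R' < \<tau>1 \<longrightarrow>
     abs_conv b r' R' \<and> (\<forall>x y. norm x \<le> r' \<longrightarrow> norm y \<le> R' \<longrightarrow> double_series a x (y + Q x) = double_series b x y)"
  proof -
    have "\<exists>b. \<forall>r' R'. 0 \<le> r' \<longrightarrow> r' < \<tau>1 \<longrightarrow> 0 \<le> R' \<longrightarrow> R' < \<tau>1 \<longrightarrow>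
     abs_conv b r' R' \<and> (\<forall>x y. norm x \<le> r' \<longrightarrow> norm y \<le> R' \<longrightarrow> (\<lambda>x y. double_series a x (y + Q x)) x y = double_series b x y)"
    proof (rule separately_holomorphic_power_series[OF \<tau>1(1) \<tau>1(1), where M=Mb])
      show "norm (double_series a x (y + Q x)) \<le> Mb" if "norm x < \<tau>1" "norm y < \<tau>1" for x y
        using that yQ[OF that] \<tau>1 by (intro Mb) auto
      show "(\<lambda>x. double_series a x (y + Q x)) holomorphic_on ball 0 \<tau>1" if y: "norm y < \<tau>1" for y
      proof (rule holomorphic_on_double_series_comp[OF conv(1) open_ball])
        have "Q holomorphic_on ball 0 \<tau>1" using Qhol by (rule holomorphic_on_subset) (use \<tau>1 in auto)
        then show "(\<lambda>t. y + Q t) holomorphic_on ball 0 \<tau>1" by (intro holomorphic_intros)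
        show "norm t \<le> \<rho>" if "t \<in> ball 0 \<tau>1" for t :: complex using that \<tau>1 conv by simp
        show "norm (y + Q t) \<le> \<rho>" if "t \<in> ball 0 \<tau>1" for t using yQ[of t y] that y by simp
      qed auto
      show "(\<lambda>y. double_series a x (y + Q x)) holomorphic_on ball 0 \<tau>1" if x: "norm x < \<tau>1" for x
      proof (rule holomorphic_on_double_series_comp[OF conv(1) open_ball])
        show "norm x \<le> \<rho>" using x \<tau>1 conv by simp
        show "norm (t + Q x) \<le> \<rho>" if "t \<in> ball 0 \<tau>1" for t using yQ[of x t] that x by simp
      qed (auto intro!: holomorphic_intros)
    qed
    then show ?thesis using that by auto
  qed
  define t where "t = Min {\<tau>1 / 2, L / 2, r0 / 2}"
  have t: "0 < t" "t \<le> \<tau>1 / 2" "t \<le> L / 2" "t \<le> r0 / 2" "t < \<tau>1" "t < L" "t < \<tau>"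
    using \<tau>1 L r0 by (auto simp: t_def min_def)
  have convb: "abs_conv b t t" and b_eq: "\<And>x y. norm x \<le> t \<Longrightarrow> norm y \<le> t \<Longrightarrow> double_series a x (y + Q x) = double_series b x y"
    using b[rule_format, of t t] t by auto
  have convg: "abs_conv g t t" and g_eq: "\<And>x w. norm x \<le> t \<Longrightarrow> norm w \<le> t \<Longrightarrow> double_series a' x (w + Z x) = double_series g x w"
    using g[rule_format, of t t] t by auto
  define u where "u = Min {t / 2, 1}"
  have u: "0 < u" "u \<le> t / 2" "u \<le> 1" "u < t" using t by (auto simp: u_def min_def)
  have uK: "u ^ K \<le> u" using power_decreasing[of 1 K u] K u by simp
  have convbu: "abs_conv (blow_up K b) u u"
  proof (rule abs_conv_blow_up, rule abs_conv_mono[OF convb])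
    have "u ^ K * u \<le> u * 1" using uK u by (intro mult_mono) auto
    also have "u * 1 \<le> t" using u by simp
    finally show "u ^ K * u \<le> t" .
  qed (use u in auto)
  have convgu: "abs_conv (raise_x n g) u u"
    by (rule abs_conv_raise_x[OF convg]) (use u in auto)
  (* The blow-up of b is x^n times the translated strict transform; hence b has weight at least n
  and its edge coefficients are read off from g at x = 0. *)
  have "blow_up K b = raise_x n g"
  proof (rule double_series_cong_coeffs[OF convbu convgu u(1) u(1)])
    show "\<forall>\<^sub>F (x, y) in nhds (0, 0). double_series (blow_up K b) x y = double_series (raise_x n g) x y"
      unfolding eventually_nhds_metric
    proof (intro exI[of _ u] conjI allI impI u(1))
      fix p :: "complex \<times> complex" assume p: "dist p (0, 0) < u"
      obtain x w where xw: "p = (x, w)" by force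
      have x: "norm x < u" and w: "norm w < u"
        using p norm_fst_le[of x w] norm_snd_le[of w x] by (auto simp: xw dist_norm)
      have xK: "norm (x ^ K * w) \<le> t"
      proof -
        have "norm (x ^ K * w) \<le> u ^ K * u" unfolding norm_mult norm_power using x w u by (intro mult_mono power_mono) auto
        also have "\<dots> \<le> u * 1" using uK u by (intro mult_mono) auto
        finally show ?thesis using u by simp
      qed
      have Zx: "norm (w + Z x) \<le> R / 2" using x w u t by (intro wZ) auto
      have xr0: "norm x \<le> r0 / 2" using x u t by linarith
      have "norm (x ^ K * (w + Z x)) \<le> r0 ^ K * (2 * R)"
        unfolding norm_mult norm_power using xr0 r0 Zx L by (intro mult_mono power_mono) (auto simp: R_def)
      then have xKr: "norm (x ^ K * (w + Z x)) \<le> \<rho>" using r0K by simp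
      have "double_series (blow_up K b) x w = double_series b x (x ^ K * w)"
        using x u xK by (intro double_series_blow_up[OF convb]) auto
      also have "\<dots> = double_series a x (x ^ K * w + Q x)" using x u xK by (intro b_eq[symmetric]) auto
      also have "\<dots> = double_series a x (x ^ K * (w + Z x))" by (simp add: Q_def algebra_simps)
      also have "\<dots> = double_series h x (w + Z x)"
        unfolding h_def using xr0 r0 by (intro double_series_blow_up[OF conv(1) _ xKr, symmetric]) auto
      also have "\<dots> = x ^ n * double_series a' x (w + Z x)" using xr0 Zx L by (intro fact_h) (auto simp: R_def)
      also have "double_series a' x (w + Z x) = double_series g x w" using x w u by (intro g_eq) auto
      also have "x ^ n * double_series g x w = double_series (raise_x n g) x w"
      proof -
        have "raise_x n g (p, j) = 0" if "p < n" for p j using that by (simp add: raise_x_def)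
        from double_series_drop_x[where h="raise_x n g" and n=n and r=t and R=t and x=x and z=w, OF this] show ?thesis
          using convg x w u by simp
      qed
      finally show "case p of (x, y) \<Rightarrow> double_series (blow_up K b) x y = double_series (raise_x n g) x y"
        by (simp add: xw)
    qed
  qed
  have b_g: "b (i, j) = (if n \<le> i + K * j then g (i + K * j - n, j) else 0)" for i j
  proof -
    have "b (i, j) = blow_up K b (i + K * j, j)" by (simp add: blow_up_def)
    also have "\<dots> = raise_x n g (i + K * j, j)" by (simp add: \<open>blow_up K b = raise_x n g\<close>)
    finally show ?thesis by (simp add: raise_x_def)
  qed
  have taylor_g: "double_series (taylor_coeffs s g) x 0 = double_series (taylor_coeffs s a') x (Z x)" if x: "norm x < t" for s x
  proof -
    let ?F = "\<lambda>w. double_series a' x (w + Z x)"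
    have "(deriv ^^ s) ?F 0 = fact s * double_series (taylor_coeffs s a') x (0 + Z x)"
    proof (rule higher_deriv_double_series[OF conva'])
      show "norm (Z x) + L \<le> R / 2" using Zz[of x] x t L by (simp add: R_def)
    qed (use x t L r0 \<tau> in \<open>auto simp: R_def\<close>)
    moreover have "(deriv ^^ s) ?F 0 = fact s * double_series (taylor_coeffs s g) x (0 + 0)"
    proof (rule higher_deriv_double_series[OF convg t(1) x])
      show "norm (0 :: complex) + t / 2 \<le> t / 2" by simp
      show "?F w = double_series g x (w + 0)" if "norm w < t / 2" for w using that x t by (simp add: g_eq)
    qed (use t in auto)
    ultimately show ?thesis by simp
  qed
  have g0: "g (0, s) = edge_taylor a (real K) (real n) 1 z s" for s
  proof -
    have "g (0, s) = double_series (taylor_coeffs s g) 0 0" by (simp add: double_series_zero_zero taylor_coeffs_def)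
    also have "\<dots> = double_series (taylor_coeffs s a') 0 z" using taylor_g[of 0 s] t by (simp add: Z)
    also have "\<dots> = edge_taylor a (real K) (real n) 1 z s" unfolding a'_eq by (rule exceptional_divisor_taylor[OF K])
    finally show ?thesis .
  qed
  have gm: "g (p, m - 1) = 0" for p
  proof -
    have cg: "abs_conv (taylor_coeffs (m - 1) g) (t / 2) (t / 4)"
      by (rule abs_conv_taylor_coeffs[OF convg]) (use t in auto)
    have "taylor_coeffs (m - 1) g (p, 0) = 0"
    proof (rule power_series_zero_coeffs[where c="\<lambda>p. taylor_coeffs (m - 1) g (p, 0)" and r="t / 2"])
      fix x :: complex assume x: "norm x < t / 2"
      have "double_series (taylor_coeffs (m - 1) g) x 0 = 0"
        using taylor_g[of x "m - 1"] Zz[of x] x t by (simp add: \<alpha>_def)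
      then show "((\<lambda>p. taylor_coeffs (m - 1) g (p, 0) * x ^ p) has_sum 0) UNIV"
        using double_series_snd_zero[OF cg, of x] x t by simp
    qed (use t in simp)
    then show ?thesis by (simp add: taylor_coeffs_def)
  qed
  have shear: "shear_of Q a b"
    unfolding shear_of_def
  proof (intro conjI Qfps Q0)
    show "convergent_coeffs a" "convergent_coeffs b" using conv convb t by (auto simp: convergent_coeffs_def)
    show "\<forall>\<^sub>F p in nhds (0, 0). double_series a (fst p) (snd p + Q (fst p)) = double_series b (fst p) (snd p)"
      unfolding eventually_nhds_metric
    proof (intro exI[of _ t] conjI allI impI t(1))
      fix p :: "complex \<times> complex" assume "dist p (0, 0) < t"
      then show "double_series a (fst p) (snd p + Q (fst p)) = double_series b (fst p) (snd p)"
        using norm_fst_le[of "fst p" "snd p"] norm_snd_le[of "snd p" "fst p"]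
        by (intro b_eq) (auto simp: dist_norm zero_prod_def[symmetric])
    qed
  qed
  have real: "\<exists>\<tau>>0. \<forall>x\<in>\<real>. norm x < \<tau> \<longrightarrow> Q x \<in> \<real>" if "\<forall>ij. a ij \<in> \<real>" "z \<in> \<real>"
  proof (intro exI[of _ \<tau>] conjI \<tau>(1) ballI impI)
    fix x :: complex assume x: "x \<in> \<real>" "norm x < \<tau>"
    have "\<forall>ij. \<alpha> ij \<in> \<real>" using that(1) by (auto simp: \<alpha>_def a'_eq taylor_coeffs_def drop_x_def blow_up_def)
    then show "Q x \<in> \<real>" using Zreal that(2) x by (simp add: Q_def)
  qed
  have "weight_ge b (real K) (real n)"
    unfolding weight_ge_def
  proof (intro allI impI)
    fix i j assume "b (i, j) \<noteq> 0"
    then have "n \<le> i + K * j" by (auto simp: b_g split: if_splits)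
    then have "real n \<le> real (i + K * j)" by (simp only: of_nat_le_iff)
    then show "real n \<le> real i + real K * real j" by simp
  qed
  moreover have "\<forall>i j. i + K * j = n \<longrightarrow> b (i, j) = edge_taylor a (real K) (real n) 1 z j"
    by (auto simp: b_g g0)
  moreover have "\<forall>i. b (i, m - 1) = 0" by (simp add: b_g gm[unfolded One_nat_def])
  ultimately show ?thesis using shear real by blast
qed

lemma straightenable_complex:
  fixes a :: "nat \<times> nat \<Rightarrow> complex"
  assumes "convergent_coeffs a" shows "straightenable a"
proof -
  obtain \<rho> where \<rho>: "0 < \<rho>" "abs_conv a \<rho> \<rho>" using assms by (auto simp: convergent_coeffs_def)
  show ?thesis
    unfolding straightenable_def
  proof (intro allI impI)
    fix K n m :: nat and z :: complex
    assume "1 \<le> K" "1 \<le> m" "weight_ge a (real K) (real n)"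
      "edge_taylor a (real K) (real n) 1 z (m - 1) = 0" "edge_taylor a (real K) (real n) 1 z m \<noteq> 0"
    from straighten_complex[OF \<rho>(2,1) this]
    show "\<exists>Q b. shear_of Q a b \<and> weight_ge b (real K) (real n) \<and>
      (\<forall>i j. i + K * j = n \<longrightarrow> b (i, j) = edge_taylor a (real K) (real n) 1 z j) \<and> (\<forall>i. b (i, m - 1) = 0)"
      by blast
  qed
qed

section \<open>Straightening a root over the real numbers\<close>

text \<open>
  The real and imaginary parts of the coefficients are separated by evaluating at real points.
\<close>
lemma has_fps_expansion_Re:
  fixes Q :: "complex \<Rightarrow> complex"
  assumes "Q has_fps_expansion F"
  shows "(\<lambda>x. Re (Q (complex_of_real x))) has_fps_expansion Abs_fps (\<lambda>n. Re (fps_nth F n))"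
proof (rule has_fps_expansionI)
  have pos: "0 < fps_conv_radius F" and ev: "\<forall>\<^sub>F z in nhds 0. eval_fps F z = Q z"
    using assms by (auto simp: has_fps_expansion_def)
  have "\<forall>\<^sub>F z in nhds 0. z \<in> eball (0::complex) (fps_conv_radius F)"
    using pos by (intro eventually_nhds_in_open) (auto simp: zero_ereal_def)
  with ev have "\<forall>\<^sub>F z in nhds 0. (\<lambda>n. fps_nth F n * z ^ n) sums Q z"
  proof eventually_elim
    case (elim z)
    then show ?case using sums_eval_fps[of z F] by simp
  qed
  moreover have "filterlim complex_of_real (nhds 0) (nhds 0)"
    using tendsto_of_real[OF tendsto_ident_at, of "0::real"] filterlim_ident[of "nhds (0::real)"]
      tendsto_of_real[of "\<lambda>x. x" 0 "nhds 0"] by simp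
  ultimately have "\<forall>\<^sub>F x in nhds 0. (\<lambda>n. fps_nth F n * complex_of_real x ^ n) sums Q (complex_of_real x)"
    by (rule eventually_compose_filterlim)
  then show "\<forall>\<^sub>F u in nhds 0. (\<lambda>n. fps_nth (Abs_fps (\<lambda>n. Re (fps_nth F n))) n * u ^ n) sums Re (Q (complex_of_real u))"
  proof eventually_elim
    case (elim u)
    from sums_Re[OF this] show ?case by (simp flip: of_real_power)
  qed
qed

lemma double_series_of_real:
  fixes a :: "nat \<times> nat \<Rightarrow> real"
  assumes "abs_conv a r R" "norm x \<le> r" "norm y \<le> R"
  shows "double_series (\<lambda>ij. complex_of_real (a ij)) (of_real x) (of_real y) = of_real (double_series a x y)"
proof -
  have "((\<lambda>ij. complex_of_real (case ij of (i, j) \<Rightarrow> a (i, j) * x ^ i * y ^ j)) has_sum of_real (double_series a x y)) UNIV"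
    using abs_conv_has_sum[OF assms] by (rule has_sum_of_real)
  then show ?thesis
    unfolding double_series_def[of "\<lambda>ij. complex_of_real (a ij)"] by (intro infsumI) (simp add: case_prod_unfold)
qed

lemma abs_conv_of_real: "abs_conv (\<lambda>ij. complex_of_real (a ij)) r R \<longleftrightarrow> abs_conv a r R"
  by (simp add: abs_conv_def)

lemma abs_conv_le:
  assumes "abs_conv a r R" "\<And>ij. norm (b ij) \<le> norm (a ij)" "0 \<le> r" "0 \<le> R"
  shows "abs_conv b r R"
  using assms(1) unfolding abs_conv_def
  by (rule summable_on_comparison_test) (use assms in \<open>auto simp: case_prod_unfold intro!: mult_right_mono\<close>)

lemma edge_of_real: "edge (\<lambda>ij. complex_of_real (a ij)) k N = edge a k N"
  by (simp add: edge_def)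

lemma edge_taylor_of_real:
  "edge_taylor (\<lambda>ij. complex_of_real (a ij)) k N 1 (of_real z) s = of_real (edge_taylor a k N 1 z s)"
  by (simp add: edge_taylor_def edge_of_real case_prod_unfold)

text \<open>
  The complex shear of the complexified series is real at real points. So the imaginary parts of the
  new coefficients sum to zero on a real neighbourhood and vanish by uniqueness of coefficients.
\<close>
lemma straightenable_real:
  fixes a :: "nat \<times> nat \<Rightarrow> real"
  assumes "convergent_coeffs a" shows "straightenable a"
proof -
  obtain \<rho> where \<rho>: "0 < \<rho>" "abs_conv a \<rho> \<rho>" using assms by (auto simp: convergent_coeffs_def)
  define ac where "ac ij = complex_of_real (a ij)" for ij
  have convac: "abs_conv ac \<rho> \<rho>" using \<rho> by (simp add: ac_def[abs_def] abs_conv_of_real)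
  have ac_real: "\<forall>ij. ac ij \<in> \<real>" by (simp add: ac_def)
  show ?thesis
    unfolding straightenable_def
  proof (intro allI impI)
    fix K n m :: nat and z :: real
    assume K: "1 \<le> K" "1 \<le> m" and wt: "weight_ge a (real K) (real n)"
      and T: "edge_taylor a (real K) (real n) 1 z (m - 1) = 0" "edge_taylor a (real K) (real n) 1 z m \<noteq> 0"
    have Tc: "edge_taylor ac (real K) (real n) 1 (of_real z) s = of_real (edge_taylor a (real K) (real n) 1 z s)" for s
      unfolding ac_def[abs_def] by (rule edge_taylor_of_real)
    have wtc: "weight_ge ac (real K) (real n)" using wt by (simp add: weight_ge_def ac_def)
    have "edge_taylor ac (real K) (real n) 1 (of_real z) (m - 1) = 0"
      "edge_taylor ac (real K) (real n) 1 (of_real z) m \<noteq> 0"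
      using T by (simp_all add: Tc)
    from straighten_complex[OF convac \<rho>(1) K wtc this]
    obtain Q b where sh: "shear_of Q ac b" and wtb: "weight_ge b (real K) (real n)"
      and edge_b: "\<forall>i j. i + K * j = n \<longrightarrow> b (i, j) = edge_taylor ac (real K) (real n) 1 (of_real z) j"
      and bm: "\<forall>i. b (i, m - 1) = 0"
      and re: "\<exists>\<tau>>0. \<forall>x\<in>\<real>. norm x < \<tau> \<longrightarrow> Q x \<in> \<real>"
      using ac_real by auto
    obtain F where F: "Q has_fps_expansion F" and Q0: "Q 0 = 0" using sh by (auto simp: shear_of_def)
    obtain \<rho>b where \<rho>b: "0 < \<rho>b" "abs_conv b \<rho>b \<rho>b" using sh by (auto simp: shear_of_def convergent_coeffs_def)
    obtain \<tau> where \<tau>: "\<tau> > 0" "\<And>x. x \<in> \<real> \<Longrightarrow> norm x < \<tau> \<Longrightarrow> Q x \<in> \<real>" using re by blast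
    have cQ: "\<forall>e>0. \<exists>d>0. \<forall>x. dist x 0 < d \<longrightarrow> dist (Q x) (Q 0) < e"
      using fps_expansion_isCont[OF F] by (simp add: continuous_at_eps_delta)
    have "0 < \<rho> / 2" using \<rho> by simp
    from cQ[rule_format, OF this] obtain d where d: "d > 0" "\<And>x. norm x < d \<Longrightarrow> norm (Q x) < \<rho> / 2"
      by (auto simp: Q0)
    obtain e where e: "e > 0" "\<And>p. dist p (0, 0) < e \<Longrightarrow>
      double_series ac (fst p) (snd p + Q (fst p)) = double_series b (fst p) (snd p)"
      using sh unfolding shear_of_def eventually_nhds_metric by blast
    define t where "t = Min {\<rho> / 2, \<rho>b, \<tau>, d, e / 2}"
    have t: "0 < t" "t \<le> \<rho> / 2" "t \<le> \<rho>b" "t \<le> \<tau>" "t \<le> d" "t \<le> e / 2"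
      using \<rho> \<rho>b \<tau> d e by (auto simp: t_def)
    define Qr where "Qr x = Re (Q (of_real x))" for x
    have Qr: "Q (of_real x) = of_real (Qr x)" if "norm x < t" for x
      using \<tau>(2)[of "of_real x"] that t by (auto simp: Qr_def elim!: Reals_cases)
    have yQ: "norm (y + Qr x) \<le> \<rho>" if "norm x < t" "norm y < t" for x y
    proof -
      have "norm (Q (of_real x)) < \<rho> / 2" using that t by (intro d(2)) auto
      then have "norm (Qr x) < \<rho> / 2" using Qr[OF that(1)] by simp
      then show ?thesis using that t norm_triangle_ineq[of y "Qr x"] by simp
    qed
    have eq: "double_series b (of_real x) (of_real y) = of_real (double_series a x (y + Qr x))"
      if xy: "norm x < t" "norm y < t" for x y
    proof -
      have "dist (complex_of_real x, complex_of_real y) (0, 0) < e"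
        using xy t norm_Pair_le[of "complex_of_real x" "complex_of_real y"] by (simp add: dist_norm)
      from e(2)[OF this] have "double_series b (of_real x) (of_real y) = double_series ac (of_real x) (of_real (y + Qr x))"
        using Qr[OF xy(1)] by simp
      also have "\<dots> = of_real (double_series a x (y + Qr x))"
        unfolding ac_def[abs_def] using xy t yQ[OF xy] by (intro double_series_of_real[OF \<rho>(2)]) auto
      finally show ?thesis .
    qed
    define bi where "bi ij = Im (b ij)" for ij
    define br where "br ij = Re (b ij)" for ij
    have conv_br: "abs_conv br \<rho>b \<rho>b" and conv_bi: "abs_conv bi \<rho>b \<rho>b"
      using \<rho>b by (auto intro!: abs_conv_le[OF \<rho>b(2)] simp: br_def bi_def abs_Re_le_cmod abs_Im_le_cmod)
    have "bi ij = 0" for ij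
    proof (rule double_series_eq_0D[of bi t t])
      show "abs_conv bi t t" using conv_bi by (rule abs_conv_mono) (use t in auto)
      fix x y :: real assume xy: "norm x < t" "norm y < t"
      have "((\<lambda>ij. Im (case ij of (i, j) \<Rightarrow> b (i, j) * of_real x ^ i * of_real y ^ j)) has_sum
          Im (double_series b (of_real x) (of_real y))) UNIV"
        using xy t by (intro has_sum_Im abs_conv_has_sum[OF \<rho>b(2)]) auto
      then have "((\<lambda>(i, j). bi (i, j) * x ^ i * y ^ j) has_sum 0) UNIV"
        using eq[OF xy] by (simp add: bi_def case_prod_unfold flip: of_real_power)
      then show "double_series bi x y = 0" unfolding double_series_def by (rule infsumI)
    qed (use t in auto)
    then have b_br: "b = (\<lambda>ij. complex_of_real (br ij))"
      by (auto simp: fun_eq_iff bi_def br_def complex_eq_iff)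
    have b_br': "b ij = complex_of_real (br ij)" for ij by (simp add: b_br)
    have "shear_of Qr a br"
      unfolding shear_of_def
    proof (intro conjI)
      show "\<exists>F. Qr has_fps_expansion F" using has_fps_expansion_Re[OF F] unfolding Qr_def[abs_def] by blast
      show "Qr 0 = 0" by (simp add: Qr_def Q0)
      show "convergent_coeffs a" "convergent_coeffs br" using assms conv_br \<rho>b by (auto simp: convergent_coeffs_def)
      show "\<forall>\<^sub>F p in nhds (0, 0). double_series a (fst p) (snd p + Qr (fst p)) = double_series br (fst p) (snd p)"
        unfolding eventually_nhds_metric
      proof (intro exI[of _ t] conjI allI impI t(1))
        fix p :: "real \<times> real" assume "dist p (0, 0) < t"
        then have xy: "norm (fst p) < t" "norm (snd p) < t"
          using norm_fst_le[of "fst p" "snd p"] norm_snd_le[of "snd p" "fst p"] by (auto simp: dist_norm zero_prod_def[symmetric])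
        have "complex_of_real (double_series br (fst p) (snd p)) = double_series b (of_real (fst p)) (of_real (snd p))"
          unfolding b_br using xy t by (intro double_series_of_real[OF conv_br, symmetric]) auto
        also have "\<dots> = of_real (double_series a (fst p) (snd p + Qr (fst p)))" by (rule eq[OF xy])
        finally show "double_series a (fst p) (snd p + Qr (fst p)) = double_series br (fst p) (snd p)"
          by (simp only: of_real_eq_iff)
      qed
    qed
    moreover have "weight_ge br (real K) (real n)" using wtb by (simp add: weight_ge_def b_br')
    moreover have "\<forall>i j. i + K * j = n \<longrightarrow> br (i, j) = edge_taylor a (real K) (real n) 1 z j"
      using edge_b by (simp add: b_br' Tc)
    moreover have "\<forall>i. br (i, m - 1) = 0" using bm by (simp add: b_br')
    ultimately show "\<exists>Q b. shear_of Q a b \<and> weight_ge b (real K) (real n) \<and>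
      (\<forall>i j. i + K * j = n \<longrightarrow> b (i, j) = edge_taylor a (real K) (real n) 1 z j) \<and> (\<forall>i. b (i, m - 1) = 0)"
      by blast
  qed
qed

section \<open>The critical index in adapted coordinates\<close>

lemma has_power_series2_eventually_iff:
  fixes f :: "'a::{real_normed_field,banach} \<times> 'a \<Rightarrow> 'a"
  shows "has_power_series2 f a 0 \<longleftrightarrow> convergent_coeffs a \<and>
    (\<forall>\<^sub>F p in nhds (0, 0). f p = double_series a (fst p) (snd p))"
proof
  assume "has_power_series2 f a 0"
  then obtain r where r: "r > 0" "abs_conv a r r" "\<And>x y. norm x < r \<Longrightarrow> norm y < r \<Longrightarrow> f (x, y) = double_series a x y"
    by (auto simp: has_power_series2_iff)
  have "\<forall>\<^sub>F p in nhds (0, 0). f p = double_series a (fst p) (snd p)"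
    unfolding eventually_nhds_metric
  proof (intro exI[of _ r] conjI allI impI r(1))
    fix p :: "'a \<times> 'a" assume "dist p (0, 0) < r"
    then have "norm (fst p) < r" "norm (snd p) < r"
      using norm_fst_le[of "fst p" "snd p"] norm_snd_le[of "snd p" "fst p"] by (auto simp: dist_norm zero_prod_def[symmetric])
    then show "f p = double_series a (fst p) (snd p)" using r(3)[of "fst p" "snd p"] by simp
  qed
  with r show "convergent_coeffs a \<and> (\<forall>\<^sub>F p in nhds (0, 0). f p = double_series a (fst p) (snd p))"
    by (auto simp: convergent_coeffs_def)
next
  assume "convergent_coeffs a \<and> (\<forall>\<^sub>F p in nhds (0, 0). f p = double_series a (fst p) (snd p))"
  then obtain \<rho> e where \<rho>: "\<rho> > 0" "abs_conv a \<rho> \<rho>"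
    and e: "e > 0" "\<And>p. dist p (0, 0) < e \<Longrightarrow> f p = double_series a (fst p) (snd p)"
    unfolding convergent_coeffs_def eventually_nhds_metric by blast
  define r where "r = min \<rho> (e / 2)"
  have r: "r > 0" "r \<le> \<rho>" "r \<le> e / 2" using \<rho> e by (auto simp: r_def)
  show "has_power_series2 f a 0"
    unfolding has_power_series2_iff
  proof (intro exI[of _ r] conjI allI impI r(1))
    show "abs_conv a r r" using \<rho>(2) by (rule abs_conv_mono) (use r in auto)
    fix x y :: 'a assume "norm x < r" "norm y < r"
    then have "dist (x, y) (0, 0) < e" using r norm_Pair_le[of x y] by (simp add: dist_norm)
    from e(2)[OF this] show "f (x, y) = double_series a x y" by simp
  qed
qed

lemma has_power_series2_continuous:
  fixes f :: "'a::{real_normed_field,banach} \<times> 'a \<Rightarrow> 'a"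
  assumes "has_power_series2 f a 0"
  obtains \<rho> where "0 < \<rho>" "continuous_on (ball 0 \<rho>) f"
proof -
  obtain r where r: "r > 0" "abs_conv a r r" "\<And>x y. norm x < r \<Longrightarrow> norm y < r \<Longrightarrow> f (x, y) = double_series a x y"
    using assms by (auto simp: has_power_series2_iff)
  have sub: "norm (fst p) < r \<and> norm (snd p) < r" if "p \<in> ball 0 r" for p :: "'a \<times> 'a"
    using that norm_fst_le[of "fst p" "snd p"] norm_snd_le[of "snd p" "fst p"] by auto
  have "continuous_on (ball 0 r) (\<lambda>(x, y). double_series a x y)"
  proof (rule continuous_on_subset[OF continuous_on_double_series[OF r(2)]])
    show "ball 0 r \<subseteq> cball (0::'a) r \<times> cball (0::'a) r" using sub by (force simp: mem_Times_iff)
  qed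
  moreover have "(case p of (x, y) \<Rightarrow> double_series a x y) = f p" if "p \<in> ball 0 r" for p
    using sub[OF that] r(3)[of "fst p" "snd p"] by (cases p) auto
  ultimately have "continuous_on (ball 0 r) f" by (rule continuous_on_eq)
  then show ?thesis using that r(1) by blast
qed

lemma shear_of_nonzero:
  assumes "shear_of Q a b" "a ij \<noteq> 0"
  shows "\<exists>ij. b ij \<noteq> 0"
proof (rule ccontr)
  assume "\<not> (\<exists>ij. b ij \<noteq> 0)"
  then have b0: "double_series b x y = 0" for x y by (simp add: double_series_def case_prod_unfold)
  obtain F where F: "Q has_fps_expansion F" and Q0: "Q 0 = 0" using assms by (auto simp: shear_of_def)
  have "\<forall>\<^sub>F p in nhds (0, 0). double_series a (fst p) (snd p + Q (fst p)) = 0"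
    using assms(1) by (simp add: shear_of_def b0)
  from eventually_compose_filterlim[OF this tendsto_shear[of "\<lambda>x. - Q x"]]
  have "\<forall>\<^sub>F p in nhds (0, 0). double_series a (fst p) (snd p) = 0"
    using fps_expansion_isCont[OF F] Q0 by (simp add: continuous_minus)
  then have ev: "\<forall>\<^sub>F (x, y) in nhds (0, 0). double_series a x y = double_series (\<lambda>_. 0) x y"
    by (simp add: case_prod_unfold double_series_def)
  obtain \<rho> where "\<rho> > 0" "abs_conv a \<rho> \<rho>" using assms by (auto simp: shear_of_def convergent_coeffs_def)
  moreover have "abs_conv (\<lambda>_. 0 :: 'a) \<rho> \<rho>" by (simp add: abs_conv_def case_prod_unfold)
  ultimately have "a = (\<lambda>_. 0)" using double_series_cong_coeffs ev by blast
  then show False using assms(2) by simp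
qed

lemma shear_of_origin:
  assumes "shear_of Q a b" shows "b (0, 0) = a (0, 0)"
proof -
  have "\<forall>\<^sub>F p in nhds (0, 0). double_series a (fst p) (snd p + Q (fst p)) = double_series b (fst p) (snd p)"
    and "Q 0 = 0" using assms by (auto simp: shear_of_def)
  from eventually_nhds_x_imp_x[OF this(1)] this(2) show ?thesis by (simp add: double_series_zero_zero)
qed

text \<open>
  The shear in shear_of is a germ, given by a function that may be arbitrary away from the origin.
  Cutting it off outside a disc on which its series converges gives a Borel function P, so that the
  shear by P is a measure preserving map of the whole plane.
\<close>
lemma critical_index_adapted:
  fixes f :: "'a::{real_normed_field,euclidean_space} \<times> 'a \<Rightarrow> 'a"
  assumes f: "has_power_series2 f a 0" and nz: "a ij \<noteq> 0" and a0: "a (0, 0) = 0"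
    and sh: "shear_of Q a b" and ad: "adapted b"
  obtains P F where "P has_fps_expansion F" "P 0 = 0"
    "has_power_series2 (\<lambda>(x, y). f (x, y + P x)) b 0"
    "critical_integrability_index f = ereal (real DIM('a) * inverse (diagonal_exit b))"
proof -
  obtain F where F: "Q has_fps_expansion F" and Q0: "Q 0 = 0" using sh by (auto simp: shear_of_def)
  obtain r where r: "r > 0" "ereal r < fps_conv_radius F" "\<And>x. norm x < r \<Longrightarrow> eval_fps F x = Q x"
  proof -
    have "\<forall>\<^sub>F x in nhds 0. eval_fps F x = Q x" "0 < fps_conv_radius F" using F by (auto simp: has_fps_expansion_def)
    then obtain e where e: "e > 0" "\<And>x. dist x 0 < e \<Longrightarrow> eval_fps F x = Q x" unfolding eventually_nhds_metric by blast
    obtain r' where r': "ereal 0 < ereal r'" "ereal r' < fps_conv_radius F"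
      using ereal_dense2[of 0 "fps_conv_radius F"] \<open>0 < fps_conv_radius F\<close> by (auto simp: zero_ereal_def)
    show ?thesis
    proof (rule that[of "min e r'"])
      show "ereal (min e r') < fps_conv_radius F" using r'(2) by (rule le_less_trans[rotated]) auto
    qed (use e r' in auto)
  qed
  define P where "P x = (if norm x < r then Q x else 0)" for x
  have P0: "P 0 = 0" using Q0 by (simp add: P_def)
  have evP: "\<forall>\<^sub>F x in nhds 0. P x = Q x"
    unfolding eventually_nhds_metric using r(1) by (intro exI[of _ r]) (auto simp: P_def)
  have "\<forall>\<^sub>F x in nhds 0. eval_fps F x = P x"
    using evP F unfolding has_fps_expansion_def by (auto elim: eventually_elim2)
  then have PF: "P has_fps_expansion F" using F by (auto simp: has_fps_expansion_def)
  have contP: "isCont P 0" by (rule fps_expansion_isCont[OF PF])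
  have "continuous_on (ball 0 r) Q"
  proof -
    have "continuous_on (ball 0 r) (eval_fps F)"
    proof (rule continuous_on_subset[OF continuous_on_eval_fps])
      show "ball (0 :: 'a) r \<subseteq> eball 0 (fps_conv_radius F)"
      proof
        fix x :: 'a assume "x \<in> ball 0 r"
        then have "ereal (dist 0 x) < ereal r" by simp
        then show "x \<in> eball 0 (fps_conv_radius F)" unfolding in_eball_iff using r(2) by (rule less_trans)
      qed
    qed
    then show ?thesis by (rule continuous_on_eq) (use r(3) in simp)
  qed
  then have "(\<lambda>x. indicator (ball 0 r) x *\<^sub>R Q x) \<in> borel_measurable borel"
    by (intro borel_measurable_continuous_on_indicator) auto
  moreover have "(\<lambda>x. indicator (ball 0 r) x *\<^sub>R Q x) = P"
    by (auto simp: P_def indicator_def)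
  ultimately have Pmeas: "P \<in> borel_measurable borel" by simp
  let ?g = "\<lambda>(x, y). f (x, y + P x)"
  have evf: "\<forall>\<^sub>F p in nhds (0, 0). f p = double_series a (fst p) (snd p)"
    using f by (simp add: has_power_series2_eventually_iff)
  from eventually_compose_filterlim[OF this tendsto_shear[OF contP P0]]
  have 1: "\<forall>\<^sub>F p in nhds (0, 0). f (fst p, snd p + P (fst p)) = double_series a (fst p) (snd p + P (fst p))"
    by simp
  have "filterlim fst (nhds 0) (nhds (0 :: 'a, 0 :: 'a))"
    using tendsto_fst[OF filterlim_ident[of "nhds (0 :: 'a, 0 :: 'a)"]] by simp
  from eventually_compose_filterlim[OF evP this]
  have 2: "\<forall>\<^sub>F p in nhds (0, 0 :: 'a). P (fst p) = Q (fst p)" .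
  have 3: "\<forall>\<^sub>F p in nhds (0, 0). double_series a (fst p) (snd p + Q (fst p)) = double_series b (fst p) (snd p)"
    using sh by (simp add: shear_of_def)
  have evg: "\<forall>\<^sub>F p in nhds (0, 0). ?g p = double_series b (fst p) (snd p)"
    using 1 2 3 by eventually_elim (simp add: case_prod_unfold)
  have g: "has_power_series2 ?g b 0"
    unfolding has_power_series2_eventually_iff using sh evg by (simp add: shear_of_def)
  obtain \<rho> where \<rho>: "0 < \<rho>" "continuous_on (ball 0 \<rho>) f" by (rule has_power_series2_continuous[OF f])
  obtain \<rho>' where \<rho>': "0 < \<rho>'" "continuous_on (ball 0 \<rho>') ?g" by (rule has_power_series2_continuous[OF g])
  have fg: "neg_integrable f c \<longleftrightarrow> neg_integrable ?g c" for c
    by (rule neg_integrable_shear_iff[OF Pmeas contP P0 \<rho>(2,1) \<rho>'(2,1), symmetric])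
  have evg': "\<forall>\<^sub>F p in nhds 0. ?g p = (case p of (x, y) \<Rightarrow> double_series b x y)"
    using evg by (simp add: case_prod_unfold zero_prod_def)
  then have evg'': "\<forall>\<^sub>F p in nhds 0. (case p of (x, y) \<Rightarrow> double_series b x y) = ?g p"
    by (auto elim: eventually_mono)
  have gb: "neg_integrable ?g c \<longleftrightarrow> neg_integrable (\<lambda>(x, y). double_series b x y) c" for c
    using neg_integrable_cong[OF evg'] neg_integrable_cong[OF evg''] by blast
  obtain ij' where nzb: "b ij' \<noteq> 0" using shear_of_nonzero[OF sh nz] by blast
  have b0: "b (0, 0) = 0" using shear_of_origin[OF sh] a0 by simp
  have d: "0 < diagonal_exit b" using diagonal_exit_pos[where a=b, OF nzb b0] .
  obtain \<rho>b where \<rho>b: "0 < \<rho>b" "abs_conv b \<rho>b \<rho>b" using sh by (auto simp: shear_of_def convergent_coeffs_def)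
  have "critical_integrability_index f = ereal (real DIM('a) * inverse (diagonal_exit b))"
  proof (rule critical_index_eqI)
    show "0 < real DIM('a) * inverse (diagonal_exit b)" using d by simp
    show "neg_integrable f c" if "0 < c" "c < real DIM('a) * inverse (diagonal_exit b)" for c
    proof -
      have "c * diagonal_exit b < real DIM('a)" using that d by (simp add: field_simps)
      then show ?thesis using ad that unfolding adapted_def fg gb by blast
    qed
    show "\<not> neg_integrable f c" if c: "real DIM('a) * inverse (diagonal_exit b) < c" for c
    proof -
      have "0 < real DIM('a) * inverse (diagonal_exit b)" using d by simp
      then have "0 < c" using c by linarith
      moreover have "real DIM('a) < c * diagonal_exit b" using c d by (simp add: field_simps)
      ultimately show ?thesis unfolding fg gb using not_neg_integrable_above_exit[where a=b, OF \<rho>b(2,1) nzb] by blast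
    qed
  qed
  then show ?thesis using that PF P0 g by blast
qed

text \<open>
  Uniqueness of the expansion identifies the coefficients in the definition of the polyhedron.
\<close>
lemma newton_distance_eq:
  fixes f :: "'a::{real_normed_field,banach} \<times> 'a \<Rightarrow> 'a"
  assumes "has_power_series2 f a 0"
  shows "newton_distance f = inverse (diagonal_exit a)"
  by (simp add: newton_distance_def newton_polyhedron_def diagonal_exit_def newton_hull_def power_series_coeff_eq[OF assms])

lemma newton_hull_swap: "newton_hull (swap_coeffs a) = prod.swap ` newton_hull a"
proof -
  let ?S = "\<lambda>a. \<Union>(p, q)\<in>{pq. a pq \<noteq> 0}. {(s :: real, t :: real). real p \<le> s \<and> real q \<le> t}"
  have "linear (prod.swap :: real \<times> real \<Rightarrow> real \<times> real)"
    by (rule linearI) auto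
  then have "prod.swap ` (convex hull (?S a)) = convex hull (prod.swap ` ?S a)"
    by (rule convex_hull_linear_image)
  moreover have "prod.swap ` ?S a = ?S (swap_coeffs a)"
    by (force simp: image_iff)
  ultimately show ?thesis by (simp add: newton_hull_def)
qed

lemma diagonal_exit_swap: "diagonal_exit (swap_coeffs a) = diagonal_exit a"
proof -
  have "(t, t) \<in> newton_hull (swap_coeffs a) \<longleftrightarrow> (t, t) \<in> newton_hull a" for t
    unfolding newton_hull_swap by (force simp: image_iff)
  then show ?thesis by (simp add: diagonal_exit_def)
qed

lemma has_power_series2_swap:
  fixes f :: "'a::{real_normed_field,banach} \<times> 'a \<Rightarrow> 'a"
  assumes "has_power_series2 f a 0"
  shows "has_power_series2 (\<lambda>(x, y). f (y, x)) (swap_coeffs a) 0"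
  using assms abs_conv_swap unfolding has_power_series2_iff
  by (fastforce simp: double_series_swap)

text \<open>
  Both fields at once: straightenability is the only ingredient that has to be established
  separately for \<real> and \<complex>. The alternative in the form of the coordinate change comes
  from the exchange of coordinates when the diagonal meets a vertical face or an edge with k < 1.
\<close>
theorem critical_index_eq_newton_distance:
  fixes f :: "'a::{real_normed_field,euclidean_space} \<times> 'a \<Rightarrow> 'a"
  assumes st: "\<And>b :: nat \<times> nat \<Rightarrow> 'a. convergent_coeffs b \<Longrightarrow> straightenable b"
    and f: "has_power_series2 f a 0" and nz: "\<not> (\<forall>\<^sub>F z in nhds 0. f z = 0)" and f0: "f 0 = 0"
  shows "\<exists>Q \<Phi>. (\<exists>F. Q has_fps_expansion F) \<and> Q 0 = 0 \<and>
    (\<Phi> = (\<lambda>(x, y). (x - Q y, y)) \<or> \<Phi> = (\<lambda>(x, y). (x, y - Q x))) \<and>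
    critical_integrability_index f = ereal (real DIM('a) * newton_distance (f \<circ> inv \<Phi>))"
proof -
  have conv: "convergent_coeffs a" and ev: "\<forall>\<^sub>F p in nhds (0, 0). f p = double_series a (fst p) (snd p)"
    using f by (auto simp: has_power_series2_eventually_iff)
  have "\<exists>ij. a ij \<noteq> 0"
  proof (rule ccontr)
    assume "\<not> (\<exists>ij. a ij \<noteq> 0)"
    then have "double_series a x y = 0" for x y by (simp add: double_series_def case_prod_unfold)
    then show False using ev nz by (simp add: zero_prod_def)
  qed
  then obtain ij where ij: "a ij \<noteq> 0" by blast
  have a0: "a (0, 0) = 0"
    using eventually_nhds_x_imp_x[OF ev] f0 by (simp add: double_series_zero_zero zero_prod_def)
  obtain Q b where b: "shear_of Q a b \<or> shear_of Q (swap_coeffs a) b" "adapted b"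
    using adapted_shear_exists[where a=a, OF st conv ij] by blast
  from b(1) show ?thesis
  proof
    assume "shear_of Q a b"
    from critical_index_adapted[where a=a, OF f ij a0 this b(2)]
    obtain P F where P: "P has_fps_expansion F" "P 0 = 0" "has_power_series2 (\<lambda>(x, y). f (x, y + P x)) b 0"
      "critical_integrability_index f = ereal (real DIM('a) * inverse (diagonal_exit b))" by blast
    define \<Phi> where "\<Phi> = (\<lambda>(x, y). (x, y - P x))"
    have "inv \<Phi> = (\<lambda>(x, y). (x, y + P x))"
      by (rule inv_equality) (auto simp: \<Phi>_def)
    then have "f \<circ> inv \<Phi> = (\<lambda>(x, y). f (x, y + P x))" by (auto simp: fun_eq_iff)
    then have "newton_distance (f \<circ> inv \<Phi>) = inverse (diagonal_exit b)"
      using newton_distance_eq[OF P(3)] by simp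
    then show ?thesis using P \<Phi>_def by (intro exI[of _ P] exI[of _ \<Phi>]) auto
  next
    assume sh: "shear_of Q (swap_coeffs a) b"
    let ?f = "\<lambda>(x, y). f (y, x)"
    obtain i j where "ij = (i, j)" by force
    then have ij': "swap_coeffs a (j, i) \<noteq> 0" using ij by simp
    have a0': "swap_coeffs a (0, 0) = 0" using a0 by simp
    note f' = has_power_series2_swap[OF f]
    from critical_index_adapted[where a="swap_coeffs a", OF f' ij' a0' sh b(2)]
    obtain P F where P: "P has_fps_expansion F" "P 0 = 0" "has_power_series2 (\<lambda>(x, y). ?f (x, y + P x)) b 0"
      "critical_integrability_index ?f = ereal (real DIM('a) * inverse (diagonal_exit b))" by blast
    obtain \<rho> where \<rho>: "0 < \<rho>" "continuous_on (ball 0 \<rho>) f" by (rule has_power_series2_continuous[OF f])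
    obtain \<rho>' where \<rho>': "0 < \<rho>'" "continuous_on (ball 0 \<rho>') ?f" by (rule has_power_series2_continuous[OF f'])
    have "neg_integrable ?f c \<longleftrightarrow> neg_integrable f c" for c
      using neg_integrable_swap[OF \<rho>(2,1), of c] neg_integrable_swap[OF \<rho>'(2,1), of c] by auto
    then have crit: "critical_integrability_index f = critical_integrability_index ?f"
      unfolding critical_integrability_index_def neg_integrable_def by simp
    define \<Phi> where "\<Phi> = (\<lambda>(x, y). (x - P y, y))"
    have "inv \<Phi> = (\<lambda>(x, y). (x + P y, y))"
      by (rule inv_equality) (auto simp: \<Phi>_def)
    then have "f \<circ> inv \<Phi> = (\<lambda>(x, y). (\<lambda>(x, y). ?f (x, y + P x)) (y, x))" by (auto simp: fun_eq_iff)
    then have "newton_distance (f \<circ> inv \<Phi>) = inverse (diagonal_exit b)"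
      using newton_distance_eq[OF has_power_series2_swap[OF P(3)]] by (simp add: diagonal_exit_swap)
    then show ?thesis using P crit \<Phi>_def by (intro exI[of _ P] exI[of _ \<Phi>]) auto
  qed
qed

theorem theorem1p4:
  "(\<forall>(f :: complex \<times> complex \<Rightarrow> complex) U.
      open U \<longrightarrow> 0 \<in> U \<longrightarrow> holomorphic2_on f U \<longrightarrow>
      \<not> (\<forall>\<^sub>F z in nhds 0. f z = 0) \<longrightarrow> f 0 = 0 \<longrightarrow>
      (\<exists>(Q :: complex \<Rightarrow> complex) \<Phi>.
        Q analytic_on {0} \<and> Q 0 = 0 \<and>
        (\<Phi> = (\<lambda>(x, y). (x - Q y, y)) \<or> \<Phi> = (\<lambda>(x, y). (x, y - Q x))) \<and>
        critical_integrability_index f = ereal (2 * newton_distance (f \<circ> inv \<Phi>))))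
   \<and>
   (\<forall>(f :: real \<times> real \<Rightarrow> real) U.
      open U \<longrightarrow> 0 \<in> U \<longrightarrow> real_analytic2_on f U \<longrightarrow>
      \<not> (\<forall>\<^sub>F z in nhds 0. f z = 0) \<longrightarrow> f 0 = 0 \<longrightarrow>
      (\<exists>(Q :: real \<Rightarrow> real) \<Phi>.
        (\<exists>F. Q has_fps_expansion F) \<and> Q 0 = 0 \<and>
        (\<Phi> = (\<lambda>(x, y). (x - Q y, y)) \<or> \<Phi> = (\<lambda>(x, y). (x, y - Q x))) \<and>
        critical_integrability_index f = ereal (newton_distance (f \<circ> inv \<Phi>))))"
proof (intro conjI allI impI)
  fix f :: "complex \<times> complex \<Rightarrow> complex" and U
  assume f: "open U" "0 \<in> U" "holomorphic2_on f U" "\<not> (\<forall>\<^sub>F z in nhds 0. f z = 0)" "f 0 = 0"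
  obtain a where "has_power_series2 f a 0"
    using holomorphic2_has_power_series[OF f(1-3)] by blast
  from critical_index_eq_newton_distance[OF straightenable_complex this f(4,5)]
  show "\<exists>Q \<Phi>. Q analytic_on {0} \<and> Q 0 = 0 \<and>
      (\<Phi> = (\<lambda>(x, y). (x - Q y, y)) \<or> \<Phi> = (\<lambda>(x, y). (x, y - Q x))) \<and>
      critical_integrability_index f = ereal (2 * newton_distance (f \<circ> inv \<Phi>))"
    using has_fps_expansion_imp_analytic_0 by (simp only: DIM_complex of_nat_numeral) blast
next
  fix f :: "real \<times> real \<Rightarrow> real" and U
  assume f: "open U" "0 \<in> U" "real_analytic2_on f U" "\<not> (\<forall>\<^sub>F z in nhds 0. f z = 0)" "f 0 = 0"
  obtain a where "has_power_series2 f a 0"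
    using f(2,3) by (auto simp: real_analytic2_on_def)
  from critical_index_eq_newton_distance[OF straightenable_real this f(4,5)]
  show "\<exists>Q \<Phi>. (\<exists>F. Q has_fps_expansion F) \<and> Q 0 = 0 \<and>
      (\<Phi> = (\<lambda>(x, y). (x - Q y, y)) \<or> \<Phi> = (\<lambda>(x, y). (x, y - Q x))) \<and>
      critical_integrability_index f = ereal (newton_distance (f \<circ> inv \<Phi>))"
    by simp
qed

end
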